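(* Let $\mathcal{Q}$ be a variety of algebras, given by a signature and a list of defining identities, such that every free Hom-$\mathcal{Q}$-algebra is $\mathbb{N}^+$-graded. Then for every identity $f=0$ satisfied by all $\mathcal{Q}$-algebras, every Hom-$\mathcal{Q}$-algebra satisfies the Hom-type identity obtained from $f=0$.
   Context: All vector spaces are over a field $\mathbb{K}$ of characteristic zero. An algebra is a vector space $A$ with a countable family of multilinear operations $\mu_i:A^{\otimes n_i}\to A$, $n_i\ge 1$ (the signature records the arities $n_i$). A Hom-algebra $(A,\{\mu_i\},\alpha)$ is an algebra together with an endomorphism $\alpha$ of all the operations (so $\alpha\circ\mu_i=\mu_i\circ\alpha^{\otimes n_i}$). A variety of algebras $\mathcal{Q}$ is the class of all algebras of a given signature satisfying a given set of identities; members are called $\mathcal{Q}$-algebras. An identity is written as a linear combination $\sum_i\lambda_i T_i$ of rooted trees, equated to zero. Each internal node $N$ of a tree is labelled by an operation $s$ and has $\sigma(s)$ inputs and one output, where $\sigma(s)$ is the arity of $s$; the leaves are labelled by variables representing elements of the algebra. Write $\sigma(N)$ for the arity of the operation at $N$. The corresponding Hom-type identity is obtained by the following procedure: for every internal node $N$ of every tree $T_i$, apply $\alpha^{\sigma(N)-1}$ to every leaf of $T_i$ which is not comparable to $N$ in the partial order defined by the tree (i.e. every leaf that is not a descendant of $N$); the powers of $\alpha$ coming from different nodes are composed. For example, $(xy)z-x(yz)=0$ becomes $(xy)\alpha(z)-\alpha(x)(yz)=0$. A Hom-$\mathcal{Q}$-algebra is a Hom-algebra of the signature of $\mathcal{Q}$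 satisfying the Hom-type identities of the defining identities of $\mathcal{Q}$. The free Hom-$\mathcal{Q}$-algebra $B(V,\alpha)$ on a vector space $V$ with a linear endomorphism $\alpha$ is the quotient of the free Hom-algebra $F(V,\alpha)$ of that signature by the ideal generated by the Hom-type identities defining Hom-$\mathcal{Q}$-algebras. That it is $\mathbb{N}^+$-graded means that it is graded by the positive integers with generators $V$ in degree $1$, i.e. $B=\bigoplus_{a\ge1}B_a$ with $V$ in degree $1$, $\mu_i(B_{a_1}\otimes\cdots\otimes B_{a_{n_i}})\subseteq B_{a_1+\cdots+a_{n_i}}$ and $\alpha(B_a)\subseteq B_a$. *)

theory Defs
  imports "HOL-Algebra.Module" "HOL-Algebra.AbelCoset"
    "HOL-Library.Sublist" "HOL-Library.Countable_Set"
begin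

section \<open>Algebras with multilinear operations\<close>

record 's signature =
  syms :: "'s set"
  arity :: "'s \<Rightarrow> nat"

definition signature :: "'s signature \<Rightarrow> bool" where
  "signature Sig \<longleftrightarrow> countable (syms Sig) \<and> (\<forall>s\<in>syms Sig. 1 \<le> arity Sig s)"

text \<open>The fields \<open>mult\<close> and \<open>one\<close> that the library's record \<open>module\<close> inherits from \<open>ring\<close> play no
  role: the locale \<open>module\<close> does not mention them, and the operations of an algebra
  are given by \<open>opn\<close>, applied to the list of arguments.\<close>

record ('k, 'a, 's) op_algebra = "('k, 'a) module" +
  opn :: "'s \<Rightarrow> 'a list \<Rightarrow> 'a"

record ('k, 'a, 's) hom_algebra = "('k, 'a, 's) op_algebra" +
  twist :: "'a \<Rightarrow> 'a"

definition char_zero :: "('k, 'n) ring_scheme \<Rightarrow> bool" where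
  "char_zero K \<longleftrightarrow> (\<forall>n::nat. 0 < n \<longrightarrow> [n] \<cdot>\<^bsub>K\<^esub> \<one>\<^bsub>K\<^esub> \<noteq> \<zero>\<^bsub>K\<^esub>)"

definition linear_endo ::
  "('k, 'n) ring_scheme \<Rightarrow> ('k, 'a, 'm) module_scheme \<Rightarrow> ('a \<Rightarrow> 'a) \<Rightarrow> bool" where
  "linear_endo K V \<alpha> \<longleftrightarrow>
     \<alpha> \<in> carrier V \<rightarrow> carrier V \<and>
     (\<forall>x\<in>carrier V. \<forall>y\<in>carrier V. \<alpha> (x \<oplus>\<^bsub>V\<^esub> y) = \<alpha> x \<oplus>\<^bsub>V\<^esub> \<alpha> y) \<and>
     (\<forall>c\<in>carrier K. \<forall>x\<in>carrier V. \<alpha> (c \<odot>\<^bsub>V\<^esub> x) = c \<odot>\<^bsub>V\<^esub> \<alpha> x)"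

definition args :: "('a, 'm) partial_object_scheme \<Rightarrow> nat \<Rightarrow> 'a list set" where
  "args A n = {xs. length xs = n \<and> set xs \<subseteq> carrier A}"

definition multilinear ::
  "('k, 'n) ring_scheme \<Rightarrow> ('k, 'a, 'm) module_scheme \<Rightarrow> nat \<Rightarrow> ('a list \<Rightarrow> 'a) \<Rightarrow> bool" where
  "multilinear K A n m \<longleftrightarrow>
     (\<forall>xs\<in>args A n. m xs \<in> carrier A) \<and>
     (\<forall>xs\<in>args A n. \<forall>i<n. \<forall>x\<in>carrier A. \<forall>y\<in>carrier A.
        m (xs[i := x \<oplus>\<^bsub>A\<^esub> y]) = m (xs[i := x]) \<oplus>\<^bsub>A\<^esub> m (xs[i := y])) \<and>
     (\<forall>xs\<in>args A n. \<forall>i<n. \<forall>c\<in>carrier K. \<forall>x\<in>carrier A.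
        m (xs[i := c \<odot>\<^bsub>A\<^esub> x]) = c \<odot>\<^bsub>A\<^esub> m (xs[i := x]))"

definition op_algebra ::
  "('k, 'n) ring_scheme \<Rightarrow> 's signature \<Rightarrow> ('k, 'a, 's, 'm) op_algebra_scheme \<Rightarrow> bool" where
  "op_algebra K Sig A \<longleftrightarrow>
     module K A \<and> (\<forall>s\<in>syms Sig. multilinear K A (arity Sig s) (opn A s))"

definition hom_algebra ::
  "('k, 'n) ring_scheme \<Rightarrow> 's signature \<Rightarrow> ('k, 'a, 's, 'm) hom_algebra_scheme \<Rightarrow> bool" where
  "hom_algebra K Sig A \<longleftrightarrow>
     op_algebra K Sig A \<and> linear_endo K A (twist A) \<and>
     (\<forall>s\<in>syms Sig. \<forall>xs\<in>args A (arity Sig s).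
        twist A (opn A s xs) = opn A s (map (twist A) xs))"


section \<open>Trees and identities\<close>

datatype (dead 's, leaves: 'v) tree = Leaf 'v | Node 's "('s, 'v) tree list"

fun wf_tree :: "'s signature \<Rightarrow> ('s, 'v) tree \<Rightarrow> bool" where
  "wf_tree Sig (Leaf v) \<longleftrightarrow> True"
| "wf_tree Sig (Node s ts) \<longleftrightarrow>
     s \<in> syms Sig \<and> length ts = arity Sig s \<and> (\<forall>t\<in>set ts. wf_tree Sig t)"

text \<open>The list \<open>[(c\<^sub>1, T\<^sub>1), \<dots>, (c\<^sub>n, T\<^sub>n)]\<close> stands for the identity
  \<open>c\<^sub>1 T\<^sub>1 + \<dots> + c\<^sub>n T\<^sub>n = 0\<close>; the variables of an identity are natural numbers.
  Identities need not be multilinear or homogeneous.\<close>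

type_synonym ('k, 's, 'v) tree_comb = "('k \<times> ('s, 'v) tree) list"
type_synonym ('k, 's) identity = "('k, 's, nat) tree_comb"

definition identity ::
  "('k, 'n) ring_scheme \<Rightarrow> 's signature \<Rightarrow> ('k, 's) identity \<Rightarrow> bool" where
  "identity K Sig f \<longleftrightarrow> (\<forall>(c, T)\<in>set f. c \<in> carrier K \<and> wf_tree Sig T)"

primrec eval_tree ::
  "('k, 'a, 's, 'm) op_algebra_scheme \<Rightarrow> ('v \<Rightarrow> 'a) \<Rightarrow> ('s, 'v) tree \<Rightarrow> 'a" where
  "eval_tree A \<theta> (Leaf v) = \<theta> v"
| "eval_tree A \<theta> (Node s ts) = opn A s (map (eval_tree A \<theta>) ts)"

definition eval_comb ::
  "('k, 'a, 's, 'm) op_algebra_scheme \<Rightarrow> ('v \<Rightarrow> 'a) \<Rightarrow> ('k, 's, 'v) tree_comb \<Rightarrow> 'a" where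
  "eval_comb A \<theta> f = foldr (\<lambda>(c, T) z. (c \<odot>\<^bsub>A\<^esub> eval_tree A \<theta> T) \<oplus>\<^bsub>A\<^esub> z) f \<zero>\<^bsub>A\<^esub>"

definition satisfies ::
  "('k, 'a, 's, 'm) op_algebra_scheme \<Rightarrow> ('k, 's) identity \<Rightarrow> bool" where
  "satisfies A f \<longleftrightarrow> (\<forall>\<theta> \<in> UNIV \<rightarrow> carrier A. eval_comb A \<theta> f = \<zero>\<^bsub>A\<^esub>)"

text \<open>\<open>Q\<close>-algebras, for the variety \<open>Q\<close> of signature \<open>Sig\<close> defined by the set \<open>I\<close> of identities.\<close>

definition variety_algebra ::
  "('k, 'n) ring_scheme \<Rightarrow> 's signature \<Rightarrow> ('k, 's) identity set
    \<Rightarrow> ('k, 'a, 's, 'm) op_algebra_scheme \<Rightarrow> bool" where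
  "variety_algebra K Sig I A \<longleftrightarrow> op_algebra K Sig A \<and> (\<forall>f\<in>I. satisfies A f)"


section \<open>Hom-type identities\<close>

text \<open>A node or leaf of a tree is addressed by its path from the root, the list of the positions
  (counted from 0) of the successive children. So the descendants of a node are those nodes and
  leaves whose path has the path of the node as a prefix.\<close>

primrec internal_nodes :: "('s, 'v) tree \<Rightarrow> (nat list \<times> 's) list" where
  "internal_nodes (Leaf v) = []"
| "internal_nodes (Node s ts) =
     ([], s) # concat (map2 (\<lambda>i. map (\<lambda>(p, r). (i # p, r))) [0..<length ts] (map internal_nodes ts))"

definition leaf_exponent :: "'s signature \<Rightarrow> ('s, 'v) tree \<Rightarrow> nat list \<Rightarrow> nat" where
  "leaf_exponent Sig T p =
     (\<Sum>(q, s)\<leftarrow>internal_nodes T. if prefix q p then 0 else arity Sig s - 1)"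

primrec relabel_leaves :: "('s, 'v) tree \<Rightarrow> (nat list \<Rightarrow> 'v \<Rightarrow> 'w) \<Rightarrow> ('s, 'w) tree" where
  "relabel_leaves (Leaf v) = (\<lambda>g. Leaf (g [] v))"
| "relabel_leaves (Node s ts) =
     (\<lambda>g. Node s (map2 (\<lambda>i r. r (\<lambda>p. g (i # p))) [0..<length ts] (map relabel_leaves ts)))"

text \<open>In a Hom-type identity a leaf label \<open>(n, v)\<close> stands for the \<open>n\<close>-th power of the twisting map
  applied to the variable \<open>v\<close>.\<close>

definition hom_tree :: "'s signature \<Rightarrow> ('s, 'v) tree \<Rightarrow> ('s, nat \<times> 'v) tree" where
  "hom_tree Sig T = relabel_leaves T (\<lambda>p v. (leaf_exponent Sig T p, v))"

definition hom_type ::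
  "'s signature \<Rightarrow> ('k, 's, 'v) tree_comb \<Rightarrow> ('k, 's, nat \<times> 'v) tree_comb" where
  "hom_type Sig f = map (\<lambda>(c, T). (c, hom_tree Sig T)) f"

definition eval_hom_comb ::
  "('k, 'a, 's, 'm) hom_algebra_scheme \<Rightarrow> ('v \<Rightarrow> 'a) \<Rightarrow> ('k, 's, nat \<times> 'v) tree_comb \<Rightarrow> 'a" where
  "eval_hom_comb A \<theta> g = eval_comb A (\<lambda>(n, v). (twist A ^^ n) (\<theta> v)) g"

definition satisfies_hom_type ::
  "'s signature \<Rightarrow> ('k, 'a, 's, 'm) hom_algebra_scheme \<Rightarrow> ('k, 's) identity \<Rightarrow> bool" where
  "satisfies_hom_type Sig A f \<longleftrightarrow>
     (\<forall>\<theta> \<in> UNIV \<rightarrow> carrier A. eval_hom_comb A \<theta> (hom_type Sig f) = \<zero>\<^bsub>A\<^esub>)"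

definition hom_variety_algebra ::
  "('k, 'n) ring_scheme \<Rightarrow> 's signature \<Rightarrow> ('k, 's) identity set
    \<Rightarrow> ('k, 'a, 's, 'm) hom_algebra_scheme \<Rightarrow> bool" where
  "hom_variety_algebra K Sig I A \<longleftrightarrow>
     hom_algebra K Sig A \<and> (\<forall>f\<in>I. satisfies_hom_type Sig A f)"


section \<open>Ideals and quotients of Hom-algebras\<close>

definition hom_ideal ::
  "('k, 'n) ring_scheme \<Rightarrow> 's signature \<Rightarrow> ('k, 'a, 's, 'm) hom_algebra_scheme
    \<Rightarrow> 'a set \<Rightarrow> bool" where
  "hom_ideal K Sig A J \<longleftrightarrow>
     submodule J K A \<and>
     (\<forall>s\<in>syms Sig. \<forall>xs\<in>args A (arity Sig s). set xs \<inter> J \<noteq> {} \<longrightarrow> opn A s xs \<in> J) \<and>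
     twist A ` J \<subseteq> J"

definition generated_ideal ::
  "('k, 'n) ring_scheme \<Rightarrow> 's signature \<Rightarrow> ('k, 'a, 's, 'm) hom_algebra_scheme
    \<Rightarrow> 'a set \<Rightarrow> 'a set" where
  "generated_ideal K Sig A S = \<Inter>{J. hom_ideal K Sig A J \<and> S \<subseteq> J}"

text \<open>The unions below are over the representatives of the cosets; if \<open>J\<close> is an ideal, all choices
  of representatives give the same coset.\<close>

definition quotient_algebra ::
  "('k, 'a, 's) hom_algebra \<Rightarrow> 'a set \<Rightarrow> ('k, 'a set, 's) hom_algebra" where
  "quotient_algebra A J =
     \<lparr> carrier = a_rcosets\<^bsub>A\<^esub> J,
       mult = undefined, one = undefined,
       zero = J, add = (\<lambda>X Y. X <+>\<^bsub>A\<^esub> Y),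
       smult = (\<lambda>c X. \<Union>x\<in>X. J +>\<^bsub>A\<^esub> (c \<odot>\<^bsub>A\<^esub> x)),
       opn = (\<lambda>s Xs. \<Union>xs\<in>{xs. list_all2 (\<in>) xs Xs}. J +>\<^bsub>A\<^esub> opn A s xs),
       twist = (\<lambda>X. \<Union>x\<in>X. J +>\<^bsub>A\<^esub> twist A x) \<rparr>"


section \<open>Free Hom-algebras\<close>

text \<open>\<open>tree_algebra K Sig V \<alpha>\<close> is the space of formal linear combinations (finitely supported
  functions) of trees with leaves in the set \<open>carrier V\<close>. The operations are the multilinear
  extensions of grafting, and the twisting map applies \<open>\<alpha>\<close> to every leaf. The linear structure of
  \<open>V\<close> is not yet taken into account.\<close>

definition tree_algebra ::
  "('k, 'n) ring_scheme \<Rightarrow> 's signature \<Rightarrow> ('k, 'v, 'm) module_scheme \<Rightarrow> ('v \<Rightarrow> 'v)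
    \<Rightarrow> ('k, ('s, 'v) tree \<Rightarrow> 'k, 's) hom_algebra" where
  "tree_algebra K Sig V \<alpha> =
     \<lparr> carrier = {p. (\<forall>t. p t \<in> carrier K) \<and> finite {t. p t \<noteq> \<zero>\<^bsub>K\<^esub>} \<and>
                     (\<forall>t. p t \<noteq> \<zero>\<^bsub>K\<^esub> \<longrightarrow> wf_tree Sig t \<and> leaves t \<subseteq> carrier V)},
       mult = undefined, one = undefined,
       zero = (\<lambda>t. \<zero>\<^bsub>K\<^esub>), add = (\<lambda>p q t. p t \<oplus>\<^bsub>K\<^esub> q t),
       smult = (\<lambda>c p t. c \<otimes>\<^bsub>K\<^esub> p t),
       opn = (\<lambda>s ps t. case t of
                Leaf v \<Rightarrow> \<zero>\<^bsub>K\<^esub>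
              | Node r ts \<Rightarrow>
                  if r = s \<and> length ts = length ps
                  then foldr (\<lambda>(p, u) z. p u \<otimes>\<^bsub>K\<^esub> z) (zip ps ts) \<one>\<^bsub>K\<^esub>
                  else \<zero>\<^bsub>K\<^esub>),
       twist = (\<lambda>p t. \<Oplus>\<^bsub>K\<^esub>u\<in>{u. p u \<noteq> \<zero>\<^bsub>K\<^esub> \<and> map_tree \<alpha> u = t}. p u) \<rparr>"

definition single_leaf :: "('k, 'n) ring_scheme \<Rightarrow> 'v \<Rightarrow> ('s, 'v) tree \<Rightarrow> 'k" where
  "single_leaf K v = (\<lambda>t. if t = Leaf v then \<one>\<^bsub>K\<^esub> else \<zero>\<^bsub>K\<^esub>)"

text \<open>The elements that have to vanish for the map from \<open>V\<close> sending \<open>v\<close> to the leaf \<open>v\<close>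
  to become linear.\<close>

definition leaf_relations ::
  "('k, 'n) ring_scheme \<Rightarrow> 's signature \<Rightarrow> ('k, 'v, 'm) module_scheme \<Rightarrow> ('v \<Rightarrow> 'v)
    \<Rightarrow> (('s, 'v) tree \<Rightarrow> 'k) set" where
  "leaf_relations K Sig V \<alpha> =
     (let T = tree_algebra K Sig V \<alpha> in
      {single_leaf K (x \<oplus>\<^bsub>V\<^esub> y) \<ominus>\<^bsub>T\<^esub> (single_leaf K x \<oplus>\<^bsub>T\<^esub> single_leaf K y) | x y.
         x \<in> carrier V \<and> y \<in> carrier V} \<union>
      {single_leaf K (c \<odot>\<^bsub>V\<^esub> x) \<ominus>\<^bsub>T\<^esub> c \<odot>\<^bsub>T\<^esub> single_leaf K x | c x.
         c \<in> carrier K \<and> x \<in> carrier V})"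

definition linearity_ideal ::
  "('k, 'n) ring_scheme \<Rightarrow> 's signature \<Rightarrow> ('k, 'v, 'm) module_scheme \<Rightarrow> ('v \<Rightarrow> 'v)
    \<Rightarrow> (('s, 'v) tree \<Rightarrow> 'k) set" where
  "linearity_ideal K Sig V \<alpha> =
     generated_ideal K Sig (tree_algebra K Sig V \<alpha>) (leaf_relations K Sig V \<alpha>)"

text \<open>The free Hom-algebra \<open>F(V, \<alpha>)\<close>.\<close>

definition free_hom_algebra ::
  "('k, 'n) ring_scheme \<Rightarrow> 's signature \<Rightarrow> ('k, 'v, 'm) module_scheme \<Rightarrow> ('v \<Rightarrow> 'v)
    \<Rightarrow> ('k, (('s, 'v) tree \<Rightarrow> 'k) set, 's) hom_algebra" where
  "free_hom_algebra K Sig V \<alpha> =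
     quotient_algebra (tree_algebra K Sig V \<alpha>) (linearity_ideal K Sig V \<alpha>)"

definition free_hom_inclusion ::
  "('k, 'n) ring_scheme \<Rightarrow> 's signature \<Rightarrow> ('k, 'v, 'm) module_scheme \<Rightarrow> ('v \<Rightarrow> 'v)
    \<Rightarrow> 'v \<Rightarrow> (('s, 'v) tree \<Rightarrow> 'k) set" where
  "free_hom_inclusion K Sig V \<alpha> v =
     linearity_ideal K Sig V \<alpha> +>\<^bsub>tree_algebra K Sig V \<alpha>\<^esub> single_leaf K v"

definition hom_identity_values ::
  "'s signature \<Rightarrow> ('k, 's) identity set \<Rightarrow> ('k, 'a, 's, 'm) hom_algebra_scheme \<Rightarrow> 'a set" where
  "hom_identity_values Sig I A =
     {eval_hom_comb A \<theta> (hom_type Sig f) | f \<theta>. f \<in> I \<and> \<theta> \<in> UNIV \<rightarrow> carrier A}"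

definition hom_variety_ideal ::
  "('k, 'n) ring_scheme \<Rightarrow> 's signature \<Rightarrow> ('k, 's) identity set
    \<Rightarrow> ('k, 'v, 'm) module_scheme \<Rightarrow> ('v \<Rightarrow> 'v) \<Rightarrow> (('s, 'v) tree \<Rightarrow> 'k) set set" where
  "hom_variety_ideal K Sig I V \<alpha> =
     generated_ideal K Sig (free_hom_algebra K Sig V \<alpha>)
       (hom_identity_values Sig I (free_hom_algebra K Sig V \<alpha>))"

text \<open>The free Hom-\<open>Q\<close>-algebra \<open>B(V, \<alpha>)\<close> and the image of \<open>V\<close> in it.\<close>

definition free_hom_variety_algebra ::
  "('k, 'n) ring_scheme \<Rightarrow> 's signature \<Rightarrow> ('k, 's) identity set
    \<Rightarrow> ('k, 'v, 'm) module_scheme \<Rightarrow> ('v \<Rightarrow> 'v)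
    \<Rightarrow> ('k, (('s, 'v) tree \<Rightarrow> 'k) set set, 's) hom_algebra" where
  "free_hom_variety_algebra K Sig I V \<alpha> =
     quotient_algebra (free_hom_algebra K Sig V \<alpha>) (hom_variety_ideal K Sig I V \<alpha>)"

definition free_hom_variety_generators ::
  "('k, 'n) ring_scheme \<Rightarrow> 's signature \<Rightarrow> ('k, 's) identity set
    \<Rightarrow> ('k, 'v, 'm) module_scheme \<Rightarrow> ('v \<Rightarrow> 'v) \<Rightarrow> (('s, 'v) tree \<Rightarrow> 'k) set set set" where
  "free_hom_variety_generators K Sig I V \<alpha> =
     (\<lambda>v. hom_variety_ideal K Sig I V \<alpha> +>\<^bsub>free_hom_algebra K Sig V \<alpha>\<^esub>
            free_hom_inclusion K Sig V \<alpha> v) ` carrier V"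


section \<open>Gradings by the positive integers\<close>

definition pos_grading ::
  "('k, 'n) ring_scheme \<Rightarrow> 's signature \<Rightarrow> ('k, 'a, 's, 'm) hom_algebra_scheme \<Rightarrow> 'a set
    \<Rightarrow> (nat \<Rightarrow> 'a set) \<Rightarrow> bool" where
  "pos_grading K Sig A G D \<longleftrightarrow>
     (\<forall>a\<ge>1. submodule (D a) K A) \<and>
     (\<forall>x\<in>carrier A. \<exists>!c. c \<in> (\<Pi>\<^sub>E a\<in>{1..}. D a) \<and>
        finite {a\<in>{1..}. c a \<noteq> \<zero>\<^bsub>A\<^esub>} \<and>
        x = (\<Oplus>\<^bsub>A\<^esub>a\<in>{a\<in>{1..}. c a \<noteq> \<zero>\<^bsub>A\<^esub>}. c a)) \<and>
     G \<subseteq> D 1 \<and>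
     (\<forall>s\<in>syms Sig. \<forall>as xs. length as = arity Sig s \<and>
        list_all2 (\<lambda>a x. 1 \<le> a \<and> x \<in> D a) as xs \<longrightarrow> opn A s xs \<in> D (sum_list as)) \<and>
     (\<forall>a\<ge>1. twist A ` D a \<subseteq> D a)"

definition pos_graded ::
  "('k, 'n) ring_scheme \<Rightarrow> 's signature \<Rightarrow> ('k, 'a, 's, 'm) hom_algebra_scheme \<Rightarrow> 'a set
    \<Rightarrow> bool" where
  "pos_graded K Sig A G \<longleftrightarrow> (\<exists>D. pos_grading K Sig A G D)"

end

theory Submission
  imports Defs
begin

text \<open>
  Suppose that the twisting map \<open>\<alpha>\<close> of a Hom-\<open>Q\<close>-algebra \<open>A\<close> is bijective and that all trees of an
  identity have the same number of leaves. Then the Hom-type of the identity in \<open>A\<close> is, up to a power of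
  \<open>\<alpha>\<close>, the original identity for the operations \<open>\<alpha>^(1 - n) \<circ> \<mu>\<close>, where \<open>n\<close> is the arity of
  \<open>\<mu>\<close>. So identities could be exchanged with Hom-type identities. In general \<open>\<alpha>\<close> is
  not even injective, and inverting it would prove Hom-type identities only after
  some power of \<open>\<alpha>\<close> has been applied to them. The proof therefore inverts \<open>\<alpha>\<close> only formally: the
  missing powers are remembered as a degree. On the finitely supported sequences \<open>\<Sum> x\<^sub>b t\<^sup>b\<close> over
  \<open>A\<close>, where \<open>x t\<^sup>b\<close> plays the role of \<open>\<alpha>\<close> to the power \<open>-b\<close> applied to \<open>x\<close>, the operations
  that send \<open>x\<^sub>1, \<dots>, x\<^sub>n\<close> in degrees \<open>b\<^sub>1, \<dots>, b\<^sub>n\<close> to \<open>\<mu>(y\<^sub>1, \<dots>, y\<^sub>n)\<close> in degree \<open>b\<^sub>1 + \<dots> + b\<^sub>n + n - 1\<close>, with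
  \<open>\<alpha>\<close> applied \<open>\<Sum>\<^sub>j\<^sub>\<noteq>\<^sub>i b\<^sub>j\<close> times to \<open>x\<^sub>i\<close> to give \<open>y\<^sub>i\<close>, need nonnegative powers of \<open>\<alpha>\<close> only. Call this algebra
  untwisted. The whole argument rests on two facts about it.

  Let the weight of a tree be the sum of \<open>n - 1\<close> over its nodes, that is, its number of leaves minus
  one. At constants, a tree has in the untwisted algebra the value of the corresponding Hom-type
  tree in \<open>A\<close>, placed in the degree given by the weight (\<open>eval_untwisted_constant\<close>). So the
  Hom-type of every identity of the untwisted algebra holds in \<open>A\<close>
  (\<open>satisfies_hom_type_if_untwisted\<close>), and it remains to see that the untwisted algebra is a
  \<open>Q\<close>-algebra.

  At arbitrary sequences, the coefficients of the value of a tree are those of the Hom-type tree in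
  the algebra of polynomials \<open>A[t]\<close>, where \<open>\<alpha>\<close> acts on the coefficients, moved up by the
  weight (\<open>eval_untwisted_shift\<close>). Trees of different weight are moved by different
  amounts, so this gives a defining identity \<open>g\<close> in the untwisted algebra if the Hom-type of each
  homogeneous component of \<open>g\<close> holds in \<open>A[t]\<close> (\<open>untwisted_satisfies\<close>). It holds there if it holds
  in \<open>A\<close>: setting \<open>t\<close> to a scalar is a morphism from \<open>A[t]\<close> to \<open>A\<close>, and a polynomial that vanishes at
  all scalars is zero in characteristic zero (\<open>polynomials_satisfy\<close>).

  The grading gives the homogeneous components. In the free Hom-\<open>Q\<close>-algebra on the vector
  space \<open>A\<close>, the components of \<open>g\<close> take values in different degrees at generators, and these values add up
  to zero; hence each of them is zero, and so is its image in \<open>A\<close> under the morphism that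
  extends the identity of \<open>A\<close> (\<open>hom_variety_satisfies_component\<close>).

  The identity \<open>f\<close> is assumed for the \<open>Q\<close>-algebras on one fixed type, which contains \<open>A\<close>, while the
  untwisted algebra consists of sequences. If \<open>A\<close> is not zero, this type is infinite, so the
  finitely supported sequences can be coded in it, and the structure is transported.
\<close>

section \<open>Linear and multilinear maps\<close>

definition linear_map ::
  "('k, 'n) ring_scheme \<Rightarrow> ('k, 'a, 'm) module_scheme \<Rightarrow> ('k, 'b, 'l) module_scheme
    \<Rightarrow> ('a \<Rightarrow> 'b) \<Rightarrow> bool" where
  "linear_map K M N \<phi> \<longleftrightarrow>
     \<phi> \<in> carrier M \<rightarrow> carrier N \<and>
     (\<forall>x\<in>carrier M. \<forall>y\<in>carrier M. \<phi> (x \<oplus>\<^bsub>M\<^esub> y) = \<phi> x \<oplus>\<^bsub>N\<^esub> \<phi> y) \<and>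
     (\<forall>c\<in>carrier K. \<forall>x\<in>carrier M. \<phi> (c \<odot>\<^bsub>M\<^esub> x) = c \<odot>\<^bsub>N\<^esub> \<phi> x)"

definition multilinear_map ::
  "('k, 'n) ring_scheme \<Rightarrow> ('k, 'a, 'm) module_scheme \<Rightarrow> ('k, 'b, 'l) module_scheme
    \<Rightarrow> nat \<Rightarrow> ('a list \<Rightarrow> 'b) \<Rightarrow> bool" where
  "multilinear_map K M N n m \<longleftrightarrow>
     (\<forall>xs\<in>args M n. m xs \<in> carrier N) \<and>
     (\<forall>xs\<in>args M n. \<forall>i<n. \<forall>x\<in>carrier M. \<forall>y\<in>carrier M.
        m (xs[i := x \<oplus>\<^bsub>M\<^esub> y]) = m (xs[i := x]) \<oplus>\<^bsub>N\<^esub> m (xs[i := y])) \<and>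
     (\<forall>xs\<in>args M n. \<forall>i<n. \<forall>c\<in>carrier K. \<forall>x\<in>carrier M.
        m (xs[i := c \<odot>\<^bsub>M\<^esub> x]) = c \<odot>\<^bsub>N\<^esub> m (xs[i := x]))"

text \<open>Submodules instead of linear combinations, since two linear maps are compared on the submodule
  where they agree.\<close>

definition spanning ::
  "('k, 'n) ring_scheme \<Rightarrow> ('k, 'a, 'm) module_scheme \<Rightarrow> 'a set \<Rightarrow> bool" where
  "spanning K M S \<longleftrightarrow>
     S \<subseteq> carrier M \<and> (\<forall>H. submodule H K M \<longrightarrow> S \<subseteq> H \<longrightarrow> carrier M \<subseteq> H)"

definition op_morphism ::
  "('k, 'n) ring_scheme \<Rightarrow> 's signature \<Rightarrow> ('k, 'a, 's, 'm) op_algebra_scheme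
    \<Rightarrow> ('k, 'b, 's, 'l) op_algebra_scheme \<Rightarrow> ('a \<Rightarrow> 'b) \<Rightarrow> bool" where
  "op_morphism K Sig A B \<phi> \<longleftrightarrow>
     linear_map K A B \<phi> \<and>
     (\<forall>s\<in>syms Sig. \<forall>xs\<in>args A (arity Sig s). \<phi> (opn A s xs) = opn B s (map \<phi> xs))"

definition hom_morphism ::
  "('k, 'n) ring_scheme \<Rightarrow> 's signature \<Rightarrow> ('k, 'a, 's, 'm) hom_algebra_scheme
    \<Rightarrow> ('k, 'b, 's, 'l) hom_algebra_scheme \<Rightarrow> ('a \<Rightarrow> 'b) \<Rightarrow> bool" where
  "hom_morphism K Sig A B \<phi> \<longleftrightarrow>
     op_morphism K Sig A B \<phi> \<and> (\<forall>x\<in>carrier A. \<phi> (twist A x) = twist B (\<phi> x))"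

lemma multilinear_iff: "multilinear K A n m \<longleftrightarrow> multilinear_map K A A n m"
  by (simp add: multilinear_def multilinear_map_def)

lemma linear_endo_iff: "linear_endo K V \<alpha> \<longleftrightarrow> linear_map K V V \<alpha>"
  by (simp add: linear_endo_def linear_map_def)

lemma args_update: "xs \<in> args M n \<Longrightarrow> x \<in> carrier M \<Longrightarrow> xs[i := x] \<in> args M n"
  using set_update_subset_insert by (fastforce simp: args_def)

lemma args_nth: "xs \<in> args M n \<Longrightarrow> i < n \<Longrightarrow> xs ! i \<in> carrier M"
  by (auto simp: args_def)

lemma args_map:
  "xs \<in> args M n \<Longrightarrow> \<phi> \<in> carrier M \<rightarrow> carrier N \<Longrightarrow> map \<phi> xs \<in> args N n"
  by (auto simp: args_def)

lemma linear_mapD: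
  assumes "linear_map K M N \<phi>"
  shows "x \<in> carrier M \<Longrightarrow> \<phi> x \<in> carrier N"
    and "x \<in> carrier M \<Longrightarrow> y \<in> carrier M \<Longrightarrow> \<phi> (x \<oplus>\<^bsub>M\<^esub> y) = \<phi> x \<oplus>\<^bsub>N\<^esub> \<phi> y"
    and "c \<in> carrier K \<Longrightarrow> x \<in> carrier M \<Longrightarrow> \<phi> (c \<odot>\<^bsub>M\<^esub> x) = c \<odot>\<^bsub>N\<^esub> \<phi> x"
  using assms by (auto simp: linear_map_def)

lemma linear_map_zero:
  assumes "module K M" "module K N" "linear_map K M N \<phi>"
  shows "\<phi> \<zero>\<^bsub>M\<^esub> = \<zero>\<^bsub>N\<^esub>"
proof -
  interpret M: module K M by fact
  interpret N: module K N by fact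
  have "\<phi> (\<zero>\<^bsub>K\<^esub> \<odot>\<^bsub>M\<^esub> \<zero>\<^bsub>M\<^esub>) = \<zero>\<^bsub>K\<^esub> \<odot>\<^bsub>N\<^esub> \<phi> \<zero>\<^bsub>M\<^esub>"
    using linear_mapD[OF assms(3)] by blast
  thus ?thesis using linear_mapD(1)[OF assms(3)] by simp
qed

lemma linear_map_minus:
  assumes "module K M" "module K N" "linear_map K M N \<phi>" "x \<in> carrier M"
  shows "\<phi> (\<ominus>\<^bsub>M\<^esub> x) = \<ominus>\<^bsub>N\<^esub> \<phi> x"
proof -
  interpret M: module K M by fact
  interpret N: module K N by fact
  have "\<phi> (\<ominus>\<^bsub>M\<^esub> x) \<oplus>\<^bsub>N\<^esub> \<phi> x = \<phi> (\<ominus>\<^bsub>M\<^esub> x \<oplus>\<^bsub>M\<^esub> x)"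
    using assms(4) by (simp add: linear_mapD[OF assms(3)])
  also have "\<dots> = \<zero>\<^bsub>N\<^esub>" using assms(4) by (simp add: M.M.l_neg linear_map_zero[OF assms(1-3)])
  finally show ?thesis
    using assms(4) by (simp add: N.M.minus_equality linear_mapD[OF assms(3)])
qed

lemma linear_map_funpow: "linear_map K M M \<phi> \<Longrightarrow> linear_map K M M (\<phi> ^^ n)"
  by (induction n) (auto simp: linear_map_def Pi_def)

lemma linear_map_comp:
  "linear_map K M N \<phi> \<Longrightarrow> linear_map K N P \<psi> \<Longrightarrow> linear_map K M P (\<lambda>x. \<psi> (\<phi> x))"
  by (auto simp: linear_map_def Pi_def)

lemma linear_map_finsum:
  assumes "module K M" "module K N" "linear_map K M N \<phi>" "f \<in> X \<rightarrow> carrier M"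
  shows "\<phi> (finsum M f X) = finsum N (\<lambda>x. \<phi> (f x)) X"
proof -
  interpret M: module K M by fact
  interpret N: module K N by fact
  show ?thesis using assms(4)
  proof (induction X rule: infinite_finite_induct)
    case (infinite X) thus ?case by (simp add: linear_map_zero[OF assms(1-3)])
  next
    case empty thus ?case by (simp add: linear_map_zero[OF assms(1-3)])
  next
    case (insert x X)
    have f: "f \<in> X \<rightarrow> carrier M" "f x \<in> carrier M" using insert.prems by auto
    have g: "(\<lambda>x. \<phi> (f x)) \<in> X \<rightarrow> carrier N" "\<phi> (f x) \<in> carrier N"
      using f linear_mapD(1)[OF assms(3)] by auto
    show ?case using insert f g by (simp add: linear_mapD[OF assms(3)])
  qed
qed

lemma multilinear_mapD:
  assumes "multilinear_map K M N n m" "xs \<in> args M n"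
  shows "m xs \<in> carrier N"
    and "i < n \<Longrightarrow> x \<in> carrier M \<Longrightarrow> y \<in> carrier M \<Longrightarrow>
      m (xs[i := x \<oplus>\<^bsub>M\<^esub> y]) = m (xs[i := x]) \<oplus>\<^bsub>N\<^esub> m (xs[i := y])"
    and "i < n \<Longrightarrow> c \<in> carrier K \<Longrightarrow> x \<in> carrier M \<Longrightarrow>
      m (xs[i := c \<odot>\<^bsub>M\<^esub> x]) = c \<odot>\<^bsub>N\<^esub> m (xs[i := x])"
  using assms by (auto simp: multilinear_map_def)

lemma multilinear_map_linear_at:
  assumes "multilinear_map K M N n m" "xs \<in> args M n" "i < n"
  shows "linear_map K M N (\<lambda>x. m (xs[i := x]))"
  unfolding linear_map_def
  using multilinear_mapD[OF assms(1)] args_update[OF assms(2)] assms(2,3) by auto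

lemma multilinear_map_zero:
  assumes "module K M" "module K N" "multilinear_map K M N n m" "xs \<in> args M n"
    and "i < n" "xs ! i = \<zero>\<^bsub>M\<^esub>"
  shows "m xs = \<zero>\<^bsub>N\<^esub>"
  using linear_map_zero[OF assms(1,2) multilinear_map_linear_at[OF assms(3,4,5)]] assms(6)
  by (metis list_update_id)

lemma multilinear_map_compose_linear:
  assumes "multilinear_map K M N n m" "linear_map K N P \<phi>"
  shows "multilinear_map K M P n (\<lambda>xs. \<phi> (m xs))"
  unfolding multilinear_map_def
  using multilinear_mapD[OF assms(1)] linear_mapD[OF assms(2)] args_update[of _ M n]
  by auto

lemma multilinear_map_map2_linear:
  assumes "multilinear_map K N P n m" "\<And>i. i < n \<Longrightarrow> linear_map K M N (\<phi> i)"
  shows "multilinear_map K M P n (\<lambda>xs. m (map2 \<phi> [0..<n] xs))"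
proof -
  have in_args: "map2 \<phi> [0..<n] xs \<in> args N n" if "xs \<in> args M n" for xs
    using that linear_mapD(1)[OF assms(2)] by (auto simp: args_def set_zip subset_iff in_set_conv_nth)
  have upd: "map2 \<phi> [0..<n] (xs[i := x]) = (map2 \<phi> [0..<n] xs)[i := \<phi> i x]"
    if "xs \<in> args M n" "i < n" for xs i x
    using that by (intro nth_equalityI) (auto simp: args_def nth_list_update)
  show ?thesis
    unfolding multilinear_map_def
    using multilinear_mapD[OF assms(1)] linear_mapD[OF assms(2)] in_args
    by (auto simp: upd)
qed

lemma multilinear_map_map_linear:
  assumes "multilinear_map K N P n m" "linear_map K M N \<phi>"
  shows "multilinear_map K M P n (\<lambda>xs. m (map \<phi> xs))"
  unfolding multilinear_map_def
  using multilinear_mapD[OF assms(1)] linear_mapD[OF assms(2)] args_map[of _ M n \<phi> N]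
  by (auto simp: map_update Pi_def)

lemma multilinear_map_finsum:
  assumes "module K M" "module K N" "\<And>x. x \<in> X \<Longrightarrow> multilinear_map K M N n (m x)"
  shows "multilinear_map K M N n (\<lambda>xs. finsum N (\<lambda>x. m x xs) X)"
proof (cases "finite X")
  case True
  interpret M: module K M by fact
  interpret N: module K N by fact
  have cl: "(\<lambda>x. m x xs) \<in> X \<rightarrow> carrier N" if "xs \<in> args M n" for xs
    using multilinear_mapD(1)[OF assms(3)] that by auto
  have add: "finsum N (\<lambda>j. m j (xs[i := x \<oplus>\<^bsub>M\<^esub> y])) X =
      finsum N (\<lambda>j. m j (xs[i := x])) X \<oplus>\<^bsub>N\<^esub> finsum N (\<lambda>j. m j (xs[i := y])) X"
    if "xs \<in> args M n" "i < n" "x \<in> carrier M" "y \<in> carrier M" for xs i x y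
  proof -
    have "finsum N (\<lambda>j. m j (xs[i := x \<oplus>\<^bsub>M\<^esub> y])) X =
        finsum N (\<lambda>j. m j (xs[i := x]) \<oplus>\<^bsub>N\<^esub> m j (xs[i := y])) X"
      using cl args_update[OF that(1)] that multilinear_mapD(2)[OF assms(3)]
      by (intro N.M.finsum_cong') (auto simp: Pi_iff)
    thus ?thesis using cl args_update[OF that(1)] that by (simp add: N.M.finsum_addf)
  qed
  have sm: "finsum N (\<lambda>j. m j (xs[i := c \<odot>\<^bsub>M\<^esub> x])) X =
      c \<odot>\<^bsub>N\<^esub> finsum N (\<lambda>j. m j (xs[i := x])) X"
    if "xs \<in> args M n" "i < n" "x \<in> carrier M" "c \<in> carrier K" for xs i x c
  proof -
    have "finsum N (\<lambda>j. m j (xs[i := c \<odot>\<^bsub>M\<^esub> x])) X =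
        finsum N (\<lambda>j. c \<odot>\<^bsub>N\<^esub> m j (xs[i := x])) X"
      using cl args_update[OF that(1)] that multilinear_mapD(3)[OF assms(3)]
      by (intro N.M.finsum_cong') (auto simp: Pi_iff)
    thus ?thesis using cl args_update[OF that(1)] that True
      by (simp add: N.finsum_smult_ldistr)
  qed
  show ?thesis unfolding multilinear_map_def using cl add sm by auto
next
  case False
  interpret M: module K M by fact
  interpret N: module K N by fact
  show ?thesis using False by (auto simp: multilinear_map_def)
qed

lemma linear_map_args:
  "linear_map K M N \<phi> \<Longrightarrow> xs \<in> args M n \<Longrightarrow> map \<phi> xs \<in> args N n"
  by (auto simp: args_def linear_map_def)

lemma linear_map_eqI:
  assumes "module K M" "module K N" "spanning K M S"
    and l: "linear_map K M N \<phi>" and l': "linear_map K M N \<psi>"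
    and "\<And>x. x \<in> S \<Longrightarrow> \<phi> x = \<psi> x" and "x \<in> carrier M"
  shows "\<phi> x = \<psi> x"
proof -
  interpret M: module K M by fact
  interpret N: module K N by fact
  let ?H = "{x \<in> carrier M. \<phi> x = \<psi> x}"
  have "submodule ?H K M"
  proof (rule M.submoduleI)
    fix a assume "a \<in> ?H"
    thus "\<ominus>\<^bsub>M\<^esub> a \<in> ?H"
      using linear_map_minus[OF assms(1,2) l] linear_map_minus[OF assms(1,2) l'] by auto
  qed (use linear_mapD[OF l] linear_mapD[OF l'] linear_map_zero[OF assms(1,2) l]
      linear_map_zero[OF assms(1,2) l'] in auto)
  moreover have "S \<subseteq> ?H" using assms(3,6) by (auto simp: spanning_def)
  ultimately show ?thesis using assms(3,7) unfolding spanning_def by blast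
qed

text \<open>With the other arguments fixed, two multilinear maps agree on a submodule in each argument. So the
  restriction to the spanning set can be lifted from one argument after the other.\<close>

lemma multilinear_map_eqI:
  assumes "module K M" "module K N" "spanning K M S"
    and m: "multilinear_map K M N n m" and m': "multilinear_map K M N n m'"
    and eq: "\<And>xs. xs \<in> args M n \<Longrightarrow> set xs \<subseteq> S \<Longrightarrow> m xs = m' xs"
    and "xs \<in> args M n"
  shows "m xs = m' xs"
proof -
  interpret M: module K M by fact
  interpret N: module K N by fact
  have "\<forall>xs\<in>args M n. (\<forall>i. k \<le> i \<longrightarrow> i < n \<longrightarrow> xs ! i \<in> S) \<longrightarrow> m xs = m' xs" if "k \<le> n" for k
    using that
  proof (induction k)
    case 0
    thus ?case using eq by (auto simp: args_def set_conv_nth subset_iff)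
  next
    case (Suc k)
    show ?case
    proof (intro ballI impI)
      fix xs assume xs: "xs \<in> args M n" and S: "\<forall>i. Suc k \<le> i \<longrightarrow> i < n \<longrightarrow> xs ! i \<in> S"
      have k: "k < n" using Suc.prems by simp
      note l = multilinear_map_linear_at[OF m xs k] and l' = multilinear_map_linear_at[OF m' xs k]
      let ?H = "{x \<in> carrier M. m (xs[k := x]) = m' (xs[k := x])}"
      have "submodule ?H K M"
      proof (rule M.submoduleI)
        fix a assume "a \<in> ?H"
        thus "\<ominus>\<^bsub>M\<^esub> a \<in> ?H"
          using linear_map_minus[OF assms(1,2) l] linear_map_minus[OF assms(1,2) l'] by auto
      qed (use linear_mapD[OF l] linear_mapD[OF l'] linear_map_zero[OF assms(1,2) l]
          linear_map_zero[OF assms(1,2) l'] in auto)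
      moreover have "S \<subseteq> ?H"
      proof
        fix x assume "x \<in> S"
        hence x: "x \<in> carrier M" using assms(3) by (auto simp: spanning_def)
        have "\<forall>i. k \<le> i \<longrightarrow> i < n \<longrightarrow> xs[k := x] ! i \<in> S"
          using S \<open>x \<in> S\<close> xs by (auto simp: nth_list_update args_def)
        thus "x \<in> ?H" using Suc k args_update[OF xs x] x by auto
      qed
      ultimately have "xs ! k \<in> ?H"
        using assms(3) args_nth[OF xs k] unfolding spanning_def by blast
      thus "m xs = m' xs" by simp
    qed
  qed
  from this[of n] show ?thesis using assms(7) by auto
qed

lemma op_algebraD:
  assumes "op_algebra K Sig A"
  shows "module K A" and "s \<in> syms Sig \<Longrightarrow> multilinear_map K A A (arity Sig s) (opn A s)"
  using assms by (auto simp: op_algebra_def multilinear_iff)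

lemma hom_algebraD:
  assumes "hom_algebra K Sig A"
  shows "op_algebra K Sig A" and "module K A" and "linear_map K A A (twist A)"
    and "s \<in> syms Sig \<Longrightarrow> xs \<in> args A (arity Sig s) \<Longrightarrow>
      twist A (opn A s xs) = opn A s (map (twist A) xs)"
  using assms op_algebraD(1) by (auto simp: hom_algebra_def linear_endo_iff)

lemma op_morphism_if_spanning:
  assumes A: "op_algebra K Sig A" and B: "op_algebra K Sig B" and S: "spanning K A S"
    and l: "linear_map K A B \<phi>"
    and eq: "\<And>s xs. s \<in> syms Sig \<Longrightarrow> xs \<in> args A (arity Sig s) \<Longrightarrow> set xs \<subseteq> S \<Longrightarrow>
      \<phi> (opn A s xs) = opn B s (map \<phi> xs)"
  shows "op_morphism K Sig A B \<phi>"
  unfolding op_morphism_def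
proof (intro conjI ballI l)
  fix s xs assume s: "s \<in> syms Sig" and xs: "xs \<in> args A (arity Sig s)"
  show "\<phi> (opn A s xs) = opn B s (map \<phi> xs)"
    by (rule multilinear_map_eqI[OF op_algebraD(1)[OF A] op_algebraD(1)[OF B] S
          multilinear_map_compose_linear[OF op_algebraD(2)[OF A s] l]
          multilinear_map_map_linear[OF op_algebraD(2)[OF B s] l] eq[OF s] xs])
qed

lemma args_surj:
  assumes "xs \<in> args B n" "\<phi> ` carrier A = carrier B"
  obtains ys where "ys \<in> args A n" "xs = map \<phi> ys"
proof -
  have "set xs \<subseteq> \<phi> ` carrier A" using assms by (auto simp: args_def)
  hence "xs \<in> map \<phi> ` lists (carrier A)" by (simp flip: lists_image add: in_lists_conv_set subset_iff)
  then obtain ys where "ys \<in> lists (carrier A)" "xs = map \<phi> ys" by blast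
  thus ?thesis using that[of ys] assms(1) by (auto simp: args_def)
qed

section \<open>Images of algebras\<close>

text \<open>Quotients of algebras and copies of algebras on another type both arise as surjective images, so
  that the axioms are verified only here. The zero of the image has to be given, because the
  image is not yet known to be a group.\<close>

lemma module_surjective_image:
  assumes "module K M" "linear_map K M N \<phi>" "\<phi> ` carrier M = carrier N" "\<phi> \<zero>\<^bsub>M\<^esub> = \<zero>\<^bsub>N\<^esub>"
  shows "module K N"
proof -
  interpret M: module K M by fact
  note l = linear_mapD[OF assms(2)]
  have all: "(\<forall>y\<in>carrier N. P y) \<longleftrightarrow> (\<forall>x\<in>carrier M. P (\<phi> x))" for P
    unfolding assms(3)[symmetric] by blast
  have add: "\<phi> x \<oplus>\<^bsub>N\<^esub> \<phi> y = \<phi> (x \<oplus>\<^bsub>M\<^esub> y)" if "x \<in> carrier M" "y \<in> carrier M" for x y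
    using l(2) that by simp
  have sm: "c \<odot>\<^bsub>N\<^esub> \<phi> x = \<phi> (c \<odot>\<^bsub>M\<^esub> x)" if "c \<in> carrier K" "x \<in> carrier M" for c x
    using l(3) that by simp
  have neg: "\<exists>y\<in>carrier N. y \<oplus>\<^bsub>N\<^esub> \<phi> x = \<phi> \<zero>\<^bsub>M\<^esub>" if "x \<in> carrier M" for x
    using that by (intro bexI[of _ "\<phi> (\<ominus>\<^bsub>M\<^esub> x)"]) (simp_all add: add l(1) M.M.l_neg)
  have zero: "\<zero>\<^bsub>N\<^esub> \<in> carrier N" using l(1)[of "\<zero>\<^bsub>M\<^esub>"] assms(4) by simp
  have laws: "\<forall>x\<in>carrier N. \<forall>y\<in>carrier N. x \<oplus>\<^bsub>N\<^esub> y \<in> carrier N"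
    "\<forall>x\<in>carrier N. \<forall>y\<in>carrier N. \<forall>z\<in>carrier N. x \<oplus>\<^bsub>N\<^esub> y \<oplus>\<^bsub>N\<^esub> z = x \<oplus>\<^bsub>N\<^esub> (y \<oplus>\<^bsub>N\<^esub> z)"
    "\<forall>x\<in>carrier N. \<forall>y\<in>carrier N. x \<oplus>\<^bsub>N\<^esub> y = y \<oplus>\<^bsub>N\<^esub> x"
    "\<forall>x\<in>carrier N. \<zero>\<^bsub>N\<^esub> \<oplus>\<^bsub>N\<^esub> x = x"
    "\<forall>x\<in>carrier N. \<exists>y\<in>carrier N. y \<oplus>\<^bsub>N\<^esub> x = \<zero>\<^bsub>N\<^esub>"
    "\<forall>a\<in>carrier K. \<forall>x\<in>carrier N. a \<odot>\<^bsub>N\<^esub> x \<in> carrier N"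
    "\<forall>a\<in>carrier K. \<forall>b\<in>carrier K. \<forall>x\<in>carrier N.
      (a \<oplus>\<^bsub>K\<^esub> b) \<odot>\<^bsub>N\<^esub> x = a \<odot>\<^bsub>N\<^esub> x \<oplus>\<^bsub>N\<^esub> b \<odot>\<^bsub>N\<^esub> x"
    "\<forall>a\<in>carrier K. \<forall>x\<in>carrier N. \<forall>y\<in>carrier N.
      a \<odot>\<^bsub>N\<^esub> (x \<oplus>\<^bsub>N\<^esub> y) = a \<odot>\<^bsub>N\<^esub> x \<oplus>\<^bsub>N\<^esub> a \<odot>\<^bsub>N\<^esub> y"
    "\<forall>a\<in>carrier K. \<forall>b\<in>carrier K. \<forall>x\<in>carrier N.
      (a \<otimes>\<^bsub>K\<^esub> b) \<odot>\<^bsub>N\<^esub> x = a \<odot>\<^bsub>N\<^esub> (b \<odot>\<^bsub>N\<^esub> x)"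
    "\<forall>x\<in>carrier N. \<one>\<^bsub>K\<^esub> \<odot>\<^bsub>N\<^esub> x = x"
    unfolding all assms(4)[symmetric]
    by (simp_all add: add sm neg l(1) M.M.a_ac M.smult_l_distr M.smult_r_distr
        M.smult_assoc1)
  have group: "abelian_group N"
    by (rule abelian_groupI) (rule zero | rule laws[rule_format], assumption+)+
  show ?thesis
    by (rule moduleI) (rule M.R.cring_axioms group | rule laws[rule_format], assumption+)+
qed

lemma op_algebra_surjective_image:
  assumes "op_algebra K Sig A" "op_morphism K Sig A B \<phi>" "\<phi> ` carrier A = carrier B"
    "\<phi> \<zero>\<^bsub>A\<^esub> = \<zero>\<^bsub>B\<^esub>"
  shows "op_algebra K Sig B"
proof -
  have l: "linear_map K A B \<phi>" using assms(2) by (simp add: op_morphism_def)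
  have "multilinear_map K B B (arity Sig s) (opn B s)" if s: "s \<in> syms Sig" for s
  proof -
    have op: "opn B s (map \<phi> xs) = \<phi> (opn A s xs)" if "xs \<in> args A (arity Sig s)" for xs
      using assms(2) that s by (simp add: op_morphism_def)
    note m = op_algebraD(2)[OF assms(1) s]
    have upd: "opn B s ((map \<phi> ys)[i := \<phi> x]) = \<phi> (opn A s (ys[i := x]))"
      if "ys \<in> args A (arity Sig s)" "x \<in> carrier A" for ys i x
      using op[OF args_update[OF that]] by (simp add: map_update)
    have cl: "opn A s (ys[i := x]) \<in> carrier A"
      if "ys \<in> args A (arity Sig s)" "x \<in> carrier A" for ys i x
      using multilinear_mapD(1)[OF m args_update[OF that]] .
    interpret A: module K A using op_algebraD(1)[OF assms(1)] .
    show ?thesis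
      unfolding multilinear_map_def
    proof (intro conjI ballI allI impI)
      fix xs assume "xs \<in> args B (arity Sig s)"
      then obtain ys where "ys \<in> args A (arity Sig s)" "xs = map \<phi> ys"
        by (rule args_surj[OF _ assms(3)])
      thus "opn B s xs \<in> carrier B"
        using linear_mapD(1)[OF l multilinear_mapD(1)[OF m]] by (simp add: op)
    next
      fix xs i x y
      assume xs: "xs \<in> args B (arity Sig s)" and i: "i < arity Sig s"
        and xy: "x \<in> carrier B" "y \<in> carrier B"
      obtain ys where ys1: "ys \<in> args A (arity Sig s)" and [simp]: "xs = map \<phi> ys"
        using xs by (rule args_surj[OF _ assms(3)])
      obtain a b where ab: "a \<in> carrier A" "b \<in> carrier A" and [simp]: "x = \<phi> a" "y = \<phi> b"
        using xy assms(3) by blast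
      note ys = ys1 ab
      show "opn B s (xs[i := x \<oplus>\<^bsub>B\<^esub> y]) = opn B s (xs[i := x]) \<oplus>\<^bsub>B\<^esub> opn B s (xs[i := y])"
        using upd[OF ys(1) A.M.a_closed[OF ys(2,3)], of i]
          linear_mapD(2)[OF l cl[OF ys(1,2), of i] cl[OF ys(1,3), of i]]
        by (simp add: linear_mapD(2)[OF l ys(2,3)] multilinear_mapD(2)[OF m ys(1) i ys(2,3)]
            upd[OF ys(1,2)] upd[OF ys(1,3)])
    next
      fix xs i c x
      assume xs: "xs \<in> args B (arity Sig s)" and i: "i < arity Sig s" and c: "c \<in> carrier K"
        and x: "x \<in> carrier B"
      obtain ys where ys1: "ys \<in> args A (arity Sig s)" and [simp]: "xs = map \<phi> ys"
        using xs by (rule args_surj[OF _ assms(3)])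
      obtain a where a: "a \<in> carrier A" and [simp]: "x = \<phi> a"
        using x assms(3) by blast
      note ys = ys1 a
      show "opn B s (xs[i := c \<odot>\<^bsub>B\<^esub> x]) = c \<odot>\<^bsub>B\<^esub> opn B s (xs[i := x])"
        using upd[OF ys(1) A.smult_closed[OF c ys(2)], of i]
          linear_mapD(3)[OF l c cl[OF ys(1,2), of i]]
        by (simp add: linear_mapD(3)[OF l c ys(2)] multilinear_mapD(3)[OF m ys(1) i c ys(2)]
            upd[OF ys(1,2)])
    qed
  qed
  thus ?thesis
    using module_surjective_image[OF op_algebraD(1)[OF assms(1)] l assms(3,4)]
    by (simp add: op_algebra_def multilinear_iff)
qed

lemma op_morphismD:
  assumes "op_morphism K Sig A B \<phi>"
  shows "linear_map K A B \<phi>"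
    and "s \<in> syms Sig \<Longrightarrow> xs \<in> args A (arity Sig s) \<Longrightarrow> \<phi> (opn A s xs) = opn B s (map \<phi> xs)"
  using assms by (auto simp: op_morphism_def)

lemma hom_algebra_surjective_image:
  assumes "hom_algebra K Sig A" "hom_morphism K Sig A B \<phi>" "\<phi> ` carrier A = carrier B"
    "\<phi> \<zero>\<^bsub>A\<^esub> = \<zero>\<^bsub>B\<^esub>"
  shows "hom_algebra K Sig B"
proof -
  have m: "op_morphism K Sig A B \<phi>" and t: "\<And>x. x \<in> carrier A \<Longrightarrow> twist B (\<phi> x) = \<phi> (twist A x)"
    using assms(2) by (auto simp: hom_morphism_def)
  note l = op_morphismD(1)[OF m] and lt = hom_algebraD(3)[OF assms(1)]
  interpret A: module K A using hom_algebraD(2)[OF assms(1)] .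
  have "linear_map K B B (twist B)"
    unfolding linear_map_def
  proof (intro conjI ballI funcsetI)
    fix x assume "x \<in> carrier B"
    then obtain a where "a \<in> carrier A" "x = \<phi> a" using assms(3) by blast
    thus "twist B x \<in> carrier B" by (simp add: t linear_mapD(1)[OF l] linear_mapD(1)[OF lt])
  next
    fix x y assume "x \<in> carrier B" "y \<in> carrier B"
    then obtain a b where ab: "a \<in> carrier A" "x = \<phi> a" "b \<in> carrier A" "y = \<phi> b"
      using assms(3) by blast
    have "twist B (\<phi> (a \<oplus>\<^bsub>A\<^esub> b)) = twist B x \<oplus>\<^bsub>B\<^esub> twist B y"
      unfolding t[OF A.M.a_closed[OF ab(1,3)]] using ab
      by (simp add: t linear_mapD[OF l] linear_mapD[OF lt])
    thus "twist B (x \<oplus>\<^bsub>B\<^esub> y) = twist B x \<oplus>\<^bsub>B\<^esub> twist B y"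
      using ab by (simp add: linear_mapD[OF l])
  next
    fix c x assume c: "c \<in> carrier K" and "x \<in> carrier B"
    then obtain a where ab: "a \<in> carrier A" "x = \<phi> a"
      using assms(3) by blast
    have "twist B (\<phi> (c \<odot>\<^bsub>A\<^esub> a)) = c \<odot>\<^bsub>B\<^esub> twist B x"
      unfolding t[OF A.smult_closed[OF c ab(1)]] using ab c
      by (simp add: t linear_mapD[OF l] linear_mapD[OF lt])
    thus "twist B (c \<odot>\<^bsub>B\<^esub> x) = c \<odot>\<^bsub>B\<^esub> twist B x"
      using ab c by (simp add: linear_mapD[OF l])
  qed
  moreover have "twist B (opn B s xs) = opn B s (map (twist B) xs)"
    if s: "s \<in> syms Sig" and xs: "xs \<in> args B (arity Sig s)" for s xs
  proof -
    obtain ys where ys: "ys \<in> args A (arity Sig s)" "xs = map \<phi> ys"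
      using args_surj[OF xs assms(3)] .
    have "opn A s ys \<in> carrier A"
      using multilinear_mapD(1)[OF op_algebraD(2)[OF hom_algebraD(1)[OF assms(1)] s] ys(1)] .
    hence "twist B (opn B s xs) = \<phi> (opn A s (map (twist A) ys))"
      using t[of "opn A s ys"] ys(2) op_morphismD(2)[OF m s ys(1)] hom_algebraD(4)[OF assms(1) s ys(1)]
      by simp
    also have "\<dots> = opn B s (map \<phi> (map (twist A) ys))"
      using lt by (intro op_morphismD(2)[OF m s] args_map[OF ys(1)]) (simp add: linear_map_def)
    also have "map \<phi> (map (twist A) ys) = map (twist B) xs"
      using ys by (auto simp: args_def t subset_iff)
    finally show ?thesis .
  qed
  ultimately show ?thesis
    using op_algebra_surjective_image[OF hom_algebraD(1)[OF assms(1)] m assms(3,4)]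
    by (simp add: hom_algebra_def linear_endo_iff)
qed

section \<open>Evaluation of trees\<close>

lemma eval_tree_closed:
  assumes "op_algebra K Sig A" "wf_tree Sig T" "\<forall>v\<in>leaves T. \<theta> v \<in> carrier A"
  shows "eval_tree A \<theta> T \<in> carrier A"
  using assms(2,3)
proof (induction T)
  case (Node s ts)
  have "map (eval_tree A \<theta>) ts \<in> args A (arity Sig s)"
    using Node by (auto simp: args_def)
  thus ?case using multilinear_mapD(1)[OF op_algebraD(2)[OF assms(1)]] Node.prems by auto
qed auto

lemma args_eval_tree:
  assumes "op_algebra K Sig A" "wf_tree Sig (Node s ts)" "\<forall>v\<in>leaves (Node s ts). \<theta> v \<in> carrier A"
  shows "map (eval_tree A \<theta>) ts \<in> args A (arity Sig s)"
  using assms eval_tree_closed[OF assms(1)] by (fastforce simp: args_def)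

lemma eval_tree_morphism:
  assumes "op_algebra K Sig A" "op_morphism K Sig A B \<phi>"
    and "wf_tree Sig T" "\<forall>v\<in>leaves T. \<theta> v \<in> carrier A"
  shows "\<phi> (eval_tree A \<theta> T) = eval_tree B (\<lambda>v. \<phi> (\<theta> v)) T"
  using assms(3,4)
proof (induction T)
  case (Node s ts)
  have "\<phi> (eval_tree A \<theta> (Node s ts)) = opn B s (map \<phi> (map (eval_tree A \<theta>) ts))"
    using op_morphismD(2)[OF assms(2) _ args_eval_tree[OF assms(1) Node.prems]] Node.prems by simp
  also have "map \<phi> (map (eval_tree A \<theta>) ts) = map (eval_tree B (\<lambda>v. \<phi> (\<theta> v))) ts"
    using Node by auto
  finally show ?case by simp
qed auto

lemma eval_comb_simps [simp]:
  "eval_comb A \<theta> [] = \<zero>\<^bsub>A\<^esub>"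
  "eval_comb A \<theta> ((c, T) # f) = c \<odot>\<^bsub>A\<^esub> eval_tree A \<theta> T \<oplus>\<^bsub>A\<^esub> eval_comb A \<theta> f"
  by (simp_all add: eval_comb_def)

definition comb_in :: "('k, 'n) ring_scheme \<Rightarrow> 's signature \<Rightarrow> 'v set \<Rightarrow> ('k, 's, 'v) tree_comb \<Rightarrow> bool"
  where "comb_in K Sig V f \<longleftrightarrow> (\<forall>(c, T)\<in>set f. c \<in> carrier K \<and> wf_tree Sig T \<and> leaves T \<subseteq> V)"

lemma eval_comb_closed:
  assumes "op_algebra K Sig A" "comb_in K Sig V f" "\<forall>v\<in>V. \<theta> v \<in> carrier A"
  shows "eval_comb A \<theta> f \<in> carrier A"
proof -
  interpret A: module K A using op_algebraD(1)[OF assms(1)] .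
  show ?thesis using assms(2)
  proof (induction f)
    case (Cons cT f)
    obtain c T where [simp]: "cT = (c, T)" by (cases cT)
    have "c \<in> carrier K" "eval_tree A \<theta> T \<in> carrier A" "eval_comb A \<theta> f \<in> carrier A"
      using Cons eval_tree_closed[OF assms(1), of T \<theta>] assms(3) by (auto simp: comb_in_def)
    thus ?case by simp
  qed simp
qed

lemma eval_comb_morphism:
  assumes "op_algebra K Sig A" "op_algebra K Sig B" "op_morphism K Sig A B \<phi>"
    and "comb_in K Sig V f" "\<forall>v\<in>V. \<theta> v \<in> carrier A"
  shows "\<phi> (eval_comb A \<theta> f) = eval_comb B (\<lambda>v. \<phi> (\<theta> v)) f"
  using assms(4)
proof (induction f)
  case Nil
  thus ?case
    using linear_map_zero[OF op_algebraD(1)[OF assms(1)] op_algebraD(1)[OF assms(2)] op_morphismD(1)[OF assms(3)]]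
    by simp
next
  interpret A: module K A using op_algebraD(1)[OF assms(1)] .
  case (Cons cT f)
  obtain c T where [simp]: "cT = (c, T)" by (cases cT)
  have f: "comb_in K Sig V f" and T: "c \<in> carrier K" "wf_tree Sig T" "\<forall>v\<in>leaves T. \<theta> v \<in> carrier A"
    using Cons.prems assms(5) by (auto simp: comb_in_def)
  have cl: "eval_tree A \<theta> T \<in> carrier A" "eval_comb A \<theta> f \<in> carrier A"
    using eval_tree_closed[OF assms(1)] T eval_comb_closed[OF assms(1) f assms(5)] by auto
  show ?case
    using cl T Cons.IH[OF f] eval_tree_morphism[OF assms(1,3) T(2,3)]
    by (simp add: linear_mapD[OF op_morphismD(1)[OF assms(3)]])
qed

section \<open>Quotients by ideals\<close>

lemma hom_idealD:
  assumes "hom_ideal K Sig A J"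
  shows "submodule J K A"
    and "s \<in> syms Sig \<Longrightarrow> xs \<in> args A (arity Sig s) \<Longrightarrow> x \<in> set xs \<Longrightarrow> x \<in> J \<Longrightarrow> opn A s xs \<in> J"
    and "x \<in> J \<Longrightarrow> twist A x \<in> J"
  using assms by (auto simp: hom_ideal_def)

lemma hom_ideal_kernel:
  assumes A: "hom_algebra K Sig A" and B: "hom_algebra K Sig B" and h: "hom_morphism K Sig A B \<phi>"
  shows "hom_ideal K Sig A {x \<in> carrier A. \<phi> x = \<zero>\<^bsub>B\<^esub>}" (is "hom_ideal K Sig A ?J")
proof -
  interpret A: module K A using hom_algebraD(2)[OF A] .
  interpret B: module K B using hom_algebraD(2)[OF B] .
  have m: "op_morphism K Sig A B \<phi>" using h by (simp add: hom_morphism_def)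
  note l = op_morphismD(1)[OF m]
  note z = linear_map_zero[OF hom_algebraD(2)[OF A] hom_algebraD(2)[OF B]]
  have "submodule ?J K A"
  proof (rule A.submoduleI)
    fix a assume "a \<in> ?J"
    thus "\<ominus>\<^bsub>A\<^esub> a \<in> ?J"
      using linear_map_minus[OF hom_algebraD(2)[OF A] hom_algebraD(2)[OF B] l] by auto
  qed (use linear_mapD[OF l] z[OF l] in auto)
  moreover have "opn A s xs \<in> ?J"
    if s: "s \<in> syms Sig" and xs: "xs \<in> args A (arity Sig s)" and ne: "set xs \<inter> ?J \<noteq> {}" for s xs
  proof -
    obtain i where i: "i < arity Sig s" "\<phi> (xs ! i) = \<zero>\<^bsub>B\<^esub>"
      using ne xs by (auto simp: args_def set_conv_nth)
    have mxs: "map \<phi> xs \<in> args B (arity Sig s)"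
      using linear_map_args[OF l xs] .
    have "opn B s (map \<phi> xs) = \<zero>\<^bsub>B\<^esub>"
      using i xs multilinear_map_zero[OF hom_algebraD(2)[OF B] hom_algebraD(2)[OF B]
          op_algebraD(2)[OF hom_algebraD(1)[OF B] s] mxs i(1)]
      by (auto simp: args_def)
    thus ?thesis
      using op_morphismD(2)[OF m s xs] multilinear_mapD(1)[OF op_algebraD(2)[OF hom_algebraD(1)[OF A] s] xs]
      by simp
  qed
  moreover have "twist A ` ?J \<subseteq> ?J"
    using h linear_mapD(1)[OF hom_algebraD(3)[OF A]]
      linear_map_zero[OF hom_algebraD(2)[OF B] hom_algebraD(2)[OF B] hom_algebraD(3)[OF B]]
    by (auto simp: hom_morphism_def)
  ultimately show ?thesis by (simp add: hom_ideal_def)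
qed

lemma hom_ideal_carrier:
  assumes A: "hom_algebra K Sig A"
  shows "hom_ideal K Sig A (carrier A)"
  using module.carrier_is_submodule[OF hom_algebraD(2)[OF A]]
    linear_mapD(1)[OF hom_algebraD(3)[OF A]] multilinear_mapD(1)[OF op_algebraD(2)[OF hom_algebraD(1)[OF A]]]
  by (auto simp: hom_ideal_def)

lemma generated_ideal_subset:
  "hom_ideal K Sig A J \<Longrightarrow> S \<subseteq> J \<Longrightarrow> generated_ideal K Sig A S \<subseteq> J"
  by (auto simp: generated_ideal_def)

lemma hom_ideal_generated:
  assumes A: "hom_algebra K Sig A" and S: "S \<subseteq> carrier A"
  shows "hom_ideal K Sig A (generated_ideal K Sig A S)" (is "hom_ideal K Sig A ?J")
proof -
  interpret A: module K A using hom_algebraD(2)[OF A] .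
  have J: "x \<in> ?J \<longleftrightarrow> (\<forall>J. hom_ideal K Sig A J \<longrightarrow> S \<subseteq> J \<longrightarrow> x \<in> J)" for x
    by (auto simp: generated_ideal_def)
  have sub: "?J \<subseteq> carrier A" using generated_ideal_subset[OF hom_ideal_carrier[OF A] S] .
  note E = A.submoduleE[OF hom_idealD(1)]
  have z: "\<zero>\<^bsub>A\<^esub> \<in> J" if "hom_ideal K Sig A J" for J
    using subgroup.one_closed[OF submodule.axioms(1)[OF hom_idealD(1)[OF that]]] by simp
  have "submodule ?J K A"
  proof (rule A.submoduleI[OF sub])
    show "\<zero>\<^bsub>A\<^esub> \<in> ?J" using z by (simp add: J)
    show "\<ominus>\<^bsub>A\<^esub> a \<in> ?J" if "a \<in> ?J" for a using that E(3) by (auto simp: J)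
    show "a \<oplus>\<^bsub>A\<^esub> b \<in> ?J" if "a \<in> ?J" "b \<in> ?J" for a b using that E(5) by (auto simp: J)
    show "a \<odot>\<^bsub>A\<^esub> b \<in> ?J" if "a \<in> carrier K" "b \<in> ?J" for a b using that E(4) by (auto simp: J)
  qed
  moreover have "opn A s xs \<in> ?J"
    if "s \<in> syms Sig" "xs \<in> args A (arity Sig s)" and ne: "set xs \<inter> ?J \<noteq> {}" for s xs
  proof -
    obtain x where x: "x \<in> set xs" "x \<in> ?J" using ne by blast
    have "opn A s xs \<in> J" if J': "hom_ideal K Sig A J" "S \<subseteq> J" for J
    proof -
      have "x \<in> J" using x(2) J' J by blast
      thus ?thesis using hom_idealD(2)[OF J'(1) \<open>s \<in> syms Sig\<close> \<open>xs \<in> _\<close> x(1)] by blast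
    qed
    thus ?thesis using J by blast
  qed
  moreover have "twist A ` ?J \<subseteq> ?J" using hom_idealD(3) by (fastforce simp: J)
  ultimately show ?thesis by (simp add: hom_ideal_def)
qed

lemma generated_ideal_superset: "S \<subseteq> generated_ideal K Sig A S"
  by (auto simp: generated_ideal_def)

context
  fixes K :: "('k, 'n) ring_scheme" and Sig :: "'s signature"
    and A :: "('k, 'a, 's) hom_algebra" and J :: "'a set"
  assumes A: "hom_algebra K Sig A" and J: "hom_ideal K Sig A J"
begin

interpretation A: module K A using hom_algebraD(2)[OF A] .

interpretation J: abelian_subgroup J A
  using submodule.axioms(1)[OF hom_idealD(1)[OF J]] A.M.abelian_group_axioms
  by (intro abelian_subgroupI3 additive_subgroup.intro)

lemma in_coset_iff: "y \<in> J +>\<^bsub>A\<^esub> x \<longleftrightarrow> (\<exists>d\<in>J. y = d \<oplus>\<^bsub>A\<^esub> x)"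
  by (auto simp: a_r_coset_def')

lemma coset_absorb:
  assumes "x \<in> carrier A" "d \<in> J"
  shows "J +>\<^bsub>A\<^esub> (d \<oplus>\<^bsub>A\<^esub> x) = J +>\<^bsub>A\<^esub> x"
  using J.a_repr_independence'[OF _ assms(1)] assms(2) in_coset_iff by metis

lemma coset_Union:
  assumes "x \<in> carrier A" "\<And>y. y \<in> J +>\<^bsub>A\<^esub> x \<Longrightarrow> F y = C"
  shows "(\<Union>y\<in>J +>\<^bsub>A\<^esub> x. F y) = C"
  using assms J.a_rcos_self[OF assms(1)] by (intro SUP_eq_const) auto

lemma coset_zero: "x \<in> carrier A \<Longrightarrow> J +>\<^bsub>A\<^esub> x = J \<longleftrightarrow> x \<in> J"
  using J.a_rcos_const J.a_rcos_self by blast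

text \<open>The arguments are exchanged one after the other. Each exchange changes one argument by an element
  of the ideal, and hence the value by a value of the operation at a list that meets the ideal.\<close>

lemma opn_coset_eq:
  assumes s: "s \<in> syms Sig" and ys: "ys \<in> args A (arity Sig s)"
    and xs: "list_all2 (\<lambda>x y. x \<in> J +>\<^bsub>A\<^esub> y) xs ys"
  shows "J +>\<^bsub>A\<^esub> opn A s xs = J +>\<^bsub>A\<^esub> opn A s ys"
proof -
  note m = op_algebraD(2)[OF hom_algebraD(1)[OF A] s]
  have len: "length ys = arity Sig s" "length xs = arity Sig s"
    using xs ys by (auto simp: args_def dest: list_all2_lengthD)
  have xs': "xs \<in> args A (arity Sig s)"
    unfolding args_def
  proof (intro CollectI conjI subsetI)
    fix x assume "x \<in> set xs"
    then obtain i where "i < arity Sig s" "x = xs ! i" using len by (auto simp: in_set_conv_nth)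
    thus "x \<in> carrier A"
      using list_all2_nthD[OF xs, of i] J.a_elemrcos_carrier[OF args_nth[OF ys]] len by auto
  qed (use len in simp)
  have "J +>\<^bsub>A\<^esub> opn A s (take k xs @ drop k ys) = J +>\<^bsub>A\<^esub> opn A s ys" if "k \<le> arity Sig s" for k
    using that
  proof (induction k)
    case (Suc k)
    let ?zs = "take k xs @ drop k ys"
    have k: "k < arity Sig s" using Suc.prems by simp
    have zs: "?zs \<in> args A (arity Sig s)"
      using xs' ys len k set_take_subset[of k xs] set_drop_subset[of k ys] by (auto simp: args_def)
    obtain d where d: "d \<in> J" "xs ! k = d \<oplus>\<^bsub>A\<^esub> ys ! k"
      using list_all2_nthD[OF xs] k len in_coset_iff by metis
    have yk: "ys ! k \<in> carrier A" and dc: "d \<in> carrier A"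
      using args_nth[OF ys k] d(1) by auto
    have zk: "?zs[k := ys ! k] = ?zs" and zk': "?zs[k := xs ! k] = take (Suc k) xs @ drop (Suc k) ys"
      using len k by (auto simp: list_eq_iff_nth_eq nth_append nth_list_update min_def)
    have "opn A s (?zs[k := xs ! k]) = opn A s (?zs[k := d]) \<oplus>\<^bsub>A\<^esub> opn A s (?zs[k := ys ! k])"
      unfolding d(2) using multilinear_mapD(2)[OF m zs k dc yk] .
    moreover have "opn A s (?zs[k := d]) \<in> J"
      using hom_idealD(2)[OF J s args_update[OF zs dc] _ d(1)] len k by (auto simp: set_update_memI)
    ultimately show ?case
      unfolding zk zk' using Suc coset_absorb[OF multilinear_mapD(1)[OF m zs]] by simp
  qed simp
  from this[of "arity Sig s"] show ?thesis using len by simp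
qed

lemma opn_quotient:
  assumes s: "s \<in> syms Sig" and ys: "ys \<in> args A (arity Sig s)"
  shows "opn (quotient_algebra A J) s (map (\<lambda>x. J +>\<^bsub>A\<^esub> x) ys) = J +>\<^bsub>A\<^esub> opn A s ys"
proof -
  have "list_all2 (\<in>) ys (map (\<lambda>x. J +>\<^bsub>A\<^esub> x) ys)"
    using J.a_rcos_self[OF args_nth[OF ys]] ys by (simp add: args_def list_all2_conv_all_nth)
  moreover have "J +>\<^bsub>A\<^esub> opn A s xs = J +>\<^bsub>A\<^esub> opn A s ys"
    if "list_all2 (\<in>) xs (map (\<lambda>x. J +>\<^bsub>A\<^esub> x) ys)" for xs
    using opn_coset_eq[OF s ys] that by (simp add: list_all2_map2)
  ultimately have "(\<Union>xs\<in>{xs. list_all2 (\<in>) xs (map (\<lambda>x. J +>\<^bsub>A\<^esub> x) ys)}. J +>\<^bsub>A\<^esub> opn A s xs)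
      = J +>\<^bsub>A\<^esub> opn A s ys"
    by (intro SUP_eq_const) blast+
  thus ?thesis by (simp add: quotient_algebra_def)
qed

lemma coset_morphism: "hom_morphism K Sig A (quotient_algebra A J) (\<lambda>x. J +>\<^bsub>A\<^esub> x)"
proof -
  have "linear_map K A (quotient_algebra A J) (\<lambda>x. J +>\<^bsub>A\<^esub> x)"
    unfolding linear_map_def
  proof (intro conjI ballI funcsetI)
    fix x assume "x \<in> carrier A"
    thus "J +>\<^bsub>A\<^esub> x \<in> carrier (quotient_algebra A J)"
      using A.M.a_rcosetsI[OF J.a_subset] by (simp add: quotient_algebra_def)
  next
    fix x y assume "x \<in> carrier A" "y \<in> carrier A"
    thus "J +>\<^bsub>A\<^esub> (x \<oplus>\<^bsub>A\<^esub> y) = (J +>\<^bsub>A\<^esub> x) \<oplus>\<^bsub>quotient_algebra A J\<^esub> (J +>\<^bsub>A\<^esub> y)"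
      by (simp add: quotient_algebra_def J.a_rcos_sum)
  next
    fix c x assume c: "c \<in> carrier K" and x: "x \<in> carrier A"
    have "J +>\<^bsub>A\<^esub> (c \<odot>\<^bsub>A\<^esub> (d \<oplus>\<^bsub>A\<^esub> x)) = J +>\<^bsub>A\<^esub> (c \<odot>\<^bsub>A\<^esub> x)" if "d \<in> J" for d
      using c x that coset_absorb[of "c \<odot>\<^bsub>A\<^esub> x" "c \<odot>\<^bsub>A\<^esub> d"] A.submoduleE(4)[OF hom_idealD(1)[OF J]]
      by (simp add: A.smult_r_distr)
    hence "(\<Union>y\<in>J +>\<^bsub>A\<^esub> x. J +>\<^bsub>A\<^esub> (c \<odot>\<^bsub>A\<^esub> y)) = J +>\<^bsub>A\<^esub> (c \<odot>\<^bsub>A\<^esub> x)"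
      by (intro coset_Union[OF x]) (auto simp only: in_coset_iff)
    thus "J +>\<^bsub>A\<^esub> (c \<odot>\<^bsub>A\<^esub> x) = c \<odot>\<^bsub>quotient_algebra A J\<^esub> (J +>\<^bsub>A\<^esub> x)"
      by (simp add: quotient_algebra_def)
  qed
  moreover have "J +>\<^bsub>A\<^esub> twist A x = twist (quotient_algebra A J) (J +>\<^bsub>A\<^esub> x)" if x: "x \<in> carrier A" for x
  proof -
    note l = hom_algebraD(3)[OF A]
    have "J +>\<^bsub>A\<^esub> (twist A (d \<oplus>\<^bsub>A\<^esub> x)) = J +>\<^bsub>A\<^esub> (twist A x)" if "d \<in> J" for d
      using x that coset_absorb[OF linear_mapD(1)[OF l x] hom_idealD(3)[OF J that]]
      by (simp add: linear_mapD[OF l])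
    hence "(\<Union>y\<in>J +>\<^bsub>A\<^esub> x. J +>\<^bsub>A\<^esub> (twist A y)) = J +>\<^bsub>A\<^esub> (twist A x)"
      by (intro coset_Union[OF x]) (auto simp only: in_coset_iff)
    thus ?thesis by (simp add: quotient_algebra_def)
  qed
  ultimately show ?thesis
    using opn_quotient by (simp add: hom_morphism_def op_morphism_def)
qed

lemma coset_surj: "(\<lambda>x. J +>\<^bsub>A\<^esub> x) ` carrier A = carrier (quotient_algebra A J)"
  by (auto simp: quotient_algebra_def A_RCOSETS_def' )

lemma hom_algebra_quotient: "hom_algebra K Sig (quotient_algebra A J)"
  by (rule hom_algebra_surjective_image[OF A coset_morphism coset_surj])
    (simp add: quotient_algebra_def J.a_rcos_const)

lemma quotient_lift:
  assumes C: "hom_algebra K Sig C" and h: "hom_morphism K Sig A C \<phi>"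
    and ker: "\<forall>x\<in>J. \<phi> x = \<zero>\<^bsub>C\<^esub>"
  shows "\<exists>\<psi>. hom_morphism K Sig (quotient_algebra A J) C \<psi> \<and>
    (\<forall>x\<in>carrier A. \<psi> (J +>\<^bsub>A\<^esub> x) = \<phi> x)"
proof -
  let ?Q = "quotient_algebra A J"
  interpret C: module K C using hom_algebraD(2)[OF C] .
  interpret Q: module K ?Q using hom_algebraD(2)[OF hom_algebra_quotient] .
  note q = coset_morphism[unfolded hom_morphism_def op_morphism_def]
  have ql: "linear_map K A ?Q (\<lambda>x. J +>\<^bsub>A\<^esub> x)" using q by blast
  have l: "linear_map K A C \<phi>" using h by (simp add: hom_morphism_def op_morphism_def)
  define \<psi> where "\<psi> X = \<phi> (SOME x. x \<in> X)" for X
  have \<psi>: "\<psi> (J +>\<^bsub>A\<^esub> x) = \<phi> x" if x: "x \<in> carrier A" for x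
  proof -
    have "(SOME y. y \<in> J +>\<^bsub>A\<^esub> x) \<in> J +>\<^bsub>A\<^esub> x"
      using J.a_rcos_self[OF x] by (rule someI)
    then obtain d where d: "d \<in> J" "(SOME y. y \<in> J +>\<^bsub>A\<^esub> x) = d \<oplus>\<^bsub>A\<^esub> x"
      using in_coset_iff by blast
    hence "d \<in> carrier A" by auto
    thus ?thesis using d x bspec[OF ker d(1)] linear_mapD[OF l] by (simp add: \<psi>_def)
  qed
  have all: "(\<forall>X\<in>carrier ?Q. P X) \<longleftrightarrow> (\<forall>x\<in>carrier A. P (J +>\<^bsub>A\<^esub> x))" for P
    unfolding coset_surj[symmetric] by blast
  have "\<psi> \<in> carrier ?Q \<rightarrow> carrier C"
    using \<psi> linear_mapD(1)[OF l] by (auto simp flip: coset_surj)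
  moreover have "\<forall>X\<in>carrier ?Q. \<forall>Y\<in>carrier ?Q. \<psi> (X \<oplus>\<^bsub>?Q\<^esub> Y) = \<psi> X \<oplus>\<^bsub>C\<^esub> \<psi> Y"
    unfolding all by (simp add: \<psi> linear_mapD(2)[OF l] flip: linear_mapD(2)[OF ql])
  moreover have "\<forall>c\<in>carrier K. \<forall>X\<in>carrier ?Q. \<psi> (c \<odot>\<^bsub>?Q\<^esub> X) = c \<odot>\<^bsub>C\<^esub> \<psi> X"
    unfolding all by (simp add: \<psi> linear_mapD(3)[OF l] flip: linear_mapD(3)[OF ql])
  ultimately have \<psi>l: "linear_map K ?Q C \<psi>" by (simp add: linear_map_def)
  have "\<psi> (opn ?Q s Xs) = opn C s (map \<psi> Xs)"
    if s: "s \<in> syms Sig" and "Xs \<in> args ?Q (arity Sig s)" for s Xs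
  proof -
    obtain xs where xs: "xs \<in> args A (arity Sig s)" "Xs = map (\<lambda>x. J +>\<^bsub>A\<^esub> x) xs"
      using \<open>Xs \<in> _\<close> by (rule args_surj[OF _ coset_surj])
    have "\<psi> (opn ?Q s Xs) = \<phi> (opn A s xs)"
      using \<psi> multilinear_mapD(1)[OF op_algebraD(2)[OF hom_algebraD(1)[OF A] s] xs(1)]
      by (simp add: xs(2) opn_quotient[OF s xs(1)])
    also have "\<dots> = opn C s (map \<phi> xs)"
      using h s xs(1) by (simp add: hom_morphism_def op_morphism_def)
    also have "map \<phi> xs = map \<psi> Xs" using \<psi> xs by (auto simp: args_def)
    finally show ?thesis .
  qed
  moreover have "\<forall>X\<in>carrier ?Q. \<psi> (twist ?Q X) = twist C (\<psi> X)"
    unfolding all using q h \<psi> linear_mapD(1)[OF hom_algebraD(3)[OF A]]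
    by (simp add: hom_morphism_def flip: conjunct2[OF q, rule_format])
  ultimately have "hom_morphism K Sig ?Q C \<psi>" using \<psi>l by (simp add: hom_morphism_def op_morphism_def)
  thus ?thesis using \<psi> by blast
qed

end

lemma generated_quotient_lift:
  assumes A: "hom_algebra K Sig A" and S: "S \<subseteq> carrier A"
    and C: "hom_algebra K Sig C" and h: "hom_morphism K Sig A C \<phi>"
    and ker: "\<forall>x\<in>S. \<phi> x = \<zero>\<^bsub>C\<^esub>"
  shows "\<exists>\<psi>. hom_morphism K Sig (quotient_algebra A (generated_ideal K Sig A S)) C \<psi> \<and>
    (\<forall>x\<in>carrier A. \<psi> (generated_ideal K Sig A S +>\<^bsub>A\<^esub> x) = \<phi> x)"
proof -
  have "generated_ideal K Sig A S \<subseteq> {x \<in> carrier A. \<phi> x = \<zero>\<^bsub>C\<^esub>}"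
    using S ker by (intro generated_ideal_subset hom_ideal_kernel[OF A C h]) auto
  thus ?thesis
    by (intro quotient_lift[OF A hom_ideal_generated[OF A S] C h]) blast
qed

section \<open>Finitely supported functions\<close>

definition finsupp :: "('k, 'a, 'm) module_scheme \<Rightarrow> 'i set \<Rightarrow> ('i \<Rightarrow> 'a) set" where
  "finsupp M X = {p. (\<forall>t. p t \<in> carrier M) \<and> finite {t. p t \<noteq> \<zero>\<^bsub>M\<^esub>} \<and>
     (\<forall>t. p t \<noteq> \<zero>\<^bsub>M\<^esub> \<longrightarrow> t \<in> X)}"

definition single :: "('k, 'a, 'm) module_scheme \<Rightarrow> 'i \<Rightarrow> 'a \<Rightarrow> 'i \<Rightarrow> 'a" where
  "single M t x = (\<lambda>u. if u = t then x else \<zero>\<^bsub>M\<^esub>)"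

lemma single_same: "single M t x t = x"
  by (simp add: single_def)

lemma single_other: "u \<noteq> t \<Longrightarrow> single M t x u = \<zero>\<^bsub>M\<^esub>"
  by (simp add: single_def)

text \<open>A property of \<open>N\<close> instead of a construction, because the tree algebra and the algebras of polynomials
  carry this linear structure in records with further fields.\<close>

definition is_finsupp_module ::
  "('k, 'a, 'm) module_scheme \<Rightarrow> 'i set \<Rightarrow> ('k, 'i \<Rightarrow> 'a, 'l) module_scheme \<Rightarrow> bool" where
  "is_finsupp_module M X N \<longleftrightarrow>
     carrier N = finsupp M X \<and> \<zero>\<^bsub>N\<^esub> = (\<lambda>t. \<zero>\<^bsub>M\<^esub>) \<and>
     (\<oplus>\<^bsub>N\<^esub>) = (\<lambda>p q t. p t \<oplus>\<^bsub>M\<^esub> q t) \<and> (\<odot>\<^bsub>N\<^esub>) = (\<lambda>c p t. c \<odot>\<^bsub>M\<^esub> p t)"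

text \<open>If every \<open>\<phi> t\<close> is linear, this is the linear map on finitely supported functions with the components
  \<open>\<phi> t\<close>. It serves for linear extensions from trees, for the twisting map of the tree algebra,
  and for the evaluation of polynomials at scalars.\<close>

definition total ::
  "('k, 'a, 'm) module_scheme \<Rightarrow> ('k, 'b, 'l) module_scheme \<Rightarrow> ('i \<Rightarrow> 'a \<Rightarrow> 'b) \<Rightarrow> ('i \<Rightarrow> 'a) \<Rightarrow> 'b"
  where "total M C \<phi> p = finsum C (\<lambda>t. \<phi> t (p t)) {t. p t \<noteq> \<zero>\<^bsub>M\<^esub>}"

context
  fixes K :: "('k, 'n) ring_scheme" and M :: "('k, 'a, 'm) module_scheme" and X :: "'i set"
    and N :: "('k, 'i \<Rightarrow> 'a, 'l) module_scheme"
  assumes M: "module K M" and N: "is_finsupp_module M X N"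
begin

interpretation M: module K M using M .

lemma finsupp_simps:
  "carrier N = finsupp M X" "\<zero>\<^bsub>N\<^esub> = (\<lambda>t. \<zero>\<^bsub>M\<^esub>)" "p \<oplus>\<^bsub>N\<^esub> q = (\<lambda>t. p t \<oplus>\<^bsub>M\<^esub> q t)"
  "c \<odot>\<^bsub>N\<^esub> p = (\<lambda>t. c \<odot>\<^bsub>M\<^esub> p t)"
  using N by (auto simp: is_finsupp_module_def)

lemma finsupp_closed: "p \<in> finsupp M X \<Longrightarrow> p t \<in> carrier M"
  by (simp add: finsupp_def)

lemma finsupp_add:
  assumes p: "p \<in> finsupp M X" and q: "q \<in> finsupp M X"
  shows "(\<lambda>t. p t \<oplus>\<^bsub>M\<^esub> q t) \<in> finsupp M X"
proof -
  have "{t. p t \<oplus>\<^bsub>M\<^esub> q t \<noteq> \<zero>\<^bsub>M\<^esub>} \<subseteq> {t. p t \<noteq> \<zero>\<^bsub>M\<^esub>} \<union> {t. q t \<noteq> \<zero>\<^bsub>M\<^esub>}" by auto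
  thus ?thesis using p q by (auto simp: finsupp_def intro: finite_subset)
qed

lemma finsupp_smult:
  assumes p: "p \<in> finsupp M X" and c: "c \<in> carrier K"
  shows "(\<lambda>t. c \<odot>\<^bsub>M\<^esub> p t) \<in> finsupp M X"
proof -
  have "{t. c \<odot>\<^bsub>M\<^esub> p t \<noteq> \<zero>\<^bsub>M\<^esub>} \<subseteq> {t. p t \<noteq> \<zero>\<^bsub>M\<^esub>}" using c by auto
  thus ?thesis using p c by (auto simp: finsupp_def intro: finite_subset)
qed

lemma module_finsupp: "module K N"
proof (rule moduleI)
  show "cring K" ..
  have neg: "\<exists>q\<in>finsupp M X. (\<lambda>t. q t \<oplus>\<^bsub>M\<^esub> p t) = (\<lambda>t. \<zero>\<^bsub>M\<^esub>)" if "p \<in> finsupp M X" for p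
    using finsupp_smult[OF that, of "\<ominus>\<^bsub>K\<^esub> \<one>\<^bsub>K\<^esub>"] finsupp_closed[OF that]
    by (intro bexI[of _ "\<lambda>t. (\<ominus>\<^bsub>K\<^esub> \<one>\<^bsub>K\<^esub>) \<odot>\<^bsub>M\<^esub> p t"]) (auto simp: M.smult_l_minus M.M.l_neg)
  have zero: "(\<lambda>t. \<zero>\<^bsub>M\<^esub>) \<in> finsupp M X" by (simp add: finsupp_def)
  show "abelian_group N"
  proof (rule abelian_groupI)
    show "p \<oplus>\<^bsub>N\<^esub> q \<oplus>\<^bsub>N\<^esub> r = p \<oplus>\<^bsub>N\<^esub> (q \<oplus>\<^bsub>N\<^esub> r)"
      if "p \<in> carrier N" "q \<in> carrier N" "r \<in> carrier N" for p q r
      using that by (simp add: finsupp_simps finsupp_closed M.M.a_assoc)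
    show "\<exists>q\<in>carrier N. q \<oplus>\<^bsub>N\<^esub> p = \<zero>\<^bsub>N\<^esub>" if "p \<in> carrier N" for p
      using that neg by (simp add: finsupp_simps)
  qed (simp_all add: finsupp_simps finsupp_add zero finsupp_closed M.M.a_comm)
qed (simp_all add: finsupp_simps finsupp_closed finsupp_smult M.smult_l_distr M.smult_r_distr M.smult_assoc1)

lemma finsupp_single: "t \<in> X \<Longrightarrow> x \<in> carrier M \<Longrightarrow> single M t x \<in> finsupp M X"
  by (auto simp: finsupp_def single_def)

lemma spanning_single: "spanning K N {single M t x | t x. t \<in> X \<and> x \<in> carrier M}" (is "spanning K N ?S")
  unfolding spanning_def
proof (intro conjI allI impI subsetI)
  interpret N: module K N using module_finsupp .
  fix p assume "p \<in> ?S"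
  thus "p \<in> carrier N" using finsupp_single by (auto simp: finsupp_simps)
next
  interpret N: module K N using module_finsupp .
  fix H p assume H: "submodule H K N" and S: "?S \<subseteq> H" and p: "p \<in> carrier N"
  have "p \<in> finsupp M X \<Longrightarrow> {t. p t \<noteq> \<zero>\<^bsub>M\<^esub>} = F \<Longrightarrow> p \<in> H" if "finite F" for F p
    using that
  proof (induction F arbitrary: p rule: finite_induct)
    case empty
    hence "p = \<zero>\<^bsub>N\<^esub>" by (auto simp: finsupp_simps)
    thus ?case using subgroup.one_closed[OF submodule.axioms(1)[OF H]] by simp
  next
    case (insert t F)
    let ?q = "p(t := \<zero>\<^bsub>M\<^esub>)"
    have "{u. ?q u \<noteq> \<zero>\<^bsub>M\<^esub>} = F" using insert.hyps(2) insert.prems(2) by auto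
    moreover from this have "?q \<in> finsupp M X" using insert.prems insert.hyps(1) by (auto simp: finsupp_def)
    ultimately have "?q \<in> H" using insert.IH by blast
    moreover have "t \<in> X" "p t \<in> carrier M" using insert.prems by (auto simp: finsupp_def)
    hence "single M t (p t) \<in> H" using S by auto
    ultimately have "?q \<oplus>\<^bsub>N\<^esub> single M t (p t) \<in> H" using N.submoduleE(5)[OF H] by blast
    moreover have "?q \<oplus>\<^bsub>N\<^esub> single M t (p t) = p"
      using insert.prems(1) finsupp_closed by (auto simp: finsupp_simps single_def)
    ultimately show ?case by simp
  qed
  thus "p \<in> H" using p by (auto simp: finsupp_simps finsupp_def)
qed

context
  fixes C :: "('k, 'b, 'p) module_scheme" and \<phi> :: "'i \<Rightarrow> 'a \<Rightarrow> 'b"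
  assumes C: "module K C" and \<phi>: "\<And>t. t \<in> X \<Longrightarrow> linear_map K M C (\<phi> t)"
begin

interpretation C: module K C using C .

lemma total_superset:
  assumes "p \<in> finsupp M X" "finite U" "{t. p t \<noteq> \<zero>\<^bsub>M\<^esub>} \<subseteq> U" "U \<subseteq> X"
  shows "total M C \<phi> p = finsum C (\<lambda>t. \<phi> t (p t)) U"
  unfolding total_def
proof (rule C.M.add.finprod_mono_neutral_cong_left[OF assms(2,3)])
  have t: "linear_map K M C (\<phi> t)" if "t \<in> U" for t using that assms(4) \<phi> by blast
  thus "\<phi> i (p i) = \<zero>\<^bsub>C\<^esub>" if "i \<in> U - {t. p t \<noteq> \<zero>\<^bsub>M\<^esub>}" for i
    using that linear_map_zero[OF M C] by auto
  show "(\<lambda>t. \<phi> t (p t)) \<in> U \<rightarrow> carrier C"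
    using t finsupp_closed[OF assms(1)] linear_mapD(1) by fast
qed simp

lemma linear_map_total: "linear_map K N C (total M C \<phi>)"
proof -
  have fin: "finite {t. p t \<noteq> \<zero>\<^bsub>M\<^esub>}" "{t. p t \<noteq> \<zero>\<^bsub>M\<^esub>} \<subseteq> X" if "p \<in> finsupp M X" for p
    using that by (auto simp: finsupp_def)
  have cl: "(\<lambda>t. \<phi> t (p t)) \<in> U \<rightarrow> carrier C" if "p \<in> finsupp M X" "U \<subseteq> X" for p U
    using that finsupp_closed linear_mapD(1)[OF \<phi>] by fast
  show ?thesis
    unfolding linear_map_def finsupp_simps
  proof (intro conjI ballI funcsetI)
    fix p assume p: "p \<in> finsupp M X"
    show "total M C \<phi> p \<in> carrier C"
      unfolding total_def using cl[OF p fin(2)[OF p]] by (rule C.M.finsum_closed)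
  next
    fix p q assume p: "p \<in> finsupp M X" and q: "q \<in> finsupp M X"
    let ?U = "{t. p t \<noteq> \<zero>\<^bsub>M\<^esub>} \<union> {t. q t \<noteq> \<zero>\<^bsub>M\<^esub>}"
    have U: "finite ?U" "?U \<subseteq> X" using fin[OF p] fin[OF q] by auto
    have "total M C \<phi> (\<lambda>t. p t \<oplus>\<^bsub>M\<^esub> q t) = finsum C (\<lambda>t. \<phi> t (p t \<oplus>\<^bsub>M\<^esub> q t)) ?U"
      by (rule total_superset[OF finsupp_add[OF p q] U(1) _ U(2)]) auto
    also have "\<dots> = finsum C (\<lambda>t. \<phi> t (p t) \<oplus>\<^bsub>C\<^esub> \<phi> t (q t)) ?U"
    proof (rule C.M.finsum_cong')
      show "(\<lambda>t. \<phi> t (p t) \<oplus>\<^bsub>C\<^esub> \<phi> t (q t)) \<in> ?U \<rightarrow> carrier C"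
        using cl[OF p U(2)] cl[OF q U(2)] by (simp add: Pi_iff)
      show "\<phi> t (p t \<oplus>\<^bsub>M\<^esub> q t) = \<phi> t (p t) \<oplus>\<^bsub>C\<^esub> \<phi> t (q t)" if "t \<in> ?U" for t
        using linear_mapD(2)[OF \<phi> finsupp_closed[OF p] finsupp_closed[OF q]] that U(2) by blast
    qed simp
    also have "\<dots> = finsum C (\<lambda>t. \<phi> t (p t)) ?U \<oplus>\<^bsub>C\<^esub> finsum C (\<lambda>t. \<phi> t (q t)) ?U"
      by (rule C.M.finsum_addf[OF cl[OF p U(2)] cl[OF q U(2)]])
    also have "\<dots> = total M C \<phi> p \<oplus>\<^bsub>C\<^esub> total M C \<phi> q"
      using total_superset[OF p U(1) _ U(2)] total_superset[OF q U(1) _ U(2)] by simp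
    finally show "total M C \<phi> (\<lambda>t. p t \<oplus>\<^bsub>M\<^esub> q t) = total M C \<phi> p \<oplus>\<^bsub>C\<^esub> total M C \<phi> q" .
  next
    fix c p assume c: "c \<in> carrier K" and p: "p \<in> finsupp M X"
    let ?U = "{t. p t \<noteq> \<zero>\<^bsub>M\<^esub>}"
    have "total M C \<phi> (\<lambda>t. c \<odot>\<^bsub>M\<^esub> p t) = finsum C (\<lambda>t. \<phi> t (c \<odot>\<^bsub>M\<^esub> p t)) ?U"
      using c by (intro total_superset[OF finsupp_smult[OF p c] fin(1)[OF p] _ fin(2)[OF p]]) auto
    also have "\<dots> = finsum C (\<lambda>t. c \<odot>\<^bsub>C\<^esub> \<phi> t (p t)) ?U"
    proof (rule C.M.finsum_cong')
      show "(\<lambda>t. c \<odot>\<^bsub>C\<^esub> \<phi> t (p t)) \<in> ?U \<rightarrow> carrier C"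
        using cl[OF p fin(2)[OF p]] c by (simp add: Pi_iff)
      show "\<phi> t (c \<odot>\<^bsub>M\<^esub> p t) = c \<odot>\<^bsub>C\<^esub> \<phi> t (p t)" if "t \<in> ?U" for t
        using linear_mapD(3)[OF \<phi> c finsupp_closed[OF p]] that fin(2)[OF p] by blast
    qed simp
    also have "\<dots> = c \<odot>\<^bsub>C\<^esub> total M C \<phi> p"
      unfolding total_def using C.finsum_smult_ldistr[OF fin(1)[OF p] c cl[OF p fin(2)[OF p]]] by simp
    finally show "total M C \<phi> (\<lambda>t. c \<odot>\<^bsub>M\<^esub> p t) = c \<odot>\<^bsub>C\<^esub> total M C \<phi> p" .
  qed
qed

lemma total_single:
  assumes "t \<in> X" "x \<in> carrier M"
  shows "total M C \<phi> (single M t x) = \<phi> t x"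
proof -
  have "total M C \<phi> (single M t x) = finsum C (\<lambda>u. \<phi> u (single M t x u)) {t}"
    using assms by (intro total_superset finsupp_single) (auto simp: single_def)
  thus ?thesis using linear_mapD(1)[OF \<phi>[OF assms(1)] assms(2)] by (simp add: single_def)
qed

end

end

section \<open>The tree algebra and its universal property\<close>

definition ring_module :: "('k, 'n) ring_scheme \<Rightarrow> ('k, 'k) module" where
  "ring_module K = \<lparr>carrier = carrier K, mult = mult K, one = one K, zero = zero K, add = add K,
     smult = mult K\<rparr>"

lemma module_ring_module:
  assumes "cring K"
  shows "module K (ring_module K)"
proof -
  interpret cring K by fact
  have "abelian_group (ring_module K)"
    by (rule abelian_groupI) (auto simp: ring_module_def intro: a_assoc a_comm l_neg bexI[of _ "\<ominus>\<^bsub>K\<^esub> _"])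
  thus ?thesis
    by (intro moduleI assms) (auto simp: ring_module_def l_distr r_distr m_assoc)
qed

lemma ring_module_simps [simp]:
  "carrier (ring_module K) = carrier K" "\<zero>\<^bsub>ring_module K\<^esub> = \<zero>\<^bsub>K\<^esub>"
  "x \<oplus>\<^bsub>ring_module K\<^esub> y = x \<oplus>\<^bsub>K\<^esub> y" "c \<odot>\<^bsub>ring_module K\<^esub> x = c \<otimes>\<^bsub>K\<^esub> x"
  by (simp_all add: ring_module_def)

lemma finsum_ring_module [simp]: "finsum (ring_module K) f X = finsum K f X"
  by (simp add: finsum_def finprod_def ring_module_def)

lemma wf_map_tree [simp]: "wf_tree Sig (map_tree f t) = wf_tree Sig t"
  by (induction t) auto

lemma eval_map_tree: "eval_tree A \<theta> (map_tree f t) = eval_tree A (\<lambda>v. \<theta> (f v)) t"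
proof (induction t)
  case (Node s ts)
  thus ?case by (auto intro!: arg_cong[of _ _ "opn A s"])
qed simp

lemma eval_tree_cong:
  "(\<And>v. v \<in> leaves t \<Longrightarrow> \<theta> v = \<theta>' v) \<Longrightarrow> eval_tree A \<theta> t = eval_tree A \<theta>' t"
proof (induction t)
  case (Node s ts)
  have "eval_tree A \<theta> t = eval_tree A \<theta>' t" if "t \<in> set ts" for t
    using that Node.prems by (intro Node.IH) auto
  thus ?case by (auto intro!: arg_cong[of _ _ "opn A s"])
qed simp

definition trees_over :: "'s signature \<Rightarrow> ('k, 'v, 'm) module_scheme \<Rightarrow> ('s, 'v) tree set" where
  "trees_over Sig V = {t. wf_tree Sig t \<and> leaves t \<subseteq> carrier V}"

definition coeff_prod :: "('k, 'n) ring_scheme \<Rightarrow> ('t \<Rightarrow> 'k) list \<Rightarrow> 't list \<Rightarrow> 'k" where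
  "coeff_prod K ps ts = foldr (\<lambda>(p, u) z. p u \<otimes>\<^bsub>K\<^esub> z) (zip ps ts) \<one>\<^bsub>K\<^esub>"

lemma coeff_prod_simps [simp]:
  "coeff_prod K [] ts = \<one>\<^bsub>K\<^esub>"
  "coeff_prod K (p # ps) (t # ts) = p t \<otimes>\<^bsub>K\<^esub> coeff_prod K ps ts"
  by (simp_all add: coeff_prod_def)

context
  fixes K :: "('k, 'n) ring_scheme" (structure) and Sig :: "'s signature"
    and V :: "('k, 'v, 'm) module_scheme" and \<alpha> :: "'v \<Rightarrow> 'v"
  assumes V: "module K V" and \<alpha>: "linear_map K V V \<alpha>"
begin

interpretation V: module K V using V .

private abbreviation (input) "T \<equiv> tree_algebra K Sig V \<alpha>"
private abbreviation (input) "R \<equiv> ring_module K"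
private abbreviation (input) "basis_tree t \<equiv> single (ring_module K) t \<one>"

lemma module_scalars: "module K R" using module_ring_module[OF V.R.cring_axioms] .

lemma finsupp_tree_algebra: "is_finsupp_module R (trees_over Sig V) T"
  unfolding is_finsupp_module_def tree_algebra_def finsupp_def trees_over_def
  by (auto simp: fun_eq_iff)

lemma module_tree_algebra: "module K T"
  using module_finsupp[OF module_scalars finsupp_tree_algebra] .

lemmas tree_algebra_simps = finsupp_simps[OF module_scalars finsupp_tree_algebra]

lemma spanning_trees: "spanning K T {basis_tree t | t. t \<in> trees_over Sig V}" (is "spanning K T ?S")
  unfolding spanning_def
proof (intro conjI allI impI)
  interpret T: module K T by (rule module_tree_algebra)
  show "?S \<subseteq> carrier T" using finsupp_single[OF module_scalars finsupp_tree_algebra] by (auto simp: tree_algebra_simps)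
  fix H assume H: "submodule H K T" and S: "?S \<subseteq> H"
  have "single R t c \<in> H" if "t \<in> trees_over Sig V" "c \<in> carrier K" for t c
  proof -
    have "c \<odot>\<^bsub>T\<^esub> basis_tree t \<in> H" using S that T.submoduleE(4)[OF H] by blast
    also have "c \<odot>\<^bsub>T\<^esub> basis_tree t = single R t c" using that by (auto simp: tree_algebra_simps single_def)
    finally show ?thesis .
  qed
  thus "carrier T \<subseteq> H" using spanning_single[OF module_scalars finsupp_tree_algebra] H unfolding spanning_def by auto
qed

lemma coeff_prod_closed:
  "\<forall>p\<in>set ps. \<forall>t. p t \<in> carrier K \<Longrightarrow> length ps = length ts \<Longrightarrow> coeff_prod K ps ts \<in> carrier K"
  by (induction ps ts rule: list_induct2') auto

lemma coeff_prod_nonzero: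
  "\<forall>p\<in>set ps. \<forall>t. p t \<in> carrier K \<Longrightarrow> length ps = length ts \<Longrightarrow> coeff_prod K ps ts \<noteq> \<zero>
    \<Longrightarrow> list_all2 (\<lambda>p t. p t \<noteq> \<zero>) ps ts"
proof (induction ps ts rule: list_induct2')
  case (4 p ps t ts)
  have "p t \<in> carrier K" "coeff_prod K ps ts \<in> carrier K"
    using 4 coeff_prod_closed[of ps ts] by auto
  hence "p t \<noteq> \<zero>" "coeff_prod K ps ts \<noteq> \<zero>" using 4 by auto
  thus ?case using 4 by auto
qed auto

text \<open>The right-hand side displays the linear dependence on the factor at position \<open>i\<close>.\<close>

lemma coeff_prod_update:
  "\<forall>p\<in>set ps. \<forall>t. p t \<in> carrier K \<Longrightarrow> length ps = length ts \<Longrightarrow> i < length ps \<Longrightarrow>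
    \<forall>t. q t \<in> carrier K \<Longrightarrow>
    coeff_prod K (ps[i := q]) ts = q (ts ! i) \<otimes> coeff_prod K (ps[i := \<lambda>t. \<one>]) ts"
proof (induction ps arbitrary: ts i)
  case (Cons p ps)
  obtain u us where ts: "ts = u # us" using Cons.prems(2) by (cases ts) auto
  have len: "length ps = length us" using Cons.prems(2) ts by simp
  have u: "\<forall>p\<in>set (ps[j := \<lambda>t. \<one>]). \<forall>t. p t \<in> carrier K" for j
    using Cons.prems(1) set_update_subset_insert[of ps j "\<lambda>t. \<one>"] by fastforce
  show ?case
  proof (cases i)
    case 0
    have "coeff_prod K ps us \<in> carrier K" using coeff_prod_closed[of ps us] Cons.prems len by auto
    thus ?thesis using 0 ts by simp
  next
    case (Suc j)
    have "coeff_prod K (ps[j := q]) us = q (us ! j) \<otimes> coeff_prod K (ps[j := \<lambda>t. \<one>]) us"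
      using Cons.prems Suc len by (intro Cons.IH) auto
    moreover have "coeff_prod K (ps[j := \<lambda>t. \<one>]) us \<in> carrier K"
      using coeff_prod_closed[OF u] len by simp
    ultimately show ?thesis using Suc ts Cons.prems by (simp add: V.R.m_lcomm)
  qed
qed simp

lemma opn_tree_algebra:
  "opn T s ps (Leaf v) = \<zero>"
  "opn T s ps (Node r ts) = (if r = s \<and> length ts = length ps then coeff_prod K ps ts else \<zero>)"
  by (simp_all add: tree_algebra_def coeff_prod_def)

lemma args_tree_algebra:
  assumes "ps \<in> args T n"
  shows "length ps = n" "\<forall>p\<in>set ps. p \<in> finsupp R (trees_over Sig V)" "\<forall>p\<in>set ps. \<forall>t. p t \<in> carrier K"
  using assms finsupp_closed[OF module_scalars finsupp_tree_algebra] by (auto simp: args_def tree_algebra_simps)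

lemma tree_algebra_closed: "p \<in> carrier T \<Longrightarrow> p t \<in> carrier K"
  using finsupp_closed[OF module_scalars finsupp_tree_algebra, of p t] by (simp add: tree_algebra_simps)

lemma ones_update:
  assumes "\<forall>p\<in>set ps. \<forall>t. p t \<in> carrier K"
  shows "\<forall>p\<in>set (ps[i := \<lambda>t. \<one>]). \<forall>t. p t \<in> carrier K"
proof
  fix p assume "p \<in> set (ps[i := \<lambda>t. \<one>])"
  hence "p = (\<lambda>t. \<one>) \<or> p \<in> set ps"
    using set_update_subset_insert[of ps i "\<lambda>t. \<one>"] by blast
  thus "\<forall>t. p t \<in> carrier K" using assms by auto
qed

lemma opn_tree_algebra_closed:
  assumes s: "s \<in> syms Sig" and ps: "ps \<in> args T (arity Sig s)"
  shows "opn T s ps \<in> carrier T"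
proof -
  note a = args_tree_algebra[OF ps]
  have cl: "opn T s ps t \<in> carrier K" for t
    by (cases t) (use coeff_prod_closed[OF a(3)] in \<open>auto simp: opn_tree_algebra\<close>)
  let ?L = "{ts. list_all2 (\<lambda>p t. p t \<noteq> \<zero>) ps ts}"
  have "\<exists>ts\<in>?L. t = Node s ts" if "opn T s ps t \<noteq> \<zero>" for t
    using that coeff_prod_nonzero[OF a(3)] by (cases t) (auto simp: opn_tree_algebra split: if_splits)
  hence sub: "{t. opn T s ps t \<noteq> \<zero>} \<subseteq> Node s ` ?L" by blast
  have L: "length ts = length ps \<and> (\<forall>t\<in>set ts. t \<in> trees_over Sig V \<and> t \<in> (\<Union>p\<in>set ps. {t. p t \<noteq> \<zero>}))"
    if "ts \<in> ?L" for ts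
  proof (intro conjI ballI)
    have l: "list_all2 (\<lambda>p t. p t \<noteq> \<zero>) ps ts" using that by simp
    show len: "length ts = length ps" using list_all2_lengthD[OF l] by simp
    fix t assume "t \<in> set ts"
    then obtain i where i: "i < length ps" "t = ts ! i" using len by (auto simp: in_set_conv_nth)
    hence t: "(ps ! i) t \<noteq> \<zero>" and p: "ps ! i \<in> set ps" using list_all2_nthD[OF l] by auto
    show "t \<in> (\<Union>p\<in>set ps. {t. p t \<noteq> \<zero>})" using t p by blast
    show "t \<in> trees_over Sig V" using t a(2) p by (auto simp: finsupp_def)
  qed
  have "finite (\<Union>p\<in>set ps. {t. p t \<noteq> \<zero>})" using a(2) by (auto simp: finsupp_def)
  hence "finite ?L"
    using L by (intro finite_subset[OF _ finite_lists_length_eq[of "\<Union>p\<in>set ps. {t. p t \<noteq> \<zero>}" "length ps"]]) auto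
  hence "finite {t. opn T s ps t \<noteq> \<zero>}" using finite_subset[OF sub] by blast
  moreover have "\<forall>t. opn T s ps t \<noteq> \<zero> \<longrightarrow> t \<in> trees_over Sig V"
  proof (intro allI impI)
    fix t assume "opn T s ps t \<noteq> \<zero>"
    then obtain ts where "t = Node s ts" "ts \<in> ?L" using sub by blast
    thus "t \<in> trees_over Sig V" using L[of ts] s a(1) by (auto simp: trees_over_def)
  qed
  ultimately show ?thesis using cl by (simp add: tree_algebra_simps finsupp_def)
qed

lemma op_algebra_tree_algebra: "op_algebra K Sig T"
proof -
  have "multilinear_map K T T (arity Sig s) (opn T s)" if s: "s \<in> syms Sig" for s
    unfolding multilinear_map_def
  proof (intro conjI ballI allI impI)
    fix ps assume "ps \<in> args T (arity Sig s)"
    thus "opn T s ps \<in> carrier T" using opn_tree_algebra_closed s by blast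
  next
    fix ps i p q assume ps: "ps \<in> args T (arity Sig s)" and i: "i < arity Sig s"
      and pq: "p \<in> carrier T" "q \<in> carrier T"
    note a = args_tree_algebra[OF ps]
    have K: "\<forall>t. p t \<in> carrier K" "\<forall>t. q t \<in> carrier K"
      using tree_algebra_closed pq by blast+
    have one: "coeff_prod K (ps[i := \<lambda>t. \<one>]) ts \<in> carrier K" if "length ts = length ps" for ts
      using a(3) that by (intro coeff_prod_closed ones_update) simp_all
    have K': "\<forall>t. p t \<oplus> q t \<in> carrier K" using K by simp
    note upd = coeff_prod_update[OF a(3) _ _ K(1)] coeff_prod_update[OF a(3) _ _ K(2)]
      coeff_prod_update[OF a(3) _ _ K']
    show "opn T s (ps[i := p \<oplus>\<^bsub>T\<^esub> q]) = opn T s (ps[i := p]) \<oplus>\<^bsub>T\<^esub> opn T s (ps[i := q])"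
    proof
      fix t show "opn T s (ps[i := p \<oplus>\<^bsub>T\<^esub> q]) t = (opn T s (ps[i := p]) \<oplus>\<^bsub>T\<^esub> opn T s (ps[i := q])) t"
        by (cases t) (use i a(1) K one in \<open>simp_all add: opn_tree_algebra tree_algebra_simps
            upd V.R.l_distr\<close>)
    qed
  next
    fix ps i c p assume ps: "ps \<in> args T (arity Sig s)" and i: "i < arity Sig s"
      and c: "c \<in> carrier K" and p: "p \<in> carrier T"
    note a = args_tree_algebra[OF ps]
    have K: "\<forall>t. p t \<in> carrier K"
      using tree_algebra_closed p by blast
    have one: "coeff_prod K (ps[i := \<lambda>t. \<one>]) ts \<in> carrier K" if "length ts = length ps" for ts
      using a(3) that by (intro coeff_prod_closed ones_update) simp_all
    have K': "\<forall>t. c \<otimes> p t \<in> carrier K" using K c by simp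
    note upd = coeff_prod_update[OF a(3) _ _ K] coeff_prod_update[OF a(3) _ _ K']
    show "opn T s (ps[i := c \<odot>\<^bsub>T\<^esub> p]) = c \<odot>\<^bsub>T\<^esub> opn T s (ps[i := p])"
    proof
      fix t show "opn T s (ps[i := c \<odot>\<^bsub>T\<^esub> p]) t = (c \<odot>\<^bsub>T\<^esub> opn T s (ps[i := p])) t"
        by (cases t) (use i a(1) K one c in \<open>simp_all add: opn_tree_algebra tree_algebra_simps
            upd V.R.m_assoc\<close>)
    qed
  qed
  thus ?thesis using module_tree_algebra by (simp add: op_algebra_def multilinear_iff)
qed

lemma coeff_prod_basis_tree:
  "length ts = length us \<Longrightarrow> coeff_prod K (map (\<lambda>t. basis_tree t) ts) us = (if us = ts then \<one> else \<zero>)"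
  by (induction ts us rule: list_induct2) (auto simp: single_def)

lemma opn_basis_tree: "opn T s (map (\<lambda>t. basis_tree t) ts) = basis_tree (Node s ts)"
proof
  fix t show "opn T s (map (\<lambda>t. basis_tree t) ts) t = basis_tree (Node s ts) t"
    by (cases t) (auto simp: opn_tree_algebra coeff_prod_basis_tree, auto simp: single_def)
qed

lemma basis_trees_list:
  assumes "set ps \<subseteq> {basis_tree t | t. t \<in> trees_over Sig V}"
  obtains ts where "set ts \<subseteq> trees_over Sig V" "ps = map (\<lambda>t. basis_tree t) ts"
  using assms
proof (induction ps arbitrary: thesis)
  case (Cons p ps)
  obtain ts where "set ts \<subseteq> trees_over Sig V" "ps = map (\<lambda>t. basis_tree t) ts"
    using Cons.IH Cons.prems(2) by auto
  moreover obtain t where "t \<in> trees_over Sig V" "p = basis_tree t" using Cons.prems(2) by auto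
  ultimately show ?case using Cons.prems(1)[of "t # ts"] by simp
qed simp

lemma twist_basis_tree:
  "twist T (basis_tree t) = basis_tree (map_tree \<alpha> t)"
proof
  fix u
  have "{w. basis_tree t w \<noteq> \<zero> \<and> map_tree \<alpha> w = u} =
      (if \<one> \<noteq> \<zero> \<and> map_tree \<alpha> t = u then {t} else {})"
    by (auto simp: single_def)
  thus "twist T (basis_tree t) u = basis_tree (map_tree \<alpha> t) u"
    by (auto simp: tree_algebra_def single_def)
qed

lemma map_tree_trees_over: "t \<in> trees_over Sig V \<Longrightarrow> map_tree \<alpha> t \<in> trees_over Sig V"
  using linear_mapD(1)[OF \<alpha>] by (auto simp: trees_over_def tree.set_map)

text \<open>Each coefficient of the twist is a linear functional: it adds up the coefficients at the trees that
  \<open>\<alpha>\<close> maps to the given one.\<close>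

lemma linear_map_twist_tree_algebra: "linear_map K T T (twist T)"
proof -
  define \<phi> where "\<phi> t u c = (if map_tree \<alpha> u = t then c else \<zero>)" for t u :: "('s, 'v) tree" and c
  have \<phi>: "linear_map K R R (\<phi> t u)" for t u by (auto simp: linear_map_def \<phi>_def)
  note lin = linear_map_total[OF module_scalars finsupp_tree_algebra module_scalars \<phi>]
  have eq: "twist T p t = total R R (\<phi> t) p" if p: "p \<in> carrier T" for p t
  proof -
    have fin: "finite {u. p u \<noteq> \<zero>}" using p by (auto simp: tree_algebra_simps finsupp_def)
    have "finsum K (\<lambda>u. p u) {u. p u \<noteq> \<zero> \<and> map_tree \<alpha> u = t} = finsum K (\<lambda>u. \<phi> t u (p u)) {u. p u \<noteq> \<zero>}"
      using p fin finsupp_closed[OF module_scalars finsupp_tree_algebra]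
      by (intro V.R.add.finprod_mono_neutral_cong_left) (auto simp: \<phi>_def tree_algebra_simps)
    thus ?thesis by (simp add: tree_algebra_def total_def)
  qed
  have cl: "twist T p \<in> carrier T" if p: "p \<in> carrier T" for p
  proof -
    let ?U = "{u. p u \<noteq> \<zero>}"
    have fin: "finite ?U" "?U \<subseteq> trees_over Sig V" using p by (auto simp: tree_algebra_simps finsupp_def)
    have sub: "t \<in> map_tree \<alpha> ` ?U" if "twist T p t \<noteq> \<zero>" for t
    proof (rule ccontr)
      assume "t \<notin> map_tree \<alpha> ` ?U"
      hence "{u. p u \<noteq> \<zero> \<and> map_tree \<alpha> u = t} = {}" by auto
      moreover have "twist T p t = finsum K p {u. p u \<noteq> \<zero> \<and> map_tree \<alpha> u = t}"
        by (simp add: tree_algebra_def)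
      ultimately have "twist T p t = \<zero>" by (simp only: V.R.finsum_empty)
      thus False using that by simp
    qed
    hence "{t. twist T p t \<noteq> \<zero>} \<subseteq> map_tree \<alpha> ` ?U" by blast
    hence "finite {t. twist T p t \<noteq> \<zero>}" using fin(1) finite_surj by blast
    moreover have "t \<in> trees_over Sig V" if "twist T p t \<noteq> \<zero>" for t
      using sub[OF that] fin(2) map_tree_trees_over by blast
    moreover have "twist T p t \<in> carrier K" for t
      using linear_mapD(1)[OF lin p] eq[OF p] by simp
    ultimately show ?thesis by (simp add: tree_algebra_simps finsupp_def)
  qed
  interpret T: module K T by (rule module_tree_algebra)
  show ?thesis
    unfolding linear_map_def
  proof (intro conjI ballI funcsetI cl)
    fix p q assume pq: "p \<in> carrier T" "q \<in> carrier T"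
    show "twist T (p \<oplus>\<^bsub>T\<^esub> q) = twist T p \<oplus>\<^bsub>T\<^esub> twist T q"
      unfolding tree_algebra_simps(3)[of "twist T p"]
    proof
      fix t show "twist T (p \<oplus>\<^bsub>T\<^esub> q) t = twist T p t \<oplus>\<^bsub>R\<^esub> twist T q t"
        unfolding eq[OF T.M.a_closed[OF pq]] eq[OF pq(1)] eq[OF pq(2)]
        using linear_mapD(2)[OF lin pq] by simp
    qed
  next
    fix c p assume c: "c \<in> carrier K" and p: "p \<in> carrier T"
    show "twist T (c \<odot>\<^bsub>T\<^esub> p) = c \<odot>\<^bsub>T\<^esub> twist T p"
      unfolding tree_algebra_simps(4)[of _ "twist T p"]
    proof
      fix t show "twist T (c \<odot>\<^bsub>T\<^esub> p) t = c \<odot>\<^bsub>R\<^esub> twist T p t"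
        unfolding eq[OF T.smult_closed[OF c p]] eq[OF p]
        using linear_mapD(3)[OF lin c p] by simp
    qed
  qed
qed

lemma hom_algebra_tree_algebra: "hom_algebra K Sig T"
proof -
  have "op_morphism K Sig T T (twist T)"
  proof (rule op_morphism_if_spanning[OF op_algebra_tree_algebra op_algebra_tree_algebra
        spanning_trees linear_map_twist_tree_algebra])
    fix s ps assume "set ps \<subseteq> {basis_tree t | t. t \<in> trees_over Sig V}"
    then obtain ts where "ps = map (\<lambda>t. basis_tree t) ts" by (rule basis_trees_list)
    moreover have "map (twist T) (map (\<lambda>t. basis_tree t) ts) = map (\<lambda>t. basis_tree t) (map (map_tree \<alpha>) ts)"
      by (simp add: twist_basis_tree)
    ultimately show "twist T (opn T s ps) = opn T s (map (twist T) ps)"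
      by (simp only: opn_basis_tree twist_basis_tree tree.map)
  qed
  thus ?thesis
    using op_algebra_tree_algebra linear_map_twist_tree_algebra
    by (simp add: hom_algebra_def linear_endo_iff op_morphism_def)
qed

lemma single_leaf_eq: "single_leaf K v = basis_tree (Leaf v)"
  by (auto simp: single_leaf_def single_def)

text \<open>The morphism is the linear extension of the evaluation of trees. It suffices to compare operations and
  twists at single trees, since these span.\<close>

lemma tree_algebra_lift:
  assumes A: "hom_algebra K Sig A" and \<iota>: "linear_map K V A \<iota>"
    and comm: "\<forall>v\<in>carrier V. \<iota> (\<alpha> v) = twist A (\<iota> v)"
  shows "\<exists>\<Phi>. hom_morphism K Sig T A \<Phi> \<and> (\<forall>v\<in>carrier V. \<Phi> (single_leaf K v) = \<iota> v)"
proof -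
  interpret A: module K A using hom_algebraD(2)[OF A] .
  have ev: "eval_tree A \<iota> t \<in> carrier A" if "t \<in> trees_over Sig V" for t
    using that eval_tree_closed[OF hom_algebraD(1)[OF A]] linear_mapD(1)[OF \<iota>]
    by (auto simp: trees_over_def subset_iff)
  define \<phi> where "\<phi> t c = c \<odot>\<^bsub>A\<^esub> eval_tree A \<iota> t" for t c
  have \<phi>: "linear_map K R A (\<phi> t)" if "t \<in> trees_over Sig V" for t
    using ev[OF that] by (auto simp: linear_map_def \<phi>_def A.smult_l_distr A.smult_assoc1)
  define \<Phi> where "\<Phi> = total R A \<phi>"
  have lin: "linear_map K T A \<Phi>"
    unfolding \<Phi>_def by (rule linear_map_total[OF module_scalars finsupp_tree_algebra hom_algebraD(2)[OF A] \<phi>])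
  have \<Phi>: "\<Phi> (basis_tree t) = eval_tree A \<iota> t" if "t \<in> trees_over Sig V" for t
    unfolding \<Phi>_def using total_single[OF module_scalars finsupp_tree_algebra hom_algebraD(2)[OF A] \<phi> that] ev[OF that]
    by (simp add: \<phi>_def)
  have op: "op_morphism K Sig T A \<Phi>"
  proof (rule op_morphism_if_spanning[OF op_algebra_tree_algebra hom_algebraD(1)[OF A] spanning_trees lin])
    fix s ps assume s: "s \<in> syms Sig" and ps: "ps \<in> args T (arity Sig s)"
      and S: "set ps \<subseteq> {basis_tree t | t. t \<in> trees_over Sig V}"
    obtain ts where ts: "set ts \<subseteq> trees_over Sig V" "ps = map (\<lambda>t. basis_tree t) ts"
      using S by (rule basis_trees_list)
    have "Node s ts \<in> trees_over Sig V"
      using ts s args_tree_algebra(1)[OF ps] by (auto simp: trees_over_def)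
    hence "\<Phi> (opn T s ps) = opn A s (map (eval_tree A \<iota>) ts)"
      by (simp add: ts(2) opn_basis_tree \<Phi>)
    also have "map (eval_tree A \<iota>) ts = map \<Phi> ps" using \<Phi> ts by auto
    finally show "\<Phi> (opn T s ps) = opn A s (map \<Phi> ps)" .
  qed
  have "\<Phi> (twist T p) = twist A (\<Phi> p)" if p: "p \<in> carrier T" for p
  proof (rule linear_map_eqI[OF module_tree_algebra hom_algebraD(2)[OF A] spanning_trees _ _ _ p])
    show "linear_map K T A (\<lambda>p. \<Phi> (twist T p))"
      by (rule linear_map_comp[OF linear_map_twist_tree_algebra lin])
    show "linear_map K T A (\<lambda>p. twist A (\<Phi> p))"
      by (rule linear_map_comp[OF lin hom_algebraD(3)[OF A]])
    fix p assume "p \<in> {basis_tree t | t. t \<in> trees_over Sig V}"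
    then obtain t where t: "t \<in> trees_over Sig V" "p = basis_tree t" by blast
    have tw: "op_morphism K Sig A A (twist A)"
      using A by (simp add: hom_algebra_def linear_endo_iff op_morphism_def)
    have "\<Phi> (twist T p) = eval_tree A (\<lambda>v. \<iota> (\<alpha> v)) t"
      using \<Phi>[OF map_tree_trees_over[OF t(1)]] by (simp add: t(2) twist_basis_tree eval_map_tree)
    also have "\<dots> = eval_tree A (\<lambda>v. twist A (\<iota> v)) t"
      using t(1) comm by (intro eval_tree_cong) (auto simp: trees_over_def)
    also have "\<dots> = twist A (eval_tree A \<iota> t)"
      using t(1) linear_mapD(1)[OF \<iota>]
      by (intro eval_tree_morphism[OF hom_algebraD(1)[OF A] tw, symmetric]) (auto simp: trees_over_def)
    finally show "\<Phi> (twist T p) = twist A (\<Phi> p)" using \<Phi>[OF t(1)] t(2) by simp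
  qed
  hence "hom_morphism K Sig T A \<Phi>" using op by (simp add: hom_morphism_def)
  moreover have "\<Phi> (single_leaf K v) = \<iota> v" if "v \<in> carrier V" for v
    using \<Phi>[of "Leaf v"] that by (simp add: single_leaf_eq trees_over_def)
  ultimately show ?thesis by blast
qed

end

section \<open>Evaluation of Hom-type identities\<close>

lemma wf_relabel_leaves [simp]:
  fixes T :: "('a, 'c) tree" and g :: "nat list \<Rightarrow> 'c \<Rightarrow> 'd"
  shows "wf_tree Sig (relabel_leaves T g) = wf_tree Sig T"
proof (induction T arbitrary: g)
  case (Node s ts)
  let ?ts = "map2 (\<lambda>i r. r (\<lambda>p. g (i # p))) [0..<length ts] (map relabel_leaves ts)"
  have "map (wf_tree Sig) ?ts = map (wf_tree Sig) ts"
    using Node by (intro nth_equalityI) auto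
  moreover have "(\<forall>t\<in>set us. wf_tree Sig t) = (\<forall>b\<in>set (map (wf_tree Sig) us). b)"
    for us :: "('a, 'd) tree list" by simp
  moreover have "(\<forall>t\<in>set ts. wf_tree Sig t) = (\<forall>b\<in>set (map (wf_tree Sig) ts). b)" by simp
  ultimately have "(\<forall>t\<in>set ?ts. wf_tree Sig t) = (\<forall>t\<in>set ts. wf_tree Sig t)" by (simp only:)
  moreover have "length ?ts = length ts" by simp
  ultimately show ?case by (simp only: relabel_leaves.simps wf_tree.simps)
qed simp

lemma comb_in_hom_type:
  "identity K Sig f \<Longrightarrow> comb_in K Sig UNIV (hom_type Sig f)"
  by (auto simp: identity_def comb_in_def hom_type_def hom_tree_def)

lemma hom_morphismD:
  assumes "hom_morphism K Sig A B \<phi>"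
  shows "op_morphism K Sig A B \<phi>" "linear_map K A B \<phi>"
    and "x \<in> carrier A \<Longrightarrow> \<phi> (twist A x) = twist B (\<phi> x)"
  using assms by (auto simp: hom_morphism_def op_morphism_def)

lemma twist_funpow_closed:
  assumes "hom_algebra K Sig A" "x \<in> carrier A"
  shows "(twist A ^^ n) x \<in> carrier A"
  using linear_mapD(1)[OF linear_map_funpow[OF hom_algebraD(3)[OF assms(1)]] assms(2)] .

lemma hom_morphism_funpow:
  assumes "hom_algebra K Sig A" "hom_morphism K Sig A B \<phi>" "x \<in> carrier A"
  shows "\<phi> ((twist A ^^ n) x) = (twist B ^^ n) (\<phi> x)"
  by (induction n) (use assms(3) twist_funpow_closed[OF assms(1,3)] in \<open>auto simp: hom_morphismD(3)[OF assms(2)]\<close>)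

lemma eval_hom_comb_morphism:
  assumes A: "hom_algebra K Sig A" and B: "hom_algebra K Sig B" and h: "hom_morphism K Sig A B \<phi>"
    and f: "identity K Sig f" and \<theta>: "\<And>v. \<theta> v \<in> carrier A"
  shows "\<phi> (eval_hom_comb A \<theta> (hom_type Sig f)) = eval_hom_comb B (\<lambda>v. \<phi> (\<theta> v)) (hom_type Sig f)"
proof -
  have "\<phi> (eval_hom_comb A \<theta> (hom_type Sig f)) =
      eval_comb B (\<lambda>w. \<phi> ((\<lambda>(n, v). (twist A ^^ n) (\<theta> v)) w)) (hom_type Sig f)"
    unfolding eval_hom_comb_def
    using \<theta> twist_funpow_closed[OF A]
    by (intro eval_comb_morphism[OF hom_algebraD(1)[OF A] hom_algebraD(1)[OF B] hom_morphismD(1)[OF h]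
          comb_in_hom_type[OF f]]) auto
  also have "(\<lambda>w. \<phi> ((\<lambda>(n, v). (twist A ^^ n) (\<theta> v)) w)) = (\<lambda>(n, v). (twist B ^^ n) (\<phi> (\<theta> v)))"
    using \<theta> by (auto simp: hom_morphism_funpow[OF A h])
  finally show ?thesis by (simp add: eval_hom_comb_def)
qed

lemma eval_hom_comb_closed:
  assumes A: "hom_algebra K Sig A" and f: "identity K Sig f" and \<theta>: "\<And>v. \<theta> v \<in> carrier A"
  shows "eval_hom_comb A \<theta> (hom_type Sig f) \<in> carrier A"
  unfolding eval_hom_comb_def
  using \<theta> twist_funpow_closed[OF A]
  by (intro eval_comb_closed[OF hom_algebraD(1)[OF A] comb_in_hom_type[OF f]]) auto

section \<open>The free Hom-algebra of a variety\<close>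

context
  fixes K :: "('k, 'n) ring_scheme" and Sig :: "'s signature"
    and V :: "('k, 'v, 'm) module_scheme" and \<alpha> :: "'v \<Rightarrow> 'v"
  assumes V: "module K V" and \<alpha>: "linear_map K V V \<alpha>"
begin

interpretation V: module K V using V .

private abbreviation (input) "TA \<equiv> tree_algebra K Sig V \<alpha>"

interpretation TA: module K TA using module_tree_algebra[OF V \<alpha>] .

lemma single_leaf_closed: "v \<in> carrier V \<Longrightarrow> single_leaf K v \<in> carrier TA"
  using finsupp_single[OF module_scalars[OF V \<alpha>] finsupp_tree_algebra[OF V \<alpha>], where t = "Leaf v" and x = "\<one>\<^bsub>K\<^esub>"]
  by (auto simp: single_leaf_eq[OF V \<alpha>] tree_algebra_simps[OF V \<alpha>] trees_over_def)

lemma leaf_relations_subset: "leaf_relations K Sig V \<alpha> \<subseteq> carrier TA"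
  by (auto simp: leaf_relations_def Let_def intro!: TA.M.minus_closed TA.M.a_closed TA.smult_closed single_leaf_closed)

lemma hom_algebra_free: "hom_algebra K Sig (free_hom_algebra K Sig V \<alpha>)"
  unfolding free_hom_algebra_def linearity_ideal_def
  by (intro hom_algebra_quotient hom_algebra_tree_algebra hom_ideal_generated V \<alpha> leaf_relations_subset)

lemma free_hom_inclusion_closed:
  assumes "v \<in> carrier V"
  shows "free_hom_inclusion K Sig V \<alpha> v \<in> carrier (free_hom_algebra K Sig V \<alpha>)"
proof -
  have "hom_morphism K Sig TA (free_hom_algebra K Sig V \<alpha>) (\<lambda>x. linearity_ideal K Sig V \<alpha> +>\<^bsub>TA\<^esub> x)"
    unfolding free_hom_algebra_def linearity_ideal_def
    by (intro coset_morphism hom_algebra_tree_algebra hom_ideal_generated V \<alpha> leaf_relations_subset)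
  from linear_mapD(1)[OF hom_morphismD(2)[OF this] single_leaf_closed[OF assms]]
  show ?thesis by (simp add: free_hom_inclusion_def)
qed

text \<open>The morphism on the tree algebra kills the relations that make the inclusion of the leaves
  linear, because \<open>\<iota>\<close> is linear.\<close>

lemma free_hom_algebra_lift:
  assumes A: "hom_algebra K Sig A" and \<iota>: "linear_map K V A \<iota>"
    and comm: "\<forall>v\<in>carrier V. \<iota> (\<alpha> v) = twist A (\<iota> v)"
  shows "\<exists>\<Phi>. hom_morphism K Sig (free_hom_algebra K Sig V \<alpha>) A \<Phi> \<and>
    (\<forall>v\<in>carrier V. \<Phi> (free_hom_inclusion K Sig V \<alpha> v) = \<iota> v)"
proof -
  interpret A: module K A using hom_algebraD(2)[OF A] .
  obtain \<Psi> where \<Psi>: "hom_morphism K Sig TA A \<Psi>" and \<Psi>v: "\<forall>v\<in>carrier V. \<Psi> (single_leaf K v) = \<iota> v"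
    using tree_algebra_lift[OF V \<alpha> A \<iota> comm] by blast
  note l = hom_morphismD(2)[OF \<Psi>]
  note minus = linear_map_minus[OF module_tree_algebra[OF V \<alpha>] hom_algebraD(2)[OF A] l]
  have ker: "\<forall>x\<in>leaf_relations K Sig V \<alpha>. \<Psi> x = \<zero>\<^bsub>A\<^esub>"
  proof
    fix x assume x: "x \<in> leaf_relations K Sig V \<alpha>"
    consider (add) a b where "a \<in> carrier V" "b \<in> carrier V"
        "x = single_leaf K (a \<oplus>\<^bsub>V\<^esub> b) \<ominus>\<^bsub>TA\<^esub> (single_leaf K a \<oplus>\<^bsub>TA\<^esub> single_leaf K b)"
      | (smult) c a where "c \<in> carrier K" "a \<in> carrier V"
        "x = single_leaf K (c \<odot>\<^bsub>V\<^esub> a) \<ominus>\<^bsub>TA\<^esub> c \<odot>\<^bsub>TA\<^esub> single_leaf K a"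
      using x unfolding leaf_relations_def Let_def by blast
    thus "\<Psi> x = \<zero>\<^bsub>A\<^esub>"
    proof cases
      case add
      thus ?thesis
        using linear_mapD(1)[OF \<iota>]
        by (simp add: TA.M.minus_eq single_leaf_closed minus linear_mapD(2)[OF l] \<Psi>v linear_mapD(2)[OF \<iota>]
            A.M.r_neg)
    next
      case smult
      thus ?thesis
        using linear_mapD(1)[OF \<iota>]
        by (simp add: TA.M.minus_eq single_leaf_closed minus linear_mapD[OF l] \<Psi>v linear_mapD(3)[OF \<iota>]
            A.M.r_neg)
    qed
  qed
  obtain \<Phi> where \<Phi>: "hom_morphism K Sig (free_hom_algebra K Sig V \<alpha>) A \<Phi>"
    and \<Phi>x: "\<forall>x\<in>carrier TA. \<Phi> (linearity_ideal K Sig V \<alpha> +>\<^bsub>TA\<^esub> x) = \<Psi> x"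
    using generated_quotient_lift[OF hom_algebra_tree_algebra[OF V \<alpha>] leaf_relations_subset A \<Psi> ker]
    unfolding free_hom_algebra_def linearity_ideal_def by blast
  have "\<Phi> (free_hom_inclusion K Sig V \<alpha> v) = \<iota> v" if "v \<in> carrier V" for v
    using \<Psi>v \<Phi>x single_leaf_closed[OF that] that by (simp add: free_hom_inclusion_def)
  thus ?thesis using \<Phi> by blast
qed

context
  fixes I :: "('k, 's) identity set"
  assumes I: "\<forall>g\<in>I. identity K Sig g"
begin

private abbreviation (input) "F \<equiv> free_hom_algebra K Sig V \<alpha>"
private abbreviation (input) "B \<equiv> free_hom_variety_algebra K Sig I V \<alpha>"
private abbreviation (input) "gen \<equiv> (\<lambda>v. hom_variety_ideal K Sig I V \<alpha> +>\<^bsub>F\<^esub> free_hom_inclusion K Sig V \<alpha> v)"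

lemma hom_identity_values_subset: "hom_identity_values Sig I F \<subseteq> carrier F"
  using I eval_hom_comb_closed[OF hom_algebra_free] by (auto simp: hom_identity_values_def Pi_iff)

lemma hom_variety_ideal: "hom_ideal K Sig F (hom_variety_ideal K Sig I V \<alpha>)"
  unfolding hom_variety_ideal_def
  by (rule hom_ideal_generated[OF hom_algebra_free hom_identity_values_subset])

lemma hom_algebra_free_variety: "hom_algebra K Sig B"
  unfolding free_hom_variety_algebra_def by (rule hom_algebra_quotient[OF hom_algebra_free hom_variety_ideal])

lemma generator_closed: "v \<in> carrier V \<Longrightarrow> gen v \<in> carrier B"
  unfolding free_hom_variety_algebra_def
  using linear_mapD(1)[OF hom_morphismD(2)[OF coset_morphism[OF hom_algebra_free hom_variety_ideal]]
      free_hom_inclusion_closed] .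

lemma free_variety_satisfies:
  assumes g: "g \<in> I" and \<theta>: "\<And>v. \<theta> v \<in> carrier V"
  shows "eval_hom_comb B (\<lambda>v. gen (\<theta> v)) (hom_type Sig g) = \<zero>\<^bsub>B\<^esub>"
proof -
  let ?J = "hom_variety_ideal K Sig I V \<alpha>"
  let ?\<theta> = "\<lambda>v. free_hom_inclusion K Sig V \<alpha> (\<theta> v)"
  have \<theta>F: "?\<theta> v \<in> carrier F" for v using free_hom_inclusion_closed[OF \<theta>] .
  have "eval_hom_comb F ?\<theta> (hom_type Sig g) \<in> hom_identity_values Sig I F"
    unfolding hom_identity_values_def using g \<theta>F by blast
  hence J: "eval_hom_comb F ?\<theta> (hom_type Sig g) \<in> ?J"
    unfolding hom_variety_ideal_def using generated_ideal_superset by fast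
  have gi: "identity K Sig g" using I g by blast
  have "eval_hom_comb B (\<lambda>v. gen (\<theta> v)) (hom_type Sig g) = ?J +>\<^bsub>F\<^esub> eval_hom_comb F ?\<theta> (hom_type Sig g)"
    unfolding free_hom_variety_algebra_def
    using eval_hom_comb_morphism[OF hom_algebra_free _ coset_morphism[OF hom_algebra_free hom_variety_ideal]
        gi, of ?\<theta>] hom_algebra_quotient[OF hom_algebra_free hom_variety_ideal] \<theta>F
    by simp
  also have "\<dots> = ?J"
    using coset_zero[OF hom_algebra_free hom_variety_ideal] eval_hom_comb_closed[OF hom_algebra_free gi, of ?\<theta>] \<theta>F J by blast
  also have "\<dots> = \<zero>\<^bsub>B\<^esub>" by (simp add: free_hom_variety_algebra_def quotient_algebra_def)
  finally show ?thesis .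
qed

text \<open>The morphism on the free Hom-algebra kills all values of the Hom-type identities, because \<open>A\<close>
  satisfies these identities.\<close>

lemma free_variety_lift:
  assumes A: "hom_variety_algebra K Sig I A" and \<iota>: "linear_map K V A \<iota>"
    and comm: "\<forall>v\<in>carrier V. \<iota> (\<alpha> v) = twist A (\<iota> v)"
  shows "\<exists>\<Phi>. hom_morphism K Sig B A \<Phi> \<and> (\<forall>v\<in>carrier V. \<Phi> (gen v) = \<iota> v)"
proof -
  have A': "hom_algebra K Sig A" and sat: "\<forall>f\<in>I. satisfies_hom_type Sig A f"
    using A by (auto simp: hom_variety_algebra_def)
  obtain \<Psi> where \<Psi>: "hom_morphism K Sig F A \<Psi>"
    and \<Psi>v: "\<forall>v\<in>carrier V. \<Psi> (free_hom_inclusion K Sig V \<alpha> v) = \<iota> v"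
    using free_hom_algebra_lift[OF A' \<iota> comm] by blast
  have ker: "\<forall>x\<in>hom_identity_values Sig I F. \<Psi> x = \<zero>\<^bsub>A\<^esub>"
  proof
    fix x assume x: "x \<in> hom_identity_values Sig I F"
    obtain f \<theta> where f: "f \<in> I" "\<theta> \<in> UNIV \<rightarrow> carrier F" "x = eval_hom_comb F \<theta> (hom_type Sig f)"
      using x unfolding hom_identity_values_def by blast
    have fi: "identity K Sig f" using I f by blast
    have \<theta>: "\<theta> v \<in> carrier F" for v using f(2) by auto
    have "\<Psi> x = eval_hom_comb A (\<lambda>v. \<Psi> (\<theta> v)) (hom_type Sig f)"
      unfolding f(3) by (rule eval_hom_comb_morphism[OF hom_algebra_free A' \<Psi> fi \<theta>])
    also have "(\<lambda>v. \<Psi> (\<theta> v)) \<in> UNIV \<rightarrow> carrier A"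
      using linear_mapD(1)[OF hom_morphismD(2)[OF \<Psi>] \<theta>] by blast
    hence "eval_hom_comb A (\<lambda>v. \<Psi> (\<theta> v)) (hom_type Sig f) = \<zero>\<^bsub>A\<^esub>"
      using sat f(1) unfolding satisfies_hom_type_def by blast
    finally show "\<Psi> x = \<zero>\<^bsub>A\<^esub>" .
  qed
  obtain \<Phi> where \<Phi>: "hom_morphism K Sig B A \<Phi>"
    and \<Phi>x: "\<forall>x\<in>carrier F. \<Phi> (hom_variety_ideal K Sig I V \<alpha> +>\<^bsub>F\<^esub> x) = \<Psi> x"
    using generated_quotient_lift[OF hom_algebra_free hom_identity_values_subset A' \<Psi> ker]
    unfolding free_hom_variety_algebra_def hom_variety_ideal_def by blast
  have "\<Phi> (gen v) = \<iota> v" if "v \<in> carrier V" for v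
    using \<Psi>v \<Phi>x free_hom_inclusion_closed[OF that] that by simp
  thus ?thesis using \<Phi> by blast
qed

end

end

section \<open>Homogeneous components of identities\<close>

text \<open>The number of leaves minus one, for operations of positive arity. In this form it adds up the
  exponents that the nodes of a tree contribute to a leaf outside the tree.\<close>

primrec weight :: "'s signature \<Rightarrow> ('s, 'v) tree \<Rightarrow> nat" where
  "weight Sig (Leaf v) = 0"
| "weight Sig (Node s ts) = (arity Sig s - 1) + sum_list (map (weight Sig) ts)"

definition component :: "'s signature \<Rightarrow> nat \<Rightarrow> ('k, 's, 'v) tree_comb \<Rightarrow> ('k, 's, 'v) tree_comb" where
  "component Sig d f = filter (\<lambda>(c, T). weight Sig T = d) f"

lemma weight_relabel_leaves [simp]: "weight Sig (relabel_leaves T g) = weight Sig T"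
proof (induction T arbitrary: g)
  case (Node s ts)
  have "map (weight Sig) (map2 (\<lambda>i r. r (\<lambda>p. g (i # p))) [0..<length ts] (map relabel_leaves ts)) =
      map (weight Sig) ts"
    using Node by (intro nth_equalityI) auto
  thus ?case by (simp only: relabel_leaves.simps weight.simps)
qed simp

lemma component_hom_type: "component Sig d (hom_type Sig f) = hom_type Sig (component Sig d f)"
  by (auto simp: component_def hom_type_def hom_tree_def filter_map comp_def case_prod_unfold)

lemma identity_component: "identity K Sig f \<Longrightarrow> identity K Sig (component Sig d f)"
  by (auto simp: identity_def component_def)

lemma comb_in_component: "comb_in K Sig V f \<Longrightarrow> comb_in K Sig V (component Sig d f)"
  by (auto simp: comb_in_def component_def)

lemma eval_comb_components:
  assumes A: "op_algebra K Sig A" and f: "comb_in K Sig V f" and \<theta>: "\<forall>v\<in>V. \<theta> v \<in> carrier A"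
    and D: "finite D" "\<forall>(c, T)\<in>set f. weight Sig T \<in> D"
  shows "finsum A (\<lambda>d. eval_comb A \<theta> (component Sig d f)) D = eval_comb A \<theta> f"
  using f D(2)
proof (induction f)
  case Nil
  interpret A: module K A using op_algebraD(1)[OF A] .
  show ?case by (simp add: component_def)
next
  case (Cons cT f)
  interpret A: module K A using op_algebraD(1)[OF A] .
  obtain c T where cT: "cT = (c, T)" by (cases cT)
  have f: "comb_in K Sig V f" and T: "c \<in> carrier K" "wf_tree Sig T" "\<forall>v\<in>leaves T. \<theta> v \<in> carrier A"
    and d: "weight Sig T \<in> D"
    using Cons.prems \<theta> by (auto simp: comb_in_def cT)
  let ?x = "c \<odot>\<^bsub>A\<^esub> eval_tree A \<theta> T"
  have x: "?x \<in> carrier A" using T eval_tree_closed[OF A T(2,3)] by simp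
  have cl: "eval_comb A \<theta> (component Sig d f) \<in> carrier A" for d
    using eval_comb_closed[OF A comb_in_component[OF f] \<theta>] .
  have "eval_comb A \<theta> (component Sig d (cT # f)) =
      (if d = weight Sig T then ?x else \<zero>\<^bsub>A\<^esub>) \<oplus>\<^bsub>A\<^esub> eval_comb A \<theta> (component Sig d f)" for d
    using x cl[of d] by (auto simp: component_def cT)
  hence "finsum A (\<lambda>d. eval_comb A \<theta> (component Sig d (cT # f))) D =
      finsum A (\<lambda>d. if d = weight Sig T then ?x else \<zero>\<^bsub>A\<^esub>) D \<oplus>\<^bsub>A\<^esub>
      finsum A (\<lambda>d. eval_comb A \<theta> (component Sig d f)) D"
    using x cl by (simp add: A.M.finsum_addf Pi_iff)
  also have "finsum A (\<lambda>d. if d = weight Sig T then ?x else \<zero>\<^bsub>A\<^esub>) D = ?x"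
    using A.M.add.finprod_singleton_swap[OF d D(1), of "\<lambda>_. ?x"] x by simp
  also have "finsum A (\<lambda>d. eval_comb A \<theta> (component Sig d f)) D = eval_comb A \<theta> f"
    using Cons by (intro Cons.IH f) auto
  finally show ?case by (simp add: cT)
qed

context
  fixes K :: "('k, 'n) ring_scheme" and Sig :: "'s signature"
    and A :: "('k, 'a, 's, 'm) hom_algebra_scheme" and G :: "'a set" and D :: "nat \<Rightarrow> 'a set"
  assumes Sig: "signature Sig" and A: "hom_algebra K Sig A" and D: "pos_grading K Sig A G D"
begin

interpretation A: module K A using hom_algebraD(2)[OF A] .

lemma degree_submodule: "submodule (D (Suc d)) K A"
  using D by (simp add: pos_grading_def)

lemma degree_twist_funpow: "x \<in> D 1 \<Longrightarrow> (twist A ^^ n) x \<in> D 1"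
proof (induction n)
  case (Suc n)
  have "\<forall>a\<ge>1. twist A ` D a \<subseteq> D a" using D unfolding pos_grading_def by (elim conjE)
  thus ?case using Suc by fastforce
qed simp

lemma degree_opn:
  assumes "s \<in> syms Sig" "length as = arity Sig s" "list_all2 (\<lambda>a x. 1 \<le> a \<and> x \<in> D a) as xs"
  shows "opn A s xs \<in> D (sum_list as)"
proof -
  have "\<forall>s\<in>syms Sig. \<forall>as xs. length as = arity Sig s \<and>
      list_all2 (\<lambda>a x. 1 \<le> a \<and> x \<in> D a) as xs \<longrightarrow> opn A s xs \<in> D (sum_list as)"
    using D unfolding pos_grading_def by (elim conjE)
  from this[rule_format, OF assms(1), of as xs] show ?thesis using assms by blast
qed

lemma eval_tree_degree:
  assumes "wf_tree Sig T" "\<forall>v\<in>leaves T. \<theta> v \<in> D 1"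
  shows "eval_tree A \<theta> T \<in> D (Suc (weight Sig T))"
  using assms
proof (induction T)
  case (Node s ts)
  let ?ds = "map (\<lambda>t. Suc (weight Sig t)) ts"
  have s: "s \<in> syms Sig" "length ts = arity Sig s" "1 \<le> arity Sig s"
    using Node.prems Sig by (auto simp: signature_def)
  have "list_all2 (\<lambda>a x. 1 \<le> a \<and> x \<in> D a) ?ds (map (eval_tree A \<theta>) ts)"
    using Node by (auto simp: list_all2_map1 list_all2_map2 list_all2_same)
  hence "opn A s (map (eval_tree A \<theta>) ts) \<in> D (sum_list ?ds)"
    using s by (intro degree_opn) simp_all
  moreover have "sum_list ?ds = sum_list (map (weight Sig) ts) + length ts"
    by (induction ts) auto
  ultimately show ?case using s by (simp add: add.commute)
qed simp

lemma eval_comb_degree: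
  assumes "comb_in K Sig V f" "\<forall>v\<in>V. \<theta> v \<in> D 1"
  shows "eval_comb A \<theta> (component Sig d f) \<in> D (Suc d)"
  using assms(1)
proof (induction f)
  case Nil
  show ?case
    using subgroup.one_closed[OF submodule.axioms(1)[OF degree_submodule]] by (simp add: component_def)
next
  case (Cons cT f)
  obtain c T where cT: "cT = (c, T)" by (cases cT)
  have f: "comb_in K Sig V f" and T: "c \<in> carrier K" "wf_tree Sig T" "\<forall>v\<in>leaves T. \<theta> v \<in> D 1"
    using Cons.prems assms(2) by (auto simp: comb_in_def cT)
  have "c \<odot>\<^bsub>A\<^esub> eval_tree A \<theta> T \<in> D (Suc (weight Sig T))"
    by (rule A.submoduleE(4)[OF degree_submodule T(1) eval_tree_degree[OF T(2,3)]])
  thus ?case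
    using Cons.IH[OF f] A.submoduleE(5)[OF degree_submodule[of d], OF _ Cons.IH[OF f]]
    by (cases "weight Sig T = d") (simp_all add: component_def cT)
qed

text \<open>The components of a combination of trees have their values in different degrees, and zero has only
  one decomposition.\<close>

lemma eval_comb_component_zero:
  assumes f: "comb_in K Sig V f" and \<theta>: "\<forall>v\<in>V. \<theta> v \<in> D 1" and zero: "eval_comb A \<theta> f = \<zero>\<^bsub>A\<^esub>"
  shows "eval_comb A \<theta> (component Sig d f) = \<zero>\<^bsub>A\<^esub>"
proof -
  let ?e = "\<lambda>d. eval_comb A \<theta> (component Sig d f)"
  let ?W = "weight Sig ` snd ` set f"
  let ?ok = "\<lambda>c. c \<in> (\<Pi>\<^sub>E a\<in>{1..}. D a) \<and> finite {a\<in>{1..}. c a \<noteq> \<zero>\<^bsub>A\<^esub>} \<and>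
    \<zero>\<^bsub>A\<^esub> = (\<Oplus>\<^bsub>A\<^esub>a\<in>{a\<in>{1..}. c a \<noteq> \<zero>\<^bsub>A\<^esub>}. c a)"
  have sub: "D (Suc d) \<subseteq> carrier A" for d using A.submoduleE(1)[OF degree_submodule] .
  have \<theta>': "\<forall>v\<in>V. \<theta> v \<in> carrier A" using \<theta> sub[of 0] by auto
  have e: "?e d \<in> D (Suc d)" for d by (rule eval_comb_degree[OF f \<theta>])
  have ecl: "?e d \<in> carrier A" for d using e[of d] sub by blast
  have eW: "?e d = \<zero>\<^bsub>A\<^esub>" if "d \<notin> ?W" for d
  proof -
    have "component Sig d f = []" using that by (force simp: component_def filter_empty_conv)
    thus ?thesis by simp
  qed
  \<comment> \<open>Leaves have degree 1 and weight 0, so the component of weight \<open>d\<close> is the part of degree \<open>d + 1\<close>.\<close>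
  define c where "c = (\<lambda>a\<in>{1..}. ?e (a - 1))"
  have S: "{a\<in>{1..}. c a \<noteq> \<zero>\<^bsub>A\<^esub>} \<subseteq> Suc ` ?W"
  proof
    fix a assume "a \<in> {a\<in>{1..}. c a \<noteq> \<zero>\<^bsub>A\<^esub>}"
    hence "a \<ge> 1" "?e (a - 1) \<noteq> \<zero>\<^bsub>A\<^esub>" by (auto simp: c_def)
    hence "a - 1 \<in> ?W" using eW by blast
    thus "a \<in> Suc ` ?W" using \<open>a \<ge> 1\<close> by (metis Suc_diff_1 image_eqI less_eq_Suc_le One_nat_def)
  qed
  have "(\<Oplus>\<^bsub>A\<^esub>a\<in>{a\<in>{1..}. c a \<noteq> \<zero>\<^bsub>A\<^esub>}. c a) = (\<Oplus>\<^bsub>A\<^esub>a\<in>Suc ` ?W. c a)"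
    using ecl by (intro A.M.add.finprod_mono_neutral_cong_left S) (auto simp: c_def)
  also have "\<dots> = (\<Oplus>\<^bsub>A\<^esub>d\<in>?W. c (Suc d))"
    using ecl by (intro A.M.add.finprod_reindex) (auto simp: c_def)
  also have "\<dots> = (\<Oplus>\<^bsub>A\<^esub>d\<in>?W. ?e d)" by (simp add: c_def)
  also have "\<dots> = \<zero>\<^bsub>A\<^esub>"
    using eval_comb_components[OF hom_algebraD(1)[OF A] f \<theta>', of ?W] zero by force
  finally have sum: "(\<Oplus>\<^bsub>A\<^esub>a\<in>{a\<in>{1..}. c a \<noteq> \<zero>\<^bsub>A\<^esub>}. c a) = \<zero>\<^bsub>A\<^esub>" .
  have "?ok c"
  proof (intro conjI)
    show "\<zero>\<^bsub>A\<^esub> = (\<Oplus>\<^bsub>A\<^esub>a\<in>{a\<in>{1..}. c a \<noteq> \<zero>\<^bsub>A\<^esub>}. c a)" using sum by (rule sym)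
    show "finite {a\<in>{1..}. c a \<noteq> \<zero>\<^bsub>A\<^esub>}" using S by (rule finite_subset) simp
    have "c a \<in> D a" if "1 \<le> a" for a
      using that e[of "a - 1"] by (simp add: c_def)
    thus "c \<in> (\<Pi>\<^sub>E a\<in>{1..}. D a)" unfolding PiE_iff by (simp add: c_def)
  qed
  moreover have "?ok (\<lambda>a\<in>{1..}. \<zero>\<^bsub>A\<^esub>)"
  proof -
    have z: "\<zero>\<^bsub>A\<^esub> \<in> D a" if "1 \<le> a" for a
      using that subgroup.one_closed[OF submodule.axioms(1)[OF degree_submodule[of "a - 1"]]] by simp
    have S0: "{a\<in>{1..}. (\<lambda>a\<in>{1..}. \<zero>\<^bsub>A\<^esub>) a \<noteq> \<zero>\<^bsub>A\<^esub>} = {}" by auto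
    show ?thesis
    proof (intro conjI)
      show "(\<lambda>a\<in>{1..}. \<zero>\<^bsub>A\<^esub>) \<in> (\<Pi>\<^sub>E a\<in>{1..}. D a)" using z by (simp add: PiE_iff)
    qed (simp_all only: S0 A.M.finsum_empty finite.emptyI)
  qed
  moreover have "\<exists>!c. ?ok c"
    using D[unfolded pos_grading_def, THEN conjunct2, THEN conjunct1, rule_format, OF A.M.zero_closed] .
  moreover have uniq: "x = y" if "\<exists>!c. P c" "P x" "P y" for P and x y :: "nat \<Rightarrow> 'a" using that by blast
  ultimately have "c = (\<lambda>a\<in>{1..}. \<zero>\<^bsub>A\<^esub>)" by (intro uniq[of ?ok c])
  hence "c (Suc d) = \<zero>\<^bsub>A\<^esub>" by simp
  thus ?thesis by (simp add: c_def)
qed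

end

text \<open>The free Hom-\<open>Q\<close>-algebra on the vector space \<open>A\<close> itself, twisted by the twist of \<open>A\<close>, maps onto \<open>A\<close>
  with every element of \<open>A\<close> the image of a generator. The grading splits the identity at
  generators, and the morphism carries the result to arbitrary elements of \<open>A\<close>.\<close>

lemma hom_variety_satisfies_component:
  fixes K :: "('k, 'n) ring_scheme" and A :: "('k, 'u, 's) hom_algebra"
  assumes Sig: "signature Sig" and I: "\<forall>g\<in>I. identity K Sig g"
    and graded: "\<forall>(V :: ('k, 'u) module) \<alpha>. module K V \<longrightarrow> linear_endo K V \<alpha> \<longrightarrow>
           pos_graded K Sig (free_hom_variety_algebra K Sig I V \<alpha>)
             (free_hom_variety_generators K Sig I V \<alpha>)"
    and A: "hom_variety_algebra K Sig I A" and g: "g \<in> I"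
  shows "satisfies_hom_type Sig A (component Sig d g)"
  unfolding satisfies_hom_type_def
proof
  fix \<theta> :: "nat \<Rightarrow> 'u" assume \<theta>: "\<theta> \<in> UNIV \<rightarrow> carrier A"
  have A': "hom_algebra K Sig A" using A by (simp add: hom_variety_algebra_def)
  define V :: "('k, 'u) module" where
    "V = \<lparr>carrier = carrier A, mult = mult A, one = one A, zero = zero A, add = add A, smult = smult A\<rparr>"
  have V: "module K V"
    by (rule module_surjective_image[OF hom_algebraD(2)[OF A'], of V id])
      (auto simp: V_def linear_map_def)
  have \<alpha>: "linear_map K V V (twist A)"
    using hom_algebraD(3)[OF A'] by (simp add: V_def linear_map_def)
  have \<theta>V: "\<theta> v \<in> carrier V" for v using \<theta> by (auto simp: V_def)
  let ?B = "free_hom_variety_algebra K Sig I V (twist A)"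
  define gen where "gen v = hom_variety_ideal K Sig I V (twist A) +>\<^bsub>free_hom_algebra K Sig V (twist A)\<^esub>
    free_hom_inclusion K Sig V (twist A) v" for v
  have B: "hom_algebra K Sig ?B" by (rule hom_algebra_free_variety[OF V \<alpha> I])
  obtain D where D: "pos_grading K Sig ?B (free_hom_variety_generators K Sig I V (twist A)) D"
    using graded V \<alpha> by (auto simp: linear_endo_iff pos_graded_def)
  have "gen v \<in> D 1" if "v \<in> carrier V" for v
    using D that by (auto simp: pos_grading_def free_hom_variety_generators_def gen_def)
  hence "\<forall>w\<in>UNIV. (\<lambda>(n, v). (twist ?B ^^ n) (gen (\<theta> v))) w \<in> D 1"
    using degree_twist_funpow[OF Sig B D] \<theta>V by auto
  moreover have "identity K Sig g" using I g by blast
  moreover have "eval_hom_comb ?B (\<lambda>v. gen (\<theta> v)) (hom_type Sig g) = \<zero>\<^bsub>?B\<^esub>"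
    unfolding gen_def by (rule free_variety_satisfies[OF V \<alpha> I g \<theta>V])
  ultimately have *: "eval_hom_comb ?B (\<lambda>v. gen (\<theta> v)) (hom_type Sig (component Sig d g)) = \<zero>\<^bsub>?B\<^esub>"
    unfolding eval_hom_comb_def component_hom_type[symmetric]
    by (intro eval_comb_component_zero[OF Sig B D comb_in_hom_type])
  have gen: "gen v \<in> carrier ?B" if "v \<in> carrier V" for v
    unfolding gen_def by (rule generator_closed[OF V \<alpha> I that])
  have "linear_map K V A id" "\<forall>v\<in>carrier V. id (twist A v) = twist A (id v)"
    by (simp_all add: linear_map_def V_def)
  from free_variety_lift[OF V \<alpha> I A this]
  obtain \<Phi> where \<Phi>: "hom_morphism K Sig ?B A \<Phi>" "\<forall>v\<in>carrier V. \<Phi> (gen v) = v"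
    unfolding gen_def id_def by blast
  have "eval_hom_comb A \<theta> (hom_type Sig (component Sig d g)) =
      \<Phi> (eval_hom_comb ?B (\<lambda>v. gen (\<theta> v)) (hom_type Sig (component Sig d g)))"
    using eval_hom_comb_morphism[OF B A' \<Phi>(1) identity_component[OF \<open>identity K Sig g\<close>], of "\<lambda>v. gen (\<theta> v)" d]
      gen \<theta>V by (simp add: \<Phi>(2))
  also have "\<dots> = \<zero>\<^bsub>A\<^esub>"
    unfolding * by (rule linear_map_zero[OF hom_algebraD(2)[OF B] hom_algebraD(2)[OF A'] hom_morphismD(2)[OF \<Phi>(1)]])
  finally show "eval_hom_comb A \<theta> (hom_type Sig (component Sig d g)) = \<zero>\<^bsub>A\<^esub>" .
qed

section \<open>Recursive evaluation of Hom-type trees\<close>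

definition hom_eval ::
  "'s signature \<Rightarrow> ('k, 'a, 's, 'm) hom_algebra_scheme \<Rightarrow> ('v \<Rightarrow> 'a) \<Rightarrow> ('s, 'v) tree \<Rightarrow> 'a" where
  "hom_eval Sig A \<theta> T = eval_tree A (\<lambda>(n, v). (twist A ^^ n) (\<theta> v)) (hom_tree Sig T)"

lemma sum_list_map_concat: "sum_list (map f (concat xss)) = (\<Sum>xs\<leftarrow>xss. sum_list (map f xs))"
  by (induction xss) auto

lemma sum_list_internal_nodes: "(\<Sum>(q, s)\<leftarrow>internal_nodes T. arity Sig s - 1) = weight Sig T"
proof (induction T)
  case (Node s ts)
  have "map (\<lambda>xs. \<Sum>(q, s)\<leftarrow>xs. arity Sig s - 1)
      (map2 (\<lambda>i. map (\<lambda>(p, r). (i # p, r))) [0..<length ts] (map internal_nodes ts)) = map (weight Sig) ts"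
    using Node by (intro nth_equalityI) (auto simp: comp_def case_prod_unfold)
  thus ?case by (simp add: sum_list_map_concat)
qed simp

text \<open>The root lies above all leaves and contributes nothing, and the nodes of another subtree all
  contribute, in total the weight of this subtree.\<close>

lemma leaf_exponent_Node:
  assumes "i < length ts"
  shows "leaf_exponent Sig (Node s ts) (i # p) =
    leaf_exponent Sig (ts ! i) p + (sum_list (map (weight Sig) ts) - weight Sig (ts ! i))"
proof -
  let ?f = "\<lambda>(q, s). if prefix q (i # p) then 0 else arity Sig s - 1"
  let ?xss = "map2 (\<lambda>j. map (\<lambda>(p, r). (j # p, r))) [0..<length ts] (map internal_nodes ts)"
  have nth: "sum_list (map ?f (?xss ! j)) = (if j = i then leaf_exponent Sig (ts ! i) p else weight Sig (ts ! j))"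
    if "j < length ts" for j
  proof (cases "j = i")
    case True
    thus ?thesis using that by (simp add: leaf_exponent_def comp_def case_prod_unfold cong: if_cong)
  next
    case False
    have "map (?f \<circ> (\<lambda>(p, r). (j # p, r))) (internal_nodes (ts ! j)) =
        map (\<lambda>(q, s). arity Sig s - 1) (internal_nodes (ts ! j))"
      using False by auto
    hence "sum_list (map (?f \<circ> (\<lambda>(p, r). (j # p, r))) (internal_nodes (ts ! j))) = weight Sig (ts ! j)"
      by (simp only: sum_list_internal_nodes)
    moreover have "map ?f (?xss ! j) = map (?f \<circ> (\<lambda>(p, r). (j # p, r))) (internal_nodes (ts ! j))"
      using that by simp
    ultimately show ?thesis using False by (simp only: if_False)
  qed
  have "leaf_exponent Sig (Node s ts) (i # p) = (\<Sum>xs\<leftarrow>?xss. sum_list (map ?f xs))"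
    by (simp add: leaf_exponent_def sum_list_map_concat)
  also have "\<dots> = (\<Sum>j<length ts. if j = i then leaf_exponent Sig (ts ! i) p else weight Sig (ts ! j))"
    using nth by (simp add: sum_list_sum_nth atLeast0LessThan)
  also have "\<dots> = leaf_exponent Sig (ts ! i) p + (\<Sum>j\<in>{..<length ts} - {i}. weight Sig (ts ! j))"
    using assms by (subst sum.remove[of _ i]) auto
  also have "(\<Sum>j\<in>{..<length ts} - {i}. weight Sig (ts ! j)) =
      sum_list (map (weight Sig) ts) - weight Sig (ts ! i)"
    using assms by (subst sum_diff1_nat) (auto simp: sum_list_sum_nth atLeast0LessThan)
  finally show ?thesis .
qed

lemma map_tree_relabel_leaves: "map_tree F (relabel_leaves t g) = relabel_leaves t (\<lambda>p v. F (g p v))"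
proof (induction t arbitrary: g)
  case (Node s ts)
  have "map (map_tree F) (map2 (\<lambda>i r. r (\<lambda>p. g (i # p))) [0..<length ts] (map relabel_leaves ts)) =
     map2 (\<lambda>i r. r (\<lambda>p v. F (g (i # p) v))) [0..<length ts] (map relabel_leaves ts)"
    using Node by (intro nth_equalityI) auto
  thus ?case by (simp only: relabel_leaves.simps tree.map)
qed simp

lemma hom_tree_Node:
  "hom_tree Sig (Node s ts) =
    Node s (map (\<lambda>t. map_tree (\<lambda>(n, v). (n + (sum_list (map (weight Sig) ts) - weight Sig t), v))
      (hom_tree Sig t)) ts)"
proof -
  have "map2 (\<lambda>i r. r (\<lambda>p v. (leaf_exponent Sig (Node s ts) (i # p), v))) [0..<length ts] (map relabel_leaves ts) =
    map (\<lambda>t. map_tree (\<lambda>(n, v). (n + (sum_list (map (weight Sig) ts) - weight Sig t), v)) (hom_tree Sig t)) ts"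
    by (intro nth_equalityI) (auto simp: hom_tree_def map_tree_relabel_leaves leaf_exponent_Node)
  thus ?thesis by (simp only: hom_tree_def relabel_leaves.simps)
qed

lemma op_morphism_twist_funpow:
  assumes A: "hom_algebra K Sig A"
  shows "op_morphism K Sig A A (twist A ^^ n)"
proof -
  note l = linear_map_funpow[OF hom_algebraD(3)[OF A], of n]
  have "(twist A ^^ n) (opn A s xs) = opn A s (map (twist A ^^ n) xs)"
    if s: "s \<in> syms Sig" and xs: "xs \<in> args A (arity Sig s)" for s xs
  proof (induction n)
    case (Suc n)
    have "map (twist A ^^ n) xs \<in> args A (arity Sig s)"
      by (rule linear_map_args[OF linear_map_funpow[OF hom_algebraD(3)[OF A]] xs])
    thus ?case using Suc hom_algebraD(4)[OF A s] by (simp add: comp_def)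
  qed simp
  thus ?thesis using l by (simp add: op_morphism_def)
qed

lemma hom_eval_closed:
  assumes "hom_algebra K Sig A" "wf_tree Sig T" "\<And>v. \<theta> v \<in> carrier A"
  shows "hom_eval Sig A \<theta> T \<in> carrier A"
  unfolding hom_eval_def
  using assms twist_funpow_closed[OF assms(1)]
  by (intro eval_tree_closed[OF hom_algebraD(1)[OF assms(1)]]) (auto simp: hom_tree_def)

lemma hom_eval_Leaf [simp]: "hom_eval Sig A \<theta> (Leaf v) = \<theta> v"
  by (simp add: hom_eval_def hom_tree_def leaf_exponent_def)

text \<open>The exponent that a leaf receives from the subtrees other than its own is the same for all leaves of a
  subtree. As the twist is an endomorphism, it can be applied to the value of the subtree instead.\<close>

lemma hom_eval_Node:
  assumes A: "hom_algebra K Sig A" and T: "wf_tree Sig (Node s ts)" and \<theta>: "\<And>v. \<theta> v \<in> carrier A"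
  shows "hom_eval Sig A \<theta> (Node s ts) =
    opn A s (map (\<lambda>t. (twist A ^^ (sum_list (map (weight Sig) ts) - weight Sig t)) (hom_eval Sig A \<theta> t)) ts)"
proof -
  let ?e = "\<lambda>(n, v). (twist A ^^ n) (\<theta> v)"
  have "eval_tree A ?e (map_tree (\<lambda>(n, v). (n + k, v)) (hom_tree Sig t)) = (twist A ^^ k) (hom_eval Sig A \<theta> t)"
    if "t \<in> set ts" for t k
  proof -
    have t: "wf_tree Sig (hom_tree Sig t)" using T that by (auto simp: hom_tree_def)
    have "eval_tree A ?e (map_tree (\<lambda>(n, v). (n + k, v)) (hom_tree Sig t)) =
        eval_tree A (\<lambda>w. (twist A ^^ k) (?e w)) (hom_tree Sig t)"
      unfolding eval_map_tree
      by (intro eval_tree_cong) (auto simp: case_prod_unfold funpow_add[symmetric] add.commute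
          simp flip: comp_apply[of "twist A ^^ k"])
    also have "\<dots> = (twist A ^^ k) (eval_tree A ?e (hom_tree Sig t))"
      using \<theta> twist_funpow_closed[OF A]
      by (intro eval_tree_morphism[OF hom_algebraD(1)[OF A] op_morphism_twist_funpow[OF A] t, symmetric]) auto
    finally show ?thesis by (simp add: hom_eval_def)
  qed
  hence "map (eval_tree A ?e) (map (\<lambda>t. map_tree (\<lambda>(n, v). (n + (sum_list (map (weight Sig) ts) - weight Sig t), v))
      (hom_tree Sig t)) ts) =
    map (\<lambda>t. (twist A ^^ (sum_list (map (weight Sig) ts) - weight Sig t)) (hom_eval Sig A \<theta> t)) ts"
    by simp
  thus ?thesis by (simp only: hom_eval_def[of Sig A \<theta> "Node s ts"] hom_tree_Node eval_tree.simps)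
qed

lemma eval_hom_comb_simps:
  "eval_hom_comb A \<theta> (hom_type Sig []) = \<zero>\<^bsub>A\<^esub>"
  "eval_hom_comb A \<theta> (hom_type Sig ((c, T) # f)) =
    c \<odot>\<^bsub>A\<^esub> hom_eval Sig A \<theta> T \<oplus>\<^bsub>A\<^esub> eval_hom_comb A \<theta> (hom_type Sig f)"
  by (simp_all add: eval_hom_comb_def hom_type_def hom_eval_def)

section \<open>Algebras of polynomials\<close>

definition compositions :: "nat \<Rightarrow> nat \<Rightarrow> nat list set" where
  "compositions n e = {bs. length bs = n \<and> sum_list bs = e}"

lemma finite_compositions: "finite (compositions n e)"
proof (rule finite_subset)
  show "compositions n e \<subseteq> {bs. set bs \<subseteq> {..e} \<and> length bs = n}"
    using member_le_sum_list by (auto simp: compositions_def)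
qed (simp add: finite_lists_length_eq)

definition series_term ::
  "('k, 'a, 's, 'm) op_algebra_scheme \<Rightarrow> ('a \<Rightarrow> 'a) \<Rightarrow> 's \<Rightarrow> (nat \<Rightarrow> 'a) list \<Rightarrow> nat list \<Rightarrow> 'a" where
  "series_term A \<tau> s xs bs = opn A s (map2 (\<lambda>b x. (\<tau> ^^ (sum_list bs - b)) (x b)) bs xs)"

text \<open>Sequences stand for polynomials, and the operations are convolutions. There are two instances.
  With \<open>\<tau>\<close> the identity and no shift of the degree the algebra is \<open>A[t]\<close>. With \<open>\<tau>\<close> the
  twist of \<open>A\<close> and the shift \<open>n - 1\<close> it is the untwisted algebra: there \<open>x t\<^sup>b\<close> replaces the inverse
  of the \<open>b\<close>-th power of the twist at \<open>x\<close>, and bringing the arguments to the common denominator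
  \<open>\<Sum>\<^sub>j b\<^sub>j\<close> applies the twist \<open>\<Sum>\<^sub>j b\<^sub>j - b\<^sub>i\<close> times to the argument \<open>i\<close>.\<close>

definition series_algebra ::
  "('k, 'a, 's, 'm) hom_algebra_scheme \<Rightarrow> ('a \<Rightarrow> 'a) \<Rightarrow> (nat \<Rightarrow> nat) \<Rightarrow> ('k, nat \<Rightarrow> 'a, 's) hom_algebra"
  where
  "series_algebra A \<tau> sh =
     \<lparr> carrier = finsupp A UNIV, mult = undefined, one = undefined,
       zero = (\<lambda>b. \<zero>\<^bsub>A\<^esub>), add = (\<lambda>x y b. x b \<oplus>\<^bsub>A\<^esub> y b), smult = (\<lambda>c x b. c \<odot>\<^bsub>A\<^esub> x b),
       opn = (\<lambda>s xs d. if d < sh (length xs) then \<zero>\<^bsub>A\<^esub>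
         else finsum A (series_term A \<tau> s xs) (compositions (length xs) (d - sh (length xs)))),
       twist = (\<lambda>x b. twist A (x b)) \<rparr>"

context
  fixes K :: "('k, 'n) ring_scheme" and Sig :: "'s signature"
    and A :: "('k, 'a, 's, 'm) hom_algebra_scheme" and \<tau> :: "'a \<Rightarrow> 'a" and sh :: "nat \<Rightarrow> nat"
  assumes A: "hom_algebra K Sig A" and \<tau>: "hom_morphism K Sig A A \<tau>"
begin

private abbreviation (input) "S \<equiv> series_algebra A \<tau> sh"

interpretation A: module K A using hom_algebraD(2)[OF A] .

lemma finsupp_series: "is_finsupp_module A UNIV S"
  by (simp add: is_finsupp_module_def series_algebra_def fun_eq_iff)

lemmas series_simps = finsupp_simps[OF hom_algebraD(2)[OF A] finsupp_series]

lemma module_series: "module K S"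
  by (rule module_finsupp[OF hom_algebraD(2)[OF A] finsupp_series])

lemma series_closed: "x \<in> carrier S \<Longrightarrow> x b \<in> carrier A"
  using finsupp_closed[OF hom_algebraD(2)[OF A] finsupp_series] by (simp add: series_simps)

lemma opn_series:
  assumes "length xs = n"
  shows "opn S s xs d =
    (if d < sh n then \<zero>\<^bsub>A\<^esub> else finsum A (series_term A \<tau> s xs) (compositions n (d - sh n)))"
  using assms by (simp add: series_algebra_def)

lemma linear_\<tau>: "linear_map K A A (\<tau> ^^ k)"
  by (rule linear_map_funpow[OF hom_morphismD(2)[OF \<tau>]])

lemma linear_coefficient: "linear_map K S A (\<lambda>x. x b)"
  using series_closed by (simp add: linear_map_def series_simps)

lemma multilinear_series_term:
  assumes s: "s \<in> syms Sig" and bs: "length bs = arity Sig s"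
  shows "multilinear_map K S A (arity Sig s) (\<lambda>xs. series_term A \<tau> s xs bs)"
proof -
  let ?\<phi> = "\<lambda>i x. (\<tau> ^^ (sum_list bs - bs ! i)) (x (bs ! i))"
  have m: "multilinear_map K S A (arity Sig s) (\<lambda>xs. opn A s (map2 ?\<phi> [0..<arity Sig s] xs))"
    by (rule multilinear_map_map2_linear[OF op_algebraD(2)[OF hom_algebraD(1)[OF A] s]
        linear_map_comp[OF linear_coefficient linear_\<tau>]])
  have eq: "series_term A \<tau> s xs bs = opn A s (map2 ?\<phi> [0..<arity Sig s] xs)" if "xs \<in> args S (arity Sig s)" for xs
    unfolding series_term_def
    using that bs by (intro arg_cong[of _ _ "opn A s"] nth_equalityI) (auto simp: args_def)
  show ?thesis using m args_update[of _ S "arity Sig s"] module_series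
    unfolding multilinear_map_def
    by (simp add: eq abelian_monoid.a_closed abelian_group.axioms(1) module.axioms(2) module.smult_closed)
qed

lemma series_term_zero:
  assumes s: "s \<in> syms Sig" and bs: "length bs = arity Sig s" and xs: "xs \<in> args S (arity Sig s)"
    and i: "i < arity Sig s" "(xs ! i) (bs ! i) = \<zero>\<^bsub>A\<^esub>"
  shows "series_term A \<tau> s xs bs = \<zero>\<^bsub>A\<^esub>"
proof -
  let ?ys = "map2 (\<lambda>b x. (\<tau> ^^ (sum_list bs - b)) (x b)) bs xs"
  have "?ys \<in> args A (arity Sig s)"
    using xs bs series_closed linear_mapD(1)[OF linear_\<tau>]
    by (auto simp: args_def set_zip subset_iff)
  moreover have "?ys ! i = \<zero>\<^bsub>A\<^esub>"
    using i xs bs linear_map_zero[OF hom_algebraD(2)[OF A] hom_algebraD(2)[OF A] linear_\<tau>]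
    by (auto simp: args_def)
  ultimately show ?thesis
    unfolding series_term_def
    using multilinear_map_zero[OF hom_algebraD(2)[OF A] hom_algebraD(2)[OF A]
        op_algebraD(2)[OF hom_algebraD(1)[OF A] s] _ i(1)] by blast
qed

text \<open>A nonzero coefficient in degree \<open>d\<close> comes from a list of exponents from the supports of the arguments,
  and there are only finitely many of these.\<close>

lemma opn_series_closed:
  assumes s: "s \<in> syms Sig" and xs: "xs \<in> args S (arity Sig s)"
  shows "opn S s xs \<in> carrier S"
proof -
  let ?n = "arity Sig s"
  have len: "length xs = ?n" using xs by (simp add: args_def)
  have tcl: "series_term A \<tau> s xs \<in> compositions ?n e \<rightarrow> carrier A" for e
    using multilinear_mapD(1)[OF multilinear_series_term[OF s] xs] by (auto simp: compositions_def)
  have cl: "opn S s xs d \<in> carrier A" for d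
    using A.M.finsum_closed[OF tcl] by (simp add: opn_series[OF len])
  let ?U = "\<Union>x\<in>set xs. {b. x b \<noteq> \<zero>\<^bsub>A\<^esub>}"
  let ?L = "{bs. set bs \<subseteq> ?U \<and> length bs = ?n}"
  have "finite {b. x b \<noteq> \<zero>\<^bsub>A\<^esub>}" if "x \<in> set xs" for x
    using xs that by (auto simp: args_def series_simps finsupp_def)
  hence "finite ?L" by (intro finite_lists_length_eq) blast
  moreover have "{d. opn S s xs d \<noteq> \<zero>\<^bsub>A\<^esub>} \<subseteq> (\<lambda>bs. sum_list bs + sh ?n) ` ?L"
  proof
    fix d assume "d \<in> {d. opn S s xs d \<noteq> \<zero>\<^bsub>A\<^esub>}"
    hence d: "sh ?n \<le> d" and ne: "finsum A (series_term A \<tau> s xs) (compositions ?n (d - sh ?n)) \<noteq> \<zero>\<^bsub>A\<^esub>"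
      by (auto simp: opn_series[OF len] split: if_splits)
    then obtain bs where bs: "bs \<in> compositions ?n (d - sh ?n)" "series_term A \<tau> s xs bs \<noteq> \<zero>\<^bsub>A\<^esub>"
      using A.M.add.finprod_one_eqI[of "compositions ?n (d - sh ?n)" "series_term A \<tau> s xs"] by auto
    hence l: "length bs = ?n" "sum_list bs = d - sh ?n" by (auto simp: compositions_def)
    have "b \<in> ?U" if b: "b \<in> set bs" for b
    proof -
      obtain i where i: "i < ?n" "b = bs ! i" using b l by (auto simp: in_set_conv_nth)
      have "(xs ! i) (bs ! i) \<noteq> \<zero>\<^bsub>A\<^esub>" using series_term_zero[OF s l(1) xs i(1)] bs(2) by blast
      moreover have "xs ! i \<in> set xs" using i len by simp
      ultimately show ?thesis using i by blast
    qed
    hence "bs \<in> ?L" using l by blast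
    thus "d \<in> (\<lambda>bs. sum_list bs + sh ?n) ` ?L" using l d by (intro image_eqI[of _ _ bs]) auto
  qed
  ultimately have "finite {d. opn S s xs d \<noteq> \<zero>\<^bsub>A\<^esub>}" using finite_surj by blast
  thus ?thesis using cl by (simp add: series_simps finsupp_def)
qed

lemma op_algebra_series: "op_algebra K Sig S"
proof -
  have "multilinear_map K S S (arity Sig s) (opn S s)" if s: "s \<in> syms Sig" for s
  proof -
    let ?n = "arity Sig s"
    have zero: "multilinear_map K S A ?n (\<lambda>xs. \<zero>\<^bsub>A\<^esub>)" by (simp add: multilinear_map_def)
    have "multilinear_map K S A ?n (\<lambda>xs. finsum A (series_term A \<tau> s xs) (compositions ?n e))" for e
      using multilinear_series_term[OF s]
      by (intro multilinear_map_finsum[OF module_series hom_algebraD(2)[OF A]]) (auto simp: compositions_def)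
    hence m: "multilinear_map K S A ?n (\<lambda>xs. if d < sh ?n then \<zero>\<^bsub>A\<^esub>
        else finsum A (series_term A \<tau> s xs) (compositions ?n (d - sh ?n)))" for d
      using zero by (cases "d < sh ?n") auto
    have eq: "opn S s xs d = (if d < sh ?n then \<zero>\<^bsub>A\<^esub>
        else finsum A (series_term A \<tau> s xs) (compositions ?n (d - sh ?n)))" if "xs \<in> args S ?n" for xs d
      using that by (intro opn_series) (simp add: args_def)
    interpret S: module K S by (rule module_series)
    show ?thesis
      unfolding multilinear_map_def
    proof (intro conjI ballI allI impI)
      fix xs assume "xs \<in> args S ?n"
      thus "opn S s xs \<in> carrier S" by (rule opn_series_closed[OF s])
    next
      fix xs i x y assume xs: "xs \<in> args S ?n" and i: "i < ?n" and xy: "x \<in> carrier S" "y \<in> carrier S"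
      note u = args_update[OF xs]
      show "opn S s (xs[i := x \<oplus>\<^bsub>S\<^esub> y]) = opn S s (xs[i := x]) \<oplus>\<^bsub>S\<^esub> opn S s (xs[i := y])"
        unfolding series_simps(3)[of "opn S s (xs[i := x])"]
          eq[OF u[OF xy(1)]] eq[OF u[OF xy(2)]]
      proof
        fix d show "opn S s (xs[i := x \<oplus>\<^bsub>S\<^esub> y]) d = (if d < sh ?n then \<zero>\<^bsub>A\<^esub>
          else finsum A (series_term A \<tau> s (xs[i := x])) (compositions ?n (d - sh ?n))) \<oplus>\<^bsub>A\<^esub>
          (if d < sh ?n then \<zero>\<^bsub>A\<^esub>
          else finsum A (series_term A \<tau> s (xs[i := y])) (compositions ?n (d - sh ?n)))"
          unfolding eq[OF u[OF S.M.a_closed[OF xy]]] by (rule multilinear_mapD(2)[OF m xs i xy])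
      qed
    next
      fix xs i c x assume xs: "xs \<in> args S ?n" and i: "i < ?n" and c: "c \<in> carrier K" and x: "x \<in> carrier S"
      note u = args_update[OF xs]
      show "opn S s (xs[i := c \<odot>\<^bsub>S\<^esub> x]) = c \<odot>\<^bsub>S\<^esub> opn S s (xs[i := x])"
        unfolding series_simps(4)[of c "opn S s (xs[i := x])"] eq[OF u[OF x]]
      proof
        fix d show "opn S s (xs[i := c \<odot>\<^bsub>S\<^esub> x]) d = c \<odot>\<^bsub>A\<^esub> (if d < sh ?n then \<zero>\<^bsub>A\<^esub>
          else finsum A (series_term A \<tau> s (xs[i := x])) (compositions ?n (d - sh ?n)))"
          unfolding eq[OF u[OF S.smult_closed[OF c x]]] by (rule multilinear_mapD(3)[OF m xs i c x])
      qed
    qed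
  qed
  thus ?thesis using module_series by (simp add: op_algebra_def multilinear_iff)
qed

lemma opn_series_single:
  assumes s: "s \<in> syms Sig" and bs: "length bs = arity Sig s" and ys: "ys \<in> args A (arity Sig s)"
  shows "opn S s (map2 (single A) bs ys) =
    single A (sum_list bs + sh (arity Sig s)) (opn A s (map2 (\<lambda>b y. (\<tau> ^^ (sum_list bs - b)) y) bs ys))"
proof
  fix d
  let ?n = "arity Sig s" and ?xs = "map2 (single A) bs ys"
  have len: "length ?xs = ?n" using bs ys by (simp add: args_def)
  have xs: "?xs \<in> args S ?n"
    using bs ys finsupp_single[OF hom_algebraD(2)[OF A] finsupp_series]
    by (auto simp: args_def series_simps set_zip subset_iff)
  have ne: "series_term A \<tau> s ?xs cs = \<zero>\<^bsub>A\<^esub>" if cs: "length cs = ?n" "cs \<noteq> bs" for cs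
  proof -
    obtain i where i: "i < ?n" "cs ! i \<noteq> bs ! i" using cs bs by (auto simp: list_eq_iff_nth_eq)
    thus ?thesis using series_term_zero[OF s cs(1) xs i(1)] len bs ys by (simp add: single_def args_def)
  qed
  have eq: "series_term A \<tau> s ?xs bs = opn A s (map2 (\<lambda>b y. (\<tau> ^^ (sum_list bs - b)) y) bs ys)"
    unfolding series_term_def using bs ys
    by (intro arg_cong[of _ _ "opn A s"] nth_equalityI) (auto simp: args_def single_def)
  have cl: "series_term A \<tau> s ?xs bs \<in> carrier A"
    by (rule multilinear_mapD(1)[OF multilinear_series_term[OF s bs] xs])
  show "opn S s ?xs d = single A (sum_list bs + sh ?n) (opn A s (map2 (\<lambda>b y. (\<tau> ^^ (sum_list bs - b)) y) bs ys)) d"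
  proof (cases "d = sum_list bs + sh ?n")
    case True
    have "finsum A (series_term A \<tau> s ?xs) (compositions ?n (sum_list bs)) = finsum A (series_term A \<tau> s ?xs) {bs}"
      using ne bs multilinear_mapD(1)[OF multilinear_series_term[OF s] xs]
      by (intro A.M.add.finprod_mono_neutral_cong_right finite_compositions)
        (auto simp: compositions_def)
    also have "\<dots> = series_term A \<tau> s ?xs bs"
      using cl A.M.finsum_insert[of "{}" bs "series_term A \<tau> s ?xs"] by (simp only: A.M.finsum_empty) auto
    also have "\<dots> = opn A s (map2 (\<lambda>b y. (\<tau> ^^ (sum_list bs - b)) y) bs ys)" by (rule eq)
    finally have "opn S s ?xs d = opn A s (map2 (\<lambda>b y. (\<tau> ^^ (sum_list bs - b)) y) bs ys)"
      unfolding opn_series[OF len] using True by simp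
    thus ?thesis using True by (simp only: single_same)
  next
    case False
    have "opn S s ?xs d = \<zero>\<^bsub>A\<^esub>"
    proof (cases "d < sh ?n")
      case d: False
      have "finsum A (series_term A \<tau> s ?xs) (compositions ?n (d - sh ?n)) = \<zero>\<^bsub>A\<^esub>"
      proof (rule A.M.add.finprod_one_eqI[simplified])
        fix cs assume "cs \<in> compositions ?n (d - sh ?n)"
        thus "series_term A \<tau> s ?xs cs = \<zero>\<^bsub>A\<^esub>" using d False by (intro ne) (auto simp: compositions_def)
      qed
      thus ?thesis unfolding opn_series[OF len] using d by (simp only: if_False)
    qed (simp only: opn_series[OF len] if_True)
    thus ?thesis using False by (simp add: single_other)
  qed
qed

lemma spanning_series: "spanning K S {single A b y | b y. y \<in> carrier A}"
  using spanning_single[OF hom_algebraD(2)[OF A] finsupp_series] by (simp only: UNIV_I simp_thms)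

lemma single_list:
  assumes "set xs \<subseteq> {single A b y | b y. y \<in> carrier A}"
  shows "\<exists>(bs :: nat list) ys. length bs = length xs \<and> length ys = length xs \<and> set ys \<subseteq> carrier A \<and> xs = map2 (single A) bs ys"
proof -
  have "\<exists>p :: nat \<times> 'a. snd p \<in> carrier A \<and> x = single A (fst p) (snd p)" if "x \<in> set xs" for x
  proof -
    obtain b y where "x = single A b y" "y \<in> carrier A" using assms \<open>x \<in> set xs\<close> by blast
    thus ?thesis by (intro exI[of _ "(b, y)"]) simp
  qed
  then obtain f :: "(nat \<Rightarrow> 'a) \<Rightarrow> nat \<times> 'a" where
    f: "\<And>x. x \<in> set xs \<Longrightarrow> snd (f x) \<in> carrier A \<and> x = single A (fst (f x)) (snd (f x))"
    by metis
  have "map2 (single A) (map (\<lambda>x. fst (f x)) zs) (map (\<lambda>x. snd (f x)) zs) =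
      map (\<lambda>x. single A (fst (f x)) (snd (f x))) zs" for zs
    by (induction zs) (simp_all add: case_prod_unfold)
  also have "map (\<lambda>x. single A (fst (f x)) (snd (f x))) xs = xs"
    using f by (intro map_idI) simp
  finally have "xs = map2 (single A) (map (\<lambda>x. fst (f x)) xs) (map (\<lambda>x. snd (f x)) xs)" by (rule sym)
  moreover have "set (map (\<lambda>x. snd (f x)) xs) \<subseteq> carrier A" using f by auto
  ultimately show ?thesis
    by (intro exI[of _ "map (\<lambda>x. fst (f x)) xs"] exI[of _ "map (\<lambda>x. snd (f x)) xs"] conjI length_map)
qed

lemma op_morphism_series:
  assumes C: "op_algebra K Sig C" and l: "linear_map K S C \<phi>"
    and eq: "\<And>s bs ys. s \<in> syms Sig \<Longrightarrow> length bs = arity Sig s \<Longrightarrow> ys \<in> args A (arity Sig s) \<Longrightarrow>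
      \<phi> (single A (sum_list bs + sh (arity Sig s)) (opn A s (map2 (\<lambda>b y. (\<tau> ^^ (sum_list bs - b)) y) bs ys))) =
      opn C s (map \<phi> (map2 (single A) bs ys))"
  shows "op_morphism K Sig S C \<phi>"
proof (rule op_morphism_if_spanning[OF op_algebra_series C spanning_series l])
  fix s xs assume s: "s \<in> syms Sig" and xs: "xs \<in> args S (arity Sig s)"
    and "set xs \<subseteq> {single A b y | b y. y \<in> carrier A}"
  from single_list[OF this(3)] obtain bs :: "nat list" and ys where l: "length bs = length xs"
    "length ys = length xs" "set ys \<subseteq> carrier A" and eq_xs: "xs = map2 (single A) bs ys"
    by (elim exE conjE)
  have *: "length bs = arity Sig s" "ys \<in> args A (arity Sig s)"
    using xs l unfolding args_def by simp_all
  show "\<phi> (opn S s xs) = opn C s (map \<phi> xs)"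
    by (simp only: eq_xs opn_series_single[OF s *] eq[OF s *])
qed

lemma hom_algebra_series: "hom_algebra K Sig S"
proof -
  note lt = hom_algebraD(3)[OF A]
  have z: "twist A \<zero>\<^bsub>A\<^esub> = \<zero>\<^bsub>A\<^esub>"
    by (rule linear_map_zero[OF hom_algebraD(2)[OF A] hom_algebraD(2)[OF A] lt])
  have tw: "twist S x = (\<lambda>b. twist A (x b))" for x by (simp add: series_algebra_def)
  have cl: "(\<lambda>b. twist A (x b)) \<in> finsupp A UNIV" if "x \<in> finsupp A UNIV" for x :: "nat \<Rightarrow> 'a"
  proof -
    have "{b. twist A (x b) \<noteq> \<zero>\<^bsub>A\<^esub>} \<subseteq> {b. x b \<noteq> \<zero>\<^bsub>A\<^esub>}" using z by auto
    thus ?thesis using that linear_mapD(1)[OF lt] by (auto simp: finsupp_def intro: finite_subset)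
  qed
  have l: "linear_map K S S (twist S)"
    using cl finsupp_closed[OF hom_algebraD(2)[OF A] finsupp_series] linear_mapD[OF lt]
    by (simp add: linear_map_def tw series_simps fun_eq_iff)
  have single: "twist S (single A b y) = single A b (twist A y)" for b y
    using z by (auto simp: tw single_def)
  have "op_morphism K Sig S S (twist S)"
  proof (rule op_morphism_series[OF op_algebra_series l])
    fix s ys and bs :: "nat list"
    assume s: "s \<in> syms Sig" and bs: "length bs = arity Sig s" and ys: "ys \<in> args A (arity Sig s)"
    let ?n = "arity Sig s" and ?f = "\<lambda>b y. (\<tau> ^^ (sum_list bs - b)) y"
    have a: "map2 ?f bs ys \<in> args A ?n"
      using bs ys linear_mapD(1)[OF linear_\<tau>] by (auto simp: args_def set_zip subset_iff)
    have "(\<tau> ^^ k) (twist A y) = twist A ((\<tau> ^^ k) y)" if "y \<in> carrier A" for k y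
      by (induction k) (use that linear_mapD(1)[OF linear_\<tau>] in \<open>auto simp: hom_morphismD(3)[OF \<tau>]\<close>)
    hence eq: "map (twist A) (map2 ?f bs ys) = map2 ?f bs (map (twist A) ys)"
      using bs ys args_nth[OF ys] by (intro nth_equalityI) (simp_all add: args_def)
    have "map (twist S) (map2 (single A) bs ys) = map2 (single A) bs (map (twist A) ys)"
      using bs ys by (intro nth_equalityI) (auto simp: args_def single)
    thus "twist S (single A (sum_list bs + sh ?n) (opn A s (map2 ?f bs ys))) =
        opn S s (map (twist S) (map2 (single A) bs ys))"
      using opn_series_single[OF s bs linear_map_args[OF lt ys]] hom_algebraD(4)[OF A s a]
      by (simp only: single eq)
  qed
  thus ?thesis using op_algebra_series l by (simp add: hom_algebra_def linear_endo_iff op_morphism_def)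
qed

end

section \<open>Scalars in characteristic zero\<close>

lemma smult_eq_zero:
  fixes K :: "('k, 'n) ring_scheme" (structure)
  assumes "field K" "module K M" "c \<in> carrier K" "x \<in> carrier M" "c \<odot>\<^bsub>M\<^esub> x = \<zero>\<^bsub>M\<^esub>" "c \<noteq> \<zero>"
  shows "x = \<zero>\<^bsub>M\<^esub>"
proof -
  interpret K: field K by fact
  interpret M: module K M by fact
  have u: "c \<in> Units K" using assms(3,6) by (simp add: K.field_Units)
  have "x = (inv c \<otimes> c) \<odot>\<^bsub>M\<^esub> x" using u assms(4) by simp
  also have "\<dots> = inv c \<odot>\<^bsub>M\<^esub> (c \<odot>\<^bsub>M\<^esub> x)" using u assms(3,4) by (intro M.smult_assoc1) auto
  also have "\<dots> = \<zero>\<^bsub>M\<^esub>" using u assms(5) by simp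
  finally show ?thesis .
qed

lemma char_zero_add_pow_inj:
  fixes K :: "('k, 'n) ring_scheme" (structure)
  assumes "cring K" "char_zero K" "[m] \<cdot> \<one> = [n] \<cdot> \<one>"
  shows "m = (n :: nat)"
proof -
  interpret K: cring K by fact
  have "\<not> i < j" if "[i] \<cdot> \<one> = [j] \<cdot> \<one>" for i j :: nat
  proof
    assume "i < j"
    hence "[j] \<cdot> \<one> = ([i] \<cdot> \<one>) \<oplus> ([(j - i)] \<cdot> \<one>)"
      using K.add.nat_pow_mult[of "\<one>" i "j - i"] by simp
    hence "[(j - i)] \<cdot> \<one> = \<zero>"
      using that K.add.l_cancel_one'[of "[i] \<cdot> \<one>" "[(j - i)] \<cdot> \<one>"] by simp
    thus False using assms(2) \<open>i < j\<close> by (simp add: char_zero_def)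
  qed
  from this[of m n] this[of n m] show ?thesis using assms(3) by simp
qed

lemma two_powers_distinct:
  fixes K :: "('k, 'n) ring_scheme" (structure) and b d :: nat
  assumes "cring K" "char_zero K" "b \<noteq> d"
  shows "(\<one> \<oplus> \<one>) [^] b \<noteq> (\<one> \<oplus> \<one>) [^] d"
proof -
  interpret K: cring K by fact
  have pow: "(\<one> \<oplus> \<one>) [^] n = [(2 ^ n :: nat)] \<cdot> \<one>" for n :: nat
  proof (induction n)
    case (Suc n)
    have "[(2 ^ Suc n :: nat)] \<cdot> \<one> = ([(2 ^ n :: nat)] \<cdot> \<one>) \<oplus> ([(2 ^ n :: nat)] \<cdot> \<one>)"
      using K.add.nat_pow_mult[of "\<one>" "2 ^ n" "2 ^ n"] by (simp add: mult_2)
    thus ?case using Suc by (simp add: K.r_distr)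
  qed simp
  show ?thesis unfolding pow using char_zero_add_pow_inj[OF assms(1,2)] assms(3) by (metis power_inject_exp one_less_numeral_iff semiring_norm(76))
qed

text \<open>With \<open>p\<close> of degree \<open>n\<close> also \<open>p(2c) - 2\<^sup>n p(c)\<close> vanishes at all \<open>c\<close>. It has smaller degree, and its coefficients are
  those of \<open>p\<close> times the nonzero scalars \<open>2\<^sup>b - 2\<^sup>n\<close>. This avoids determinants.\<close>

lemma polynomial_zero:
  fixes K :: "('k, 'n) ring_scheme" (structure) and B :: nat
  assumes K: "field K" "char_zero K" and M: "module K M" and y: "\<And>b. y b \<in> carrier M"
    and zero: "\<And>c. c \<in> carrier K \<Longrightarrow> (\<Oplus>\<^bsub>M\<^esub>b\<in>{..<B}. c [^] b \<odot>\<^bsub>M\<^esub> y b) = \<zero>\<^bsub>M\<^esub>"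
    and "b < B"
  shows "y b = \<zero>\<^bsub>M\<^esub>"
  using y zero \<open>b < B\<close>
proof (induction B arbitrary: y b)
  case (Suc B)
  interpret K: field K by fact
  interpret M: module K M by fact
  define u where "u = \<one> \<oplus> \<one>"
  have u: "u \<in> carrier K" by (simp add: u_def)
  note y = Suc.prems(1)
  define y' where "y' b = (u [^] b \<oplus> \<ominus> (u [^] B)) \<odot>\<^bsub>M\<^esub> y b" for b
  have y': "y' b \<in> carrier M" for b using u y by (simp add: y'_def)
  have "(\<Oplus>\<^bsub>M\<^esub>b\<in>{..<B}. c [^] b \<odot>\<^bsub>M\<^esub> y' b) = \<zero>\<^bsub>M\<^esub>" if c: "c \<in> carrier K" for c
  proof -
    let ?S = "\<lambda>c. \<Oplus>\<^bsub>M\<^esub>b\<in>{..<Suc B}. c [^] b \<odot>\<^bsub>M\<^esub> y b"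
    have top: "y' B = \<zero>\<^bsub>M\<^esub>" using u y by (simp add: y'_def K.r_neg)
    have "c [^] b \<odot>\<^bsub>M\<^esub> y' b =
        (u \<otimes> c) [^] b \<odot>\<^bsub>M\<^esub> y b \<oplus>\<^bsub>M\<^esub> (\<ominus> (u [^] B)) \<odot>\<^bsub>M\<^esub> (c [^] b \<odot>\<^bsub>M\<^esub> y b)" for b :: nat
    proof -
      have p: "c [^] b \<in> carrier K" "u [^] b \<in> carrier K" "u [^] B \<in> carrier K"
        using c u by auto
      have "c [^] b \<odot>\<^bsub>M\<^esub> y' b = (c [^] b \<otimes> (u [^] b \<oplus> \<ominus> (u [^] B))) \<odot>\<^bsub>M\<^esub> y b"
        unfolding y'_def using p y by (intro M.smult_assoc1[symmetric]) auto
      also have "c [^] b \<otimes> (u [^] b \<oplus> \<ominus> (u [^] B)) =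
          (u \<otimes> c) [^] b \<oplus> (\<ominus> (u [^] B)) \<otimes> c [^] b"
        using p c u by (simp add: K.nat_pow_distrib K.r_distr K.m_comm)
      also have "\<dots> \<odot>\<^bsub>M\<^esub> y b = (u \<otimes> c) [^] b \<odot>\<^bsub>M\<^esub> y b \<oplus>\<^bsub>M\<^esub>
          ((\<ominus> (u [^] B)) \<otimes> c [^] b) \<odot>\<^bsub>M\<^esub> y b"
        using p c u y by (intro M.smult_l_distr) auto
      also have "((\<ominus> (u [^] B)) \<otimes> c [^] b) \<odot>\<^bsub>M\<^esub> y b =
          (\<ominus> (u [^] B)) \<odot>\<^bsub>M\<^esub> (c [^] b \<odot>\<^bsub>M\<^esub> y b)"
        using p y by (intro M.smult_assoc1) auto
      finally show ?thesis .
    qed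
    hence "(\<Oplus>\<^bsub>M\<^esub>b\<in>{..<Suc B}. c [^] b \<odot>\<^bsub>M\<^esub> y' b) =
        (\<Oplus>\<^bsub>M\<^esub>b\<in>{..<Suc B}. (u \<otimes> c) [^] b \<odot>\<^bsub>M\<^esub> y b \<oplus>\<^bsub>M\<^esub>
          (\<ominus> (u [^] B)) \<odot>\<^bsub>M\<^esub> (c [^] b \<odot>\<^bsub>M\<^esub> y b))" by (simp only:)
    also have "\<dots> = ?S (u \<otimes> c) \<oplus>\<^bsub>M\<^esub>
        (\<Oplus>\<^bsub>M\<^esub>b\<in>{..<Suc B}. (\<ominus> (u [^] B)) \<odot>\<^bsub>M\<^esub> (c [^] b \<odot>\<^bsub>M\<^esub> y b))"
      using u c y by (intro M.M.finsum_addf) auto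
    also have "(\<Oplus>\<^bsub>M\<^esub>b\<in>{..<Suc B}. (\<ominus> (u [^] B)) \<odot>\<^bsub>M\<^esub> (c [^] b \<odot>\<^bsub>M\<^esub> y b)) =
        (\<ominus> (u [^] B)) \<odot>\<^bsub>M\<^esub> ?S c"
      using u c y by (intro M.finsum_smult_ldistr[symmetric]) auto
    also have "?S c = \<zero>\<^bsub>M\<^esub>" by (rule Suc.prems(2)[OF c])
    also have "?S (u \<otimes> c) = \<zero>\<^bsub>M\<^esub>" using u c by (intro Suc.prems(2)) simp
    finally have "(\<Oplus>\<^bsub>M\<^esub>b\<in>{..<Suc B}. c [^] b \<odot>\<^bsub>M\<^esub> y' b) = \<zero>\<^bsub>M\<^esub>" using u by simp
    moreover have "(\<Oplus>\<^bsub>M\<^esub>b\<in>{..<Suc B}. c [^] b \<odot>\<^bsub>M\<^esub> y' b) =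
        c [^] B \<odot>\<^bsub>M\<^esub> y' B \<oplus>\<^bsub>M\<^esub> (\<Oplus>\<^bsub>M\<^esub>b\<in>{..<B}. c [^] b \<odot>\<^bsub>M\<^esub> y' b)"
      unfolding lessThan_Suc using c y' by (intro M.M.finsum_insert) auto
    moreover have "(\<Oplus>\<^bsub>M\<^esub>b\<in>{..<B}. c [^] b \<odot>\<^bsub>M\<^esub> y' b) \<in> carrier M"
      using c y' by (intro M.M.finsum_closed) auto
    ultimately show ?thesis using c by (simp add: top)
  qed
  hence y'0: "y' b = \<zero>\<^bsub>M\<^esub>" if "b < B" for b using Suc.IH[of y' b] y' that by blast
  have low: "y b = \<zero>\<^bsub>M\<^esub>" if b: "b < B" for b
  proof (rule smult_eq_zero[OF K(1) M _ y])
    show "(u [^] b \<oplus> \<ominus> (u [^] B)) \<odot>\<^bsub>M\<^esub> y b = \<zero>\<^bsub>M\<^esub>" using y'0[OF b] by (simp add: y'_def)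
    show "u [^] b \<oplus> \<ominus> (u [^] B) \<in> carrier K" using u by simp
    show "u [^] b \<oplus> \<ominus> (u [^] B) \<noteq> \<zero>"
    proof
      assume "u [^] b \<oplus> \<ominus> (u [^] B) = \<zero>"
      hence "\<ominus> (\<ominus> (u [^] B)) = u [^] b"
        using u by (intro K.minus_equality) simp_all
      hence "u [^] b = u [^] B" using u by simp
      thus False using two_powers_distinct[OF K.cring_axioms K(2), of b B] b by (simp add: u_def)
    qed
  qed
  have "(\<Oplus>\<^bsub>M\<^esub>b\<in>{..<Suc B}. \<one> [^] b \<odot>\<^bsub>M\<^esub> y b) =
      \<one> [^] B \<odot>\<^bsub>M\<^esub> y B \<oplus>\<^bsub>M\<^esub> (\<Oplus>\<^bsub>M\<^esub>b\<in>{..<B}. \<one> [^] b \<odot>\<^bsub>M\<^esub> y b)"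
    unfolding lessThan_Suc using y by (intro M.M.finsum_insert) auto
  moreover have "(\<Oplus>\<^bsub>M\<^esub>b\<in>{..<B}. \<one> [^] b \<odot>\<^bsub>M\<^esub> y b) = \<zero>\<^bsub>M\<^esub>"
    using low by (intro M.M.add.finprod_one_eqI) auto
  ultimately have "y B = \<zero>\<^bsub>M\<^esub>" using Suc.prems(2)[of "\<one>"] y by simp
  thus ?case using low Suc.prems(3) less_antisym by blast
qed simp

section \<open>Polynomials satisfy the same Hom-type identities\<close>

lemma multilinear_map_scale:
  fixes K :: "('k, 'n) ring_scheme" (structure)
  assumes K: "cring K" and M: "module K M" and N: "module K N" and m: "multilinear_map K M N n m"
    and bs: "length bs = n" and ys: "ys \<in> args M n" and c: "c \<in> carrier K"
  shows "m (map2 (\<lambda>(b :: nat) y. c [^] b \<odot>\<^bsub>M\<^esub> y) bs ys) = c [^] sum_list bs \<odot>\<^bsub>N\<^esub> m ys"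
proof -
  interpret K: cring K by fact
  interpret M: module K M by fact
  interpret N: module K N by fact
  let ?xs = "map2 (\<lambda>(b :: nat) y. c [^] b \<odot>\<^bsub>M\<^esub> y) bs ys"
  have len: "length ys = n" "length ?xs = n" using ys bs by (auto simp: args_def)
  have xs: "?xs \<in> args M n"
    using ys bs c by (auto simp: args_def set_zip subset_iff)
  have mys: "m ys \<in> carrier N" by (rule multilinear_mapD(1)[OF m ys])
  have "m (take k ?xs @ drop k ys) = c [^] sum_list (take k bs) \<odot>\<^bsub>N\<^esub> m ys" if "k \<le> n" for k
    using that
  proof (induction k)
    case 0
    thus ?case using mys by simp
  next
    case (Suc k)
    let ?zs = "take k ?xs @ drop k ys"
    have k: "k < n" using Suc.prems by simp
    have zs: "?zs \<in> args M n"
      using xs ys len k set_take_subset[of k ?xs] set_drop_subset[of k ys] unfolding args_def by auto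
    have zk: "?zs[k := ys ! k] = ?zs" and zk': "?zs[k := ?xs ! k] = take (Suc k) ?xs @ drop (Suc k) ys"
      using len k by (auto simp: list_eq_iff_nth_eq nth_append nth_list_update min_def)
    have xk: "?xs ! k = c [^] (bs ! k) \<odot>\<^bsub>M\<^esub> ys ! k" using len bs k by simp
    have ck: "c [^] (bs ! k) \<in> carrier K" "c [^] sum_list (take k bs) \<in> carrier K" using c by auto
    have "m (?zs[k := ?xs ! k]) = c [^] (bs ! k) \<odot>\<^bsub>N\<^esub> m (?zs[k := ys ! k])"
      unfolding xk by (rule multilinear_mapD(3)[OF m zs k ck(1) args_nth[OF ys k]])
    also have "\<dots> = c [^] (bs ! k) \<odot>\<^bsub>N\<^esub> (c [^] sum_list (take k bs) \<odot>\<^bsub>N\<^esub> m ys)"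
      unfolding zk using Suc by simp
    also have "\<dots> = (c [^] (bs ! k) \<otimes> c [^] sum_list (take k bs)) \<odot>\<^bsub>N\<^esub> m ys"
      by (rule N.smult_assoc1[OF ck mys, symmetric])
    also have "c [^] (bs ! k) \<otimes> c [^] sum_list (take k bs) = c [^] sum_list (take (Suc k) bs)"
      using c bs k by (simp add: K.nat_pow_mult take_Suc_conv_app_nth add.commute)
    finally show ?case unfolding zk' .
  qed
  from this[of n] show ?thesis using len bs by simp
qed

abbreviation (input) polynomials ::
  "('k, 'a, 's, 'm) hom_algebra_scheme \<Rightarrow> ('k, nat \<Rightarrow> 'a, 's) hom_algebra" where
  "polynomials A \<equiv> series_algebra A (\<lambda>x. x) (\<lambda>n. 0)"

lemma funpow_identity: "(\<lambda>x. x) ^^ n = (\<lambda>x. x)"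
  by (induction n) auto

lemma twist_series_single:
  assumes A: "hom_algebra K Sig A"
  shows "twist (series_algebra A \<tau> sh) (single A b y) = single A b (twist A y)"
  using linear_map_zero[OF hom_algebraD(2)[OF A] hom_algebraD(2)[OF A] hom_algebraD(3)[OF A]]
  by (auto simp: series_algebra_def single_def)

context
  fixes K :: "('k, 'n) ring_scheme" and Sig :: "'s signature"
    and A :: "('k, 'a, 's, 'm) hom_algebra_scheme"
  assumes K: "field K" "char_zero K" and A: "hom_algebra K Sig A"
begin

interpretation A: module K A using hom_algebraD(2)[OF A] .

lemma identity_morphism: "hom_morphism K Sig A A (\<lambda>x. x)"
  by (simp add: hom_morphism_def op_morphism_def linear_map_def)

lemma twist_morphism: "hom_morphism K Sig A A (twist A)"
  using op_morphism_twist_funpow[OF A, of 1] by (simp add: hom_morphism_def)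

lemma hom_algebra_polynomials: "hom_algebra K Sig (polynomials A)"
  by (rule hom_algebra_series[OF A identity_morphism])

lemma evaluation_morphism:
  assumes c: "c \<in> carrier K"
  shows "hom_morphism K Sig (polynomials A) A (total A A (\<lambda>b y. c [^]\<^bsub>K\<^esub> b \<odot>\<^bsub>A\<^esub> y))"
    (is "hom_morphism _ _ _ _ ?\<phi>")
proof -
  have cb: "linear_map K A A (\<lambda>y. c [^]\<^bsub>K\<^esub> (b :: nat) \<odot>\<^bsub>A\<^esub> y)" for b
  proof -
    have "c [^]\<^bsub>K\<^esub> b \<odot>\<^bsub>A\<^esub> (d \<odot>\<^bsub>A\<^esub> y) = d \<odot>\<^bsub>A\<^esub> (c [^]\<^bsub>K\<^esub> b \<odot>\<^bsub>A\<^esub> y)" if "d \<in> carrier K" "y \<in> carrier A" for d y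
      using that c by (simp flip: A.smult_assoc1 add: A.R.m_comm)
    thus ?thesis using c by (simp add: linear_map_def A.smult_r_distr)
  qed
  note F = finsupp_series[OF A identity_morphism, of "\<lambda>_. 0"]
  have l: "linear_map K (polynomials A) A ?\<phi>"
    by (rule linear_map_total[OF hom_algebraD(2)[OF A] F hom_algebraD(2)[OF A] cb])
  have sing: "?\<phi> (single A b y) = c [^]\<^bsub>K\<^esub> b \<odot>\<^bsub>A\<^esub> y" if "y \<in> carrier A" for y and b :: nat
    by (rule total_single[OF hom_algebraD(2)[OF A] F hom_algebraD(2)[OF A] cb UNIV_I that])
  have op: "op_morphism K Sig (polynomials A) A ?\<phi>"
  proof (rule op_morphism_series[OF A identity_morphism hom_algebraD(1)[OF A] l])
    fix s ys and bs :: "nat list"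
    assume s: "s \<in> syms Sig" and bs: "length bs = arity Sig s" and ys: "ys \<in> args A (arity Sig s)"
    have e1: "map2 (\<lambda>b y. ((\<lambda>x. x) ^^ (sum_list bs - b)) y) bs ys = ys"
      using bs ys by (intro nth_equalityI) (auto simp: args_def funpow_identity)
    have e2: "map ?\<phi> (map2 (single A) bs ys) = map2 (\<lambda>b y. c [^]\<^bsub>K\<^esub> b \<odot>\<^bsub>A\<^esub> y) bs ys"
      using bs ys sing[OF args_nth[OF ys]] by (intro nth_equalityI) (simp_all add: args_def)
    have "opn A s ys \<in> carrier A"
      by (rule multilinear_mapD(1)[OF op_algebraD(2)[OF hom_algebraD(1)[OF A] s] ys])
    thus "?\<phi> (single A (sum_list bs + 0) (opn A s (map2 (\<lambda>b y. ((\<lambda>x. x) ^^ (sum_list bs - b)) y) bs ys))) =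
        opn A s (map ?\<phi> (map2 (single A) bs ys))"
      unfolding e1 e2 by (simp add: sing multilinear_map_scale[OF A.R.cring_axioms hom_algebraD(2)[OF A]
          hom_algebraD(2)[OF A] op_algebraD(2)[OF hom_algebraD(1)[OF A] s] bs ys c])
  qed
  have "?\<phi> (twist (polynomials A) x) = twist A (?\<phi> x)" if x: "x \<in> carrier (polynomials A)" for x
  proof (rule linear_map_eqI[OF module_series[OF A identity_morphism] hom_algebraD(2)[OF A]
        spanning_series[OF A identity_morphism] _ _ _ x])
    show "linear_map K (polynomials A) A (\<lambda>x. ?\<phi> (twist (polynomials A) x))"
      by (rule linear_map_comp[OF hom_algebraD(3)[OF hom_algebra_polynomials] l])
    show "linear_map K (polynomials A) A (\<lambda>x. twist A (?\<phi> x))"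
      by (rule linear_map_comp[OF l hom_algebraD(3)[OF A]])
    fix x :: "nat \<Rightarrow> 'a" assume "x \<in> {single A b y | b y. y \<in> carrier A}"
    then obtain b :: nat and y where x: "x = single A b y" and y: "y \<in> carrier A" by blast
    have "c [^]\<^bsub>K\<^esub> b \<in> carrier K" using c by simp
    thus "?\<phi> (twist (polynomials A) x) = twist A (?\<phi> x)"
      unfolding x twist_series_single[OF A] sing[OF y] sing[OF linear_mapD(1)[OF hom_algebraD(3)[OF A] y]]
      using linear_mapD(3)[OF hom_algebraD(3)[OF A] _ y] by simp
  qed
  thus ?thesis using op by (simp add: hom_morphism_def)
qed

text \<open>The value of the identity is a polynomial whose values at scalars are values of the identity in \<open>A\<close>.\<close>

lemma polynomials_satisfy:
  assumes f: "identity K Sig f" and sat: "satisfies_hom_type Sig A f" and X: "\<And>v. X v \<in> carrier (polynomials A)"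
  shows "eval_hom_comb (polynomials A) X (hom_type Sig f) = \<zero>\<^bsub>polynomials A\<^esub>"
proof -
  note F = finsupp_series[OF A identity_morphism, of "\<lambda>_. 0"]
  let ?e = "eval_hom_comb (polynomials A) X (hom_type Sig f)"
  have e: "?e \<in> carrier (polynomials A)" by (rule eval_hom_comb_closed[OF hom_algebra_polynomials f X])
  have ec: "?e b \<in> carrier A" for b by (rule series_closed[OF A identity_morphism e])
  have fin: "finite {b. ?e b \<noteq> \<zero>\<^bsub>A\<^esub>}"
    using e by (simp add: series_simps[OF A identity_morphism] finsupp_def)
  then obtain B where B: "{b. ?e b \<noteq> \<zero>\<^bsub>A\<^esub>} \<subseteq> {..<B}" using finite_nat_iff_bounded by blast
  have "(\<Oplus>\<^bsub>A\<^esub>b\<in>{..<B}. c [^]\<^bsub>K\<^esub> b \<odot>\<^bsub>A\<^esub> ?e b) = \<zero>\<^bsub>A\<^esub>" if c: "c \<in> carrier K" for c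
  proof -
    let ?\<phi> = "total A A (\<lambda>b y. c [^]\<^bsub>K\<^esub> b \<odot>\<^bsub>A\<^esub> y)"
    have "(\<Oplus>\<^bsub>A\<^esub>b\<in>{..<B}. c [^]\<^bsub>K\<^esub> b \<odot>\<^bsub>A\<^esub> ?e b) = ?\<phi> ?e"
      unfolding total_def using B c ec
      by (intro A.M.add.finprod_mono_neutral_cong_right) auto
    also have "\<dots> = eval_hom_comb A (\<lambda>v. ?\<phi> (X v)) (hom_type Sig f)"
      by (rule eval_hom_comb_morphism[OF hom_algebra_polynomials A evaluation_morphism[OF c] f X])
    also have "\<dots> = \<zero>\<^bsub>A\<^esub>"
    proof -
      have "(\<lambda>v. ?\<phi> (X v)) \<in> UNIV \<rightarrow> carrier A"
        using linear_mapD(1)[OF hom_morphismD(2)[OF evaluation_morphism[OF c]] X] by blast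
      thus ?thesis using sat unfolding satisfies_hom_type_def by blast
    qed
    finally show ?thesis .
  qed
  hence z: "?e b = \<zero>\<^bsub>A\<^esub>" if "b < B" for b
    using polynomial_zero[OF K hom_algebraD(2)[OF A], of ?e B b] ec that by blast
  have "?e b = \<zero>\<^bsub>A\<^esub>" for b using z[of b] B by (cases "b < B") auto
  thus ?thesis by (simp add: series_simps[OF A identity_morphism] fun_eq_iff)
qed

end

section \<open>The untwisted algebra\<close>

abbreviation (input) untwisted ::
  "('k, 'a, 's, 'm) hom_algebra_scheme \<Rightarrow> ('k, nat \<Rightarrow> 'a, 's) hom_algebra" where
  "untwisted A \<equiv> series_algebra A (twist A) (\<lambda>n. n - 1)"

text \<open>The sequence \<open>\<Sum> x\<^sub>b t\<^sup>b\<close> written over the common denominator \<open>N\<close>, that is, with the \<open>N\<close>-th power of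
  the twist cleared. The terms with \<open>b > N\<close> have no such form and are cut off; they do not
  contribute to the coefficients that matter.\<close>

definition align :: "('k, 'a, 's, 'm) hom_algebra_scheme \<Rightarrow> nat \<Rightarrow> (nat \<Rightarrow> 'a) \<Rightarrow> nat \<Rightarrow> 'a" where
  "align A N x = (\<lambda>b. if b \<le> N then (twist A ^^ (N - b)) (x b) else \<zero>\<^bsub>A\<^esub>)"

lemma sum_list_less_nth:
  fixes bs ws :: "nat list"
  assumes "length bs = length ws" "sum_list bs < sum_list ws"
  shows "\<exists>i<length ws. bs ! i < ws ! i"
proof (rule ccontr)
  assume "\<not> ?thesis"
  hence "ws ! i \<le> bs ! i" if "i < length ws" for i using that by (meson not_le)
  hence "sum_list ws \<le> sum_list bs" using assms(1) by (intro sum_list_mono2) simp_all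
  thus False using assms(2) by simp
qed

lemma sum_list_map2_add:
  fixes cs ws :: "nat list"
  shows "length cs = length ws \<Longrightarrow> sum_list (map2 (+) cs ws) = sum_list cs + sum_list ws"
  by (induction cs ws rule: list_induct2) auto

context
  fixes K :: "('k, 'n) ring_scheme" and Sig :: "'s signature"
    and A :: "('k, 'a, 's, 'm) hom_algebra_scheme"
  assumes K: "field K" "char_zero K" and Sig: "signature Sig" and A: "hom_algebra K Sig A"
begin

interpretation A: module K A using hom_algebraD(2)[OF A] .

private abbreviation (input) "U \<equiv> untwisted A"
private abbreviation (input) "P \<equiv> polynomials A"

lemma op_algebra_untwisted: "op_algebra K Sig U"
  by (rule op_algebra_series[OF A twist_morphism[OF K A]])

lemma align_closed:
  assumes "x \<in> carrier U"
  shows "align A N x \<in> carrier P"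
proof -
  have x: "x b \<in> carrier A" for b by (rule series_closed[OF A twist_morphism[OF K A] assms])
  have "align A N x b \<in> carrier A" for b
    using twist_funpow_closed[OF A x] by (simp add: align_def)
  moreover have "{b. align A N x b \<noteq> \<zero>\<^bsub>A\<^esub>} \<subseteq> {..N}" by (auto simp: align_def)
  hence "finite {b. align A N x b \<noteq> \<zero>\<^bsub>A\<^esub>}" by (rule finite_subset) simp
  ultimately show ?thesis
    by (simp add: series_simps[OF A identity_morphism[OF K A]] finsupp_def)
qed

context
  fixes X :: "'v \<Rightarrow> nat \<Rightarrow> 'a"
  assumes X: "\<And>v. X v \<in> carrier U"
begin

lemma eval_untwisted_closed:
  "wf_tree Sig T \<Longrightarrow> eval_tree U X T \<in> carrier U"
  using eval_tree_closed[OF op_algebra_untwisted] X by blast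

text \<open>If the exponents chosen from the values of the subtrees add up to less than the sum of the
  weights, one of them lies below the weight of its subtree.\<close>

lemma eval_untwisted_below:
  assumes "wf_tree Sig T" "d < weight Sig T"
  shows "eval_tree U X T d = \<zero>\<^bsub>A\<^esub>"
  using assms
proof (induction T arbitrary: d)
  case (Node s ts)
  let ?n = "arity Sig s" and ?xs = "map (eval_tree U X) ts" and ?ws = "map (weight Sig) ts"
  have s: "s \<in> syms Sig" and len: "length ts = ?n" using Node.prems by auto
  have wf: "\<forall>v\<in>leaves (Node s ts). X v \<in> carrier U" using X by blast
  have xs: "?xs \<in> args U ?n" by (rule args_eval_tree[OF op_algebra_untwisted Node.prems(1) wf])
  have lxs: "length ?xs = ?n" using len by simp
  have "series_term A (twist A) s ?xs bs = \<zero>\<^bsub>A\<^esub>"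
    if d: "\<not> d < ?n - 1" and bs: "bs \<in> compositions ?n (d - (?n - 1))" for bs
  proof -
    have l: "length bs = ?n" "sum_list bs = d - (?n - 1)" using bs by (auto simp: compositions_def)
    hence "sum_list bs < sum_list ?ws" using Node.prems(2) d by simp
    then obtain i where i: "i < ?n" "bs ! i < weight Sig (ts ! i)"
      using sum_list_less_nth[of bs ?ws] l len by auto
    have "(?xs ! i) (bs ! i) = \<zero>\<^bsub>A\<^esub>" using i len Node.IH[of "ts ! i" "bs ! i"] Node.prems(1) by simp
    thus ?thesis by (rule series_term_zero[OF A twist_morphism[OF K A] s l(1) xs i(1)])
  qed
  hence "finsum A (series_term A (twist A) s ?xs) (compositions ?n (d - (?n - 1))) = \<zero>\<^bsub>A\<^esub>" if "\<not> d < ?n - 1"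
    using that by (intro A.M.add.finprod_one_eqI[simplified]) blast
  thus ?case
    unfolding eval_tree.simps opn_series[OF A twist_morphism[OF K A] lxs] by (cases "d < ?n - 1") simp_all
qed simp

text \<open>A coefficient at \<open>t\<^sup>e\<close> of \<open>A[t]\<close> depends only on coefficients of the arguments up to \<open>t\<^sup>e\<close>, so the
  denominator \<open>e\<close> is large enough, and a larger one, \<open>e + k\<close>, multiplies the value by the \<open>k\<close>-th power of the
  twist. The induction needs all \<open>k\<close>, since the subtrees of a tree
  contribute coefficients \<open>e\<^sub>i \<le> e\<close> over the same denominator.\<close>

lemma eval_untwisted_shift:
  assumes "wf_tree Sig T"
  shows "(twist A ^^ k) (eval_tree U X T (e + weight Sig T)) =
    hom_eval Sig P (\<lambda>v. align A (e + k) (X v)) T e"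
  using assms
proof (induction T arbitrary: e k)
  case (Leaf v)
  thus ?case by (simp add: align_def)
next
  case (Node s ts)
  let ?n = "arity Sig s" and ?xs = "map (eval_tree U X) ts" and ?ws = "map (weight Sig) ts"
  let ?W = "sum_list ?ws" and ?\<theta> = "\<lambda>v. align A (e + k) (X v)"
  let ?F = "series_term A (twist A) s ?xs"
  let ?h = "\<lambda>cs. map2 (+) cs ?ws"
  let ?ys = "map (\<lambda>t. (twist P ^^ (?W - weight Sig t)) (hom_eval Sig P ?\<theta> t)) ts"
  note tm = twist_morphism[OF K A] and im = identity_morphism[OF K A]
  have s: "s \<in> syms Sig" and len: "length ts = ?n" and n: "1 \<le> ?n"
    using Node.prems Sig by (auto simp: signature_def)
  have wf: "\<forall>v\<in>leaves (Node s ts). X v \<in> carrier U" using X by blast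
  have xs: "?xs \<in> args U ?n" by (rule args_eval_tree[OF op_algebra_untwisted Node.prems wf])
  have lxs: "length ?xs = ?n" "length ?ws = ?n" "length ?ys = ?n" using len by simp_all
  have tcl: "?F bs \<in> carrier A" if "length bs = ?n" for bs
    using multilinear_mapD(1)[OF multilinear_series_term[OF A tm s that] xs] .
  have hl: "length (?h cs) = ?n" "sum_list (?h cs) = sum_list cs + ?W" if "length cs = ?n" for cs
    using that lxs by (simp_all add: sum_list_map2_add)
  \<comment> \<open>Only lists with each entry at least the weight of the subtree contribute to the convolution in the
    untwisted algebra, and \<open>?h\<close> identifies them with the lists in the convolution in \<open>A[t]\<close>.\<close>
  have inj: "inj_on ?h (compositions ?n e)"
  proof (rule inj_onI)
    fix cs cs' assume c: "cs \<in> compositions ?n e" "cs' \<in> compositions ?n e" "?h cs = ?h cs'"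
    show "cs = cs'"
    proof (rule nth_equalityI)
      show "length cs = length cs'" using c by (simp add: compositions_def)
      fix i assume i: "i < length cs"
      have "?h cs ! i = ?h cs' ! i" using c(3) by simp
      thus "cs ! i = cs' ! i" using i c(1,2) len by (simp add: compositions_def)
    qed
  qed
  have sub: "?h ` compositions ?n e \<subseteq> compositions ?n (e + ?W)"
    using hl by (auto simp: compositions_def)
  have out: "?F bs = \<zero>\<^bsub>A\<^esub>" if bs: "bs \<in> compositions ?n (e + ?W) - ?h ` compositions ?n e" for bs
  proof -
    have l: "length bs = ?n" "sum_list bs = e + ?W" using bs by (auto simp: compositions_def)
    have "\<exists>i<?n. bs ! i < weight Sig (ts ! i)"
    proof (rule ccontr)
      assume "\<not> ?thesis"
      hence ge: "weight Sig (ts ! i) \<le> bs ! i" if "i < ?n" for i using that by auto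
      let ?cs = "map2 (-) bs ?ws"
      have lcs: "length ?cs = ?n" using l lxs by simp
      have eq: "bs = ?h ?cs" using l len ge by (intro nth_equalityI) simp_all
      hence "sum_list ?cs = e" using hl(2)[OF lcs] l by simp
      hence "?cs \<in> compositions ?n e" using lcs by (simp add: compositions_def)
      thus False using bs eq by blast
    qed
    then obtain i where i: "i < ?n" "bs ! i < weight Sig (ts ! i)" by blast
    have "(?xs ! i) (bs ! i) = \<zero>\<^bsub>A\<^esub>" using i len eval_untwisted_below[of "ts ! i" "bs ! i"] Node.prems by simp
    thus ?thesis by (rule series_term_zero[OF A tm s l(1) xs i(1)])
  qed
  have tterm: "(twist A ^^ k) (?F (?h cs)) = series_term A (\<lambda>x. x) s ?ys cs" if cs: "cs \<in> compositions ?n e" for cs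
  proof -
    have l: "length cs = ?n" "sum_list cs = e" using cs by (auto simp: compositions_def)
    let ?zs = "map2 (\<lambda>b x. (twist A ^^ (sum_list (?h cs) - b)) (x b)) (?h cs) ?xs"
    have zs: "?zs \<in> args A ?n"
    proof -
      have "?zs ! i \<in> carrier A" if "i < ?n" for i
      proof -
        have "(?xs ! i) (?h cs ! i) \<in> carrier A" by (rule series_closed[OF A tm args_nth[OF xs that]])
        from twist_funpow_closed[OF A this] show ?thesis using that l lxs by simp
      qed
      thus ?thesis using l lxs by (auto simp: args_def in_set_conv_nth)
    qed
    have "(twist A ^^ k) (?F (?h cs)) = opn A s (map (twist A ^^ k) ?zs)"
      unfolding series_term_def by (rule op_morphismD(2)[OF op_morphism_twist_funpow[OF A] s zs])
    also have "map (twist A ^^ k) ?zs = map2 (\<lambda>b x. ((\<lambda>x. x) ^^ (sum_list cs - b)) (x b)) cs ?ys"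
    proof (rule nth_equalityI)
      show "length (map (twist A ^^ k) ?zs) = length (map2 (\<lambda>b x. ((\<lambda>x. x) ^^ (sum_list cs - b)) (x b)) cs ?ys)"
        using l lxs by simp
      fix i assume "i < length (map (twist A ^^ k) ?zs)"
      hence i: "i < ?n" using l lxs by simp
      let ?t = "ts ! i"
      have t: "?t \<in> set ts" using i len by simp
      hence wft: "wf_tree Sig ?t" using Node.prems by simp
      have le: "cs ! i \<le> e" "weight Sig ?t \<le> ?W"
        using l i t member_le_sum_list[of "cs ! i" cs] member_le_sum_list[of "weight Sig ?t" ?ws] by auto
      have tw: "(twist P ^^ j) y b = (twist A ^^ j) (y b)" for j y b
        by (induction j arbitrary: b) (simp_all add: series_algebra_def)
      have IH: "(twist A ^^ (e + k - cs ! i)) (eval_tree U X ?t (cs ! i + weight Sig ?t)) =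
          hom_eval Sig P ?\<theta> ?t (cs ! i)"
        using Node.IH[OF t wft, of "e + k - cs ! i" "cs ! i"] le by simp
      have "map (twist A ^^ k) ?zs ! i =
          (twist A ^^ k) ((twist A ^^ (e + ?W - (cs ! i + weight Sig ?t))) (eval_tree U X ?t (cs ! i + weight Sig ?t)))"
        using i l lxs by (simp add: hl)
      also have "\<dots> = (twist A ^^ (k + (e + ?W - (cs ! i + weight Sig ?t)))) (eval_tree U X ?t (cs ! i + weight Sig ?t))"
        by (simp only: funpow_add comp_apply)
      \<comment> \<open>Both sides apply the twist equally often: the weights of the other subtrees appear once through the
        exponents of the untwisted algebra, once through the exponents of the Hom-type tree.\<close>
      also have "k + (e + ?W - (cs ! i + weight Sig ?t)) = (?W - weight Sig ?t) + (e + k - cs ! i)"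
        using le by simp
      also have "(twist A ^^ \<dots>) (eval_tree U X ?t (cs ! i + weight Sig ?t)) =
          (twist A ^^ (?W - weight Sig ?t)) (hom_eval Sig P ?\<theta> ?t (cs ! i))"
        by (simp only: funpow_add comp_apply IH)
      also have "\<dots> = map2 (\<lambda>b x. ((\<lambda>x. x) ^^ (sum_list cs - b)) (x b)) cs ?ys ! i"
        using i l lxs by (simp add: tw funpow_identity)
      finally show "map (twist A ^^ k) ?zs ! i = map2 (\<lambda>b x. ((\<lambda>x. x) ^^ (sum_list cs - b)) (x b)) cs ?ys ! i" .
    qed
    finally show ?thesis by (simp only: series_term_def)
  qed
  have e: "e + weight Sig (Node s ts) - (?n - 1) = e + ?W" "\<not> e + weight Sig (Node s ts) < ?n - 1" by simp_all
  have "eval_tree U X (Node s ts) (e + weight Sig (Node s ts)) = finsum A ?F (compositions ?n (e + ?W))"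
    unfolding eval_tree.simps opn_series[OF A tm lxs(1)] e(1) using e(2) by (simp only: if_False)
  also have "\<dots> = finsum A ?F (?h ` compositions ?n e)"
    using tcl out sub by (intro A.M.add.finprod_mono_neutral_cong_right finite_compositions)
      (auto simp: compositions_def)
  also have "\<dots> = finsum A (\<lambda>cs. ?F (?h cs)) (compositions ?n e)"
    using tcl hl(1) by (intro A.M.add.finprod_reindex inj) (auto simp: compositions_def)
  finally have "(twist A ^^ k) (eval_tree U X (Node s ts) (e + weight Sig (Node s ts))) =
      (twist A ^^ k) (finsum A (\<lambda>cs. ?F (?h cs)) (compositions ?n e))" by (rule arg_cong)
  also have "\<dots> = finsum A (\<lambda>cs. (twist A ^^ k) (?F (?h cs))) (compositions ?n e)"
    using tcl hl(1)
    by (intro linear_map_finsum[OF hom_algebraD(2)[OF A] hom_algebraD(2)[OF A]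
          linear_map_funpow[OF hom_algebraD(3)[OF A]]]) (auto simp: compositions_def)
  also have "\<dots> = finsum A (series_term A (\<lambda>x. x) s ?ys) (compositions ?n e)"
  proof (rule A.M.finsum_cong'[OF refl])
    show "series_term A (\<lambda>x. x) s ?ys \<in> compositions ?n e \<rightarrow> carrier A"
    proof
      fix cs assume cs: "cs \<in> compositions ?n e"
      hence "length cs = ?n" by (simp add: compositions_def)
      hence "?F (?h cs) \<in> carrier A" by (intro tcl hl(1))
      from twist_funpow_closed[OF A this, of k]
      show "series_term A (\<lambda>x. x) s ?ys cs \<in> carrier A" unfolding tterm[OF cs, symmetric] .
    qed
  qed (rule tterm)
  also have "\<dots> = opn P s ?ys e"
    unfolding opn_series[OF A im lxs(3)] by simp
  also have "opn P s ?ys = hom_eval Sig P ?\<theta> (Node s ts)"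
    by (rule hom_eval_Node[OF hom_algebra_polynomials[OF K A] Node.prems align_closed[OF X], symmetric])
  finally show ?case .
qed

lemma eval_untwisted_homogeneous:
  assumes "comb_in K Sig UNIV f" "\<forall>(c, T)\<in>set f. weight Sig T = w"
  shows "eval_comb U X f d = (if d < w then \<zero>\<^bsub>A\<^esub>
    else eval_hom_comb P (\<lambda>v. align A (d - w) (X v)) (hom_type Sig f) (d - w))"
  using assms
proof (induction f)
  case Nil
  show ?case
    by (simp add: eval_hom_comb_simps series_simps[OF A twist_morphism[OF K A]]
        series_simps[OF A identity_morphism[OF K A]])
next
  case (Cons cT f)
  obtain c T where cT: "cT = (c, T)" by (cases cT)
  have c: "c \<in> carrier K" and T: "wf_tree Sig T" "weight Sig T = w" and f: "comb_in K Sig UNIV f"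
    "\<forall>(c, T)\<in>set f. weight Sig T = w"
    using Cons.prems by (auto simp: cT comb_in_def)
  show ?case
  proof (cases "d < w")
    case True
    have "eval_tree U X T d = \<zero>\<^bsub>A\<^esub>" using eval_untwisted_below[OF T(1)] T(2) True by simp
    thus ?thesis
      using Cons.IH[OF f] True c by (simp add: cT series_simps[OF A twist_morphism[OF K A]])
  next
    case False
    have "eval_tree U X T d = hom_eval Sig P (\<lambda>v. align A (d - w) (X v)) T (d - w)"
      using eval_untwisted_shift[OF T(1), of 0 "d - w"] T(2) False by simp
    thus ?thesis
      using Cons.IH[OF f] False
      by (simp add: cT eval_hom_comb_simps series_simps[OF A twist_morphism[OF K A]]
          series_simps[OF A identity_morphism[OF K A]])
  qed
qed

end

text \<open>The shift of \<open>eval_untwisted_shift\<close> and the denominator depend on the weight of the tree, hence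
  the restriction to homogeneous components.\<close>

lemma untwisted_satisfies:
  assumes f: "identity K Sig f" and sat: "\<And>w. satisfies_hom_type Sig A (component Sig w f)"
  shows "satisfies U f"
  unfolding satisfies_def
proof
  fix X :: "nat \<Rightarrow> nat \<Rightarrow> 'a" assume "X \<in> UNIV \<rightarrow> carrier U"
  hence X: "X v \<in> carrier U" for v by blast
  note rs = series_simps[OF A twist_morphism[OF K A], of "\<lambda>n. n - 1"]
  interpret U: module K U using op_algebraD(1)[OF op_algebra_untwisted] .
  have cf: "comb_in K Sig UNIV f" using f by (auto simp: identity_def comb_in_def)
  have comp: "eval_comb U X (component Sig w f) = \<zero>\<^bsub>U\<^esub>" for w
  proof
    fix d
    let ?f = "component Sig w f"
    have "\<forall>(c, T)\<in>set ?f. weight Sig T = w" by (auto simp: component_def)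
    from eval_untwisted_homogeneous[OF X comb_in_component[OF cf] this]
    have "eval_comb U X ?f d = (if d < w then \<zero>\<^bsub>A\<^esub>
      else eval_hom_comb P (\<lambda>v. align A (d - w) (X v)) (hom_type Sig ?f) (d - w))" .
    also have "eval_hom_comb P (\<lambda>v. align A (d - w) (X v)) (hom_type Sig ?f) = \<zero>\<^bsub>P\<^esub>"
      by (rule polynomials_satisfy[OF K A identity_component[OF f] sat align_closed[OF X]])
    finally show "eval_comb U X ?f d = \<zero>\<^bsub>U\<^esub> d"
      unfolding rs(2) series_simps(2)[OF A identity_morphism[OF K A]] by simp
  qed
  have "eval_comb U X f = finsum U (\<lambda>w. eval_comb U X (component Sig w f)) (weight Sig ` snd ` set f)"
    using X by (intro eval_comb_components[OF op_algebra_untwisted cf, symmetric]) force+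
  also have "\<dots> = \<zero>\<^bsub>U\<^esub>" unfolding comp by (rule U.M.finsum_zero)
  finally show "eval_comb U X f = \<zero>\<^bsub>U\<^esub>" .
qed

lemma eval_untwisted_constant:
  assumes \<theta>: "\<And>v. \<theta> v \<in> carrier A" and "wf_tree Sig T"
  shows "eval_tree U (\<lambda>v. single A 0 (\<theta> v)) T = single A (weight Sig T) (hom_eval Sig A \<theta> T)"
  using assms(2)
proof (induction T)
  case (Node s ts)
  let ?ws = "map (weight Sig) ts" and ?hs = "map (hom_eval Sig A \<theta>) ts"
  have s: "s \<in> syms Sig" and len: "length ?ws = arity Sig s" "length ts = arity Sig s"
    using Node.prems by auto
  have hs: "?hs \<in> args A (arity Sig s)"
    using Node.prems by (auto simp: args_def intro!: hom_eval_closed[OF A _ \<theta>])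
  have "map (eval_tree U (\<lambda>v. single A 0 (\<theta> v))) ts = map (\<lambda>t. single A (weight Sig t) (hom_eval Sig A \<theta> t)) ts"
    using Node by (intro map_cong refl) simp
  also have "\<dots> = map2 (single A) ?ws ?hs" by (intro nth_equalityI) simp_all
  finally have "eval_tree U (\<lambda>v. single A 0 (\<theta> v)) (Node s ts) = opn U s (map2 (single A) ?ws ?hs)" by simp
  also have "\<dots> = single A (sum_list ?ws + (arity Sig s - 1))
      (opn A s (map2 (\<lambda>b y. (twist A ^^ (sum_list ?ws - b)) y) ?ws ?hs))"
    by (rule opn_series_single[OF A twist_morphism[OF K A] s len(1) hs])
  also have "map2 (\<lambda>b y. (twist A ^^ (sum_list ?ws - b)) y) ?ws ?hs =
      map (\<lambda>t. (twist A ^^ (sum_list ?ws - weight Sig t)) (hom_eval Sig A \<theta> t)) ts"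
    by (intro nth_equalityI) simp_all
  also have "opn A s \<dots> = hom_eval Sig A \<theta> (Node s ts)"
    by (rule hom_eval_Node[OF A Node.prems \<theta>, symmetric])
  finally show ?case by (simp add: add.commute)
qed simp

text \<open>At constants, the values of the trees are monomials in degrees that depend on the tree. The sum of all
  coefficients is a linear map that forgets these degrees.\<close>

lemma satisfies_hom_type_if_untwisted:
  assumes f: "identity K Sig f" and sat: "satisfies U f"
  shows "satisfies_hom_type Sig A f"
  unfolding satisfies_hom_type_def
proof
  fix \<theta> :: "nat \<Rightarrow> 'a" assume "\<theta> \<in> UNIV \<rightarrow> carrier A"
  hence \<theta>: "\<theta> v \<in> carrier A" for v by blast
  note tm = twist_morphism[OF K A]
  note F = finsupp_series[OF A tm, of "\<lambda>n. n - 1"]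
  let ?X = "\<lambda>v. single A 0 (\<theta> v)"
  let ?\<sigma> = "total A A (\<lambda>(b :: nat) y. y)"
  have id: "linear_map K A A (\<lambda>y. y)" by (simp add: linear_map_def)
  have l: "linear_map K U A ?\<sigma>" by (rule linear_map_total[OF hom_algebraD(2)[OF A] F hom_algebraD(2)[OF A] id])
  have X: "?X v \<in> carrier U" for v
    using finsupp_single[OF hom_algebraD(2)[OF A] F UNIV_I \<theta>] by (simp add: series_simps[OF A tm])
  have "?\<sigma> (eval_comb U ?X g) = eval_hom_comb A \<theta> (hom_type Sig g)" if "identity K Sig g" for g
    using that
  proof (induction g)
    case Nil
    show ?case
      using linear_map_zero[OF module_series[OF A tm] hom_algebraD(2)[OF A] l] by (simp add: eval_hom_comb_simps)
  next
    case (Cons cT g)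
    obtain c T where cT: "cT = (c, T)" by (cases cT)
    have c: "c \<in> carrier K" and T: "wf_tree Sig T" and g: "identity K Sig g"
      using Cons.prems by (auto simp: cT identity_def)
    have cl: "eval_tree U ?X T \<in> carrier U" by (rule eval_untwisted_closed[OF X T])
    have "comb_in K Sig UNIV g" using g by (auto simp: identity_def comb_in_def)
    hence cl': "eval_comb U ?X g \<in> carrier U" using X by (intro eval_comb_closed[OF op_algebra_untwisted]) auto
    have "?\<sigma> (eval_tree U ?X T) = hom_eval Sig A \<theta> T"
      unfolding eval_untwisted_constant[OF \<theta> T]
      by (rule total_single[OF hom_algebraD(2)[OF A] F hom_algebraD(2)[OF A] id UNIV_I hom_eval_closed[OF A T \<theta>]])
    thus ?case
      using Cons.IH[OF g] linear_mapD(2)[OF l module.smult_closed[OF module_series[OF A tm] c cl] cl']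
        linear_mapD(3)[OF l c cl]
      by (simp add: cT eval_hom_comb_simps)
  qed
  moreover have "eval_comb U ?X f = \<zero>\<^bsub>U\<^esub>" using sat X unfolding satisfies_def by blast
  ultimately show "eval_hom_comb A \<theta> (hom_type Sig f) = \<zero>\<^bsub>A\<^esub>"
    using f linear_map_zero[OF module_series[OF A tm] hom_algebraD(2)[OF A] l] by metis
qed

end

section \<open>Transport of structure\<close>

lemma transport_algebra:
  fixes A :: "('k, 'a, 's, 'm) op_algebra_scheme" and j :: "'a \<Rightarrow> 'u"
  assumes A: "op_algebra K Sig A" and inj: "inj_on j (carrier A)"
  shows "\<exists>C :: ('k, 'u, 's) op_algebra. op_algebra K Sig C \<and> op_morphism K Sig A C j \<and>
    j ` carrier A = carrier C"
proof -
  interpret A: module K A using op_algebraD(1)[OF A] .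
  define i where "i = inv_into (carrier A) j"
  have i: "i (j x) = x" if "x \<in> carrier A" for x using inj that by (simp add: i_def)
  define C :: "('k, 'u, 's) op_algebra" where
    "C = \<lparr>carrier = j ` carrier A, mult = undefined, one = undefined, zero = j \<zero>\<^bsub>A\<^esub>,
      add = (\<lambda>x y. j (i x \<oplus>\<^bsub>A\<^esub> i y)), smult = (\<lambda>c x. j (c \<odot>\<^bsub>A\<^esub> i x)),
      opn = (\<lambda>s xs. j (opn A s (map i xs)))\<rparr>"
  have "map (\<lambda>x. i (j x)) xs = xs" if "xs \<in> args A n" for xs n
    using that i by (intro map_idI) (auto simp: args_def)
  hence m: "op_morphism K Sig A C j"
    by (simp add: op_morphism_def linear_map_def C_def i comp_def)
  have "j ` carrier A = carrier C" "j \<zero>\<^bsub>A\<^esub> = \<zero>\<^bsub>C\<^esub>" by (simp_all add: C_def)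
  thus ?thesis using op_algebra_surjective_image[OF A m] m by blast
qed

lemma satisfies_surjective_image:
  fixes A :: "('k, 'a, 's, 'm) op_algebra_scheme" and C :: "('k, 'b, 's, 'l) op_algebra_scheme"
  assumes A: "op_algebra K Sig A" and C: "op_algebra K Sig C" and j: "op_morphism K Sig A C j"
    and surj: "j ` carrier A = carrier C" and f: "identity K Sig f" and sat: "satisfies A f"
  shows "satisfies C f"
  unfolding satisfies_def
proof
  fix \<theta> :: "nat \<Rightarrow> 'b" assume \<theta>: "\<theta> \<in> UNIV \<rightarrow> carrier C"
  have \<theta>A: "\<theta> v \<in> j ` carrier A" for v using \<theta> surj by auto
  define \<eta> where "\<eta> v = inv_into (carrier A) j (\<theta> v)" for v
  have \<eta>: "\<eta> v \<in> carrier A" "j (\<eta> v) = \<theta> v" for v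
    unfolding \<eta>_def by (rule inv_into_into[OF \<theta>A], rule f_inv_into_f[OF \<theta>A])
  have "comb_in K Sig UNIV f" using f by (auto simp: identity_def comb_in_def)
  hence "j (eval_comb A \<eta> f) = eval_comb C (\<lambda>v. j (\<eta> v)) f"
    by (rule eval_comb_morphism[OF A C j]) (simp add: \<eta>(1))
  moreover have "eval_comb A \<eta> f = \<zero>\<^bsub>A\<^esub>" using bspec[OF sat[unfolded satisfies_def], of \<eta>] \<eta>(1) by simp
  ultimately show "eval_comb C \<theta> f = \<zero>\<^bsub>C\<^esub>"
    using linear_map_zero[OF op_algebraD(1)[OF A] op_algebraD(1)[OF C] op_morphismD(1)[OF j]]
    by (simp add: \<eta>(2))
qed

lemma satisfies_injective_preimage:
  fixes A :: "('k, 'a, 's, 'm) op_algebra_scheme" and C :: "('k, 'b, 's, 'l) op_algebra_scheme"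
  assumes A: "op_algebra K Sig A" and C: "op_algebra K Sig C" and j: "op_morphism K Sig A C j"
    and inj: "inj_on j (carrier A)" and f: "identity K Sig f" and sat: "satisfies C f"
  shows "satisfies A f"
  unfolding satisfies_def
proof
  interpret A: module K A using op_algebraD(1)[OF A] .
  fix \<theta> :: "nat \<Rightarrow> 'a" assume \<theta>: "\<theta> \<in> UNIV \<rightarrow> carrier A"
  have \<theta>': "\<theta> v \<in> carrier A" for v using \<theta> by blast
  have ci: "comb_in K Sig UNIV f" using f by (auto simp: identity_def comb_in_def)
  have cl: "eval_comb A \<theta> f \<in> carrier A" by (rule eval_comb_closed[OF A ci]) (simp add: \<theta>')
  have "j (eval_comb A \<theta> f) = eval_comb C (\<lambda>v. j (\<theta> v)) f"
    by (rule eval_comb_morphism[OF A C j ci]) (simp add: \<theta>')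
  also have "(\<lambda>v. j (\<theta> v)) \<in> UNIV \<rightarrow> carrier C" using linear_mapD(1)[OF op_morphismD(1)[OF j] \<theta>'] by blast
  hence "eval_comb C (\<lambda>v. j (\<theta> v)) f = \<zero>\<^bsub>C\<^esub>" by (rule bspec[OF sat[unfolded satisfies_def]])
  also have "\<dots> = j \<zero>\<^bsub>A\<^esub>"
    by (rule linear_map_zero[OF op_algebraD(1)[OF A] op_algebraD(1)[OF C] op_morphismD(1)[OF j], symmetric])
  finally show "eval_comb A \<theta> f = \<zero>\<^bsub>A\<^esub>" using inj cl by (simp add: inj_on_def)
qed

lemma infinite_module:
  fixes K :: "('k, 'n) ring_scheme" (structure) and M :: "('k, 'u, 'm) module_scheme"
  assumes "field K" "char_zero K" "module K M" "x \<in> carrier M" "x \<noteq> \<zero>\<^bsub>M\<^esub>"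
  shows "infinite (UNIV :: 'u set)"
proof -
  interpret K: field K by fact
  interpret M: module K M by fact
  let ?f = "\<lambda>n :: nat. ([n] \<cdot> \<one>) \<odot>\<^bsub>M\<^esub> x"
  have "inj ?f"
  proof (rule injI)
    fix m n :: nat assume eq: "?f m = ?f n"
    let ?m = "[m] \<cdot> \<one>" and ?n = "[n] \<cdot> \<one>"
    have cl: "?m \<in> carrier K" "?n \<in> carrier K" by simp_all
    have "(?m \<oplus> \<ominus> ?n) \<odot>\<^bsub>M\<^esub> x = ?n \<odot>\<^bsub>M\<^esub> x \<oplus>\<^bsub>M\<^esub> \<ominus>\<^bsub>M\<^esub> (?n \<odot>\<^bsub>M\<^esub> x)"
      using cl assms(4) eq by (simp add: M.smult_l_distr M.smult_l_minus)
    also have "\<dots> = \<zero>\<^bsub>M\<^esub>" using cl assms(4) by (simp add: M.M.r_neg)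
    finally have zero: "(?m \<oplus> \<ominus> ?n) \<odot>\<^bsub>M\<^esub> x = \<zero>\<^bsub>M\<^esub>" .
    have dcl: "?m \<oplus> \<ominus> ?n \<in> carrier K" using cl by simp
    have "?m \<oplus> \<ominus> ?n = \<zero>"
      by (rule ccontr) (use smult_eq_zero[OF assms(1,3) dcl assms(4) zero] assms(5) in simp)
    hence "\<ominus> (\<ominus> ?n) = ?m" using cl by (intro K.minus_equality) simp_all
    hence "?m = ?n" using cl by simp
    thus "m = n" by (rule char_zero_add_pow_inj[OF K.cring_axioms assms(2)])
  qed
  hence "infinite (range ?f)" by (rule range_inj_infinite)
  thus ?thesis by (rule infinite_super[OF subset_UNIV])
qed

text \<open>The code of a sequence consists of the length of the shortest initial segment that contains the support
  and the values on this segment, folded by a pairing function. Folded lists can be told apart only if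
  their lengths agree, which is why the length is part of the code.\<close>

lemma finitely_supported_sequences_inject:
  fixes z :: 'u
  assumes inf: "infinite (UNIV :: 'u set)"
  shows "\<exists>j :: (nat \<Rightarrow> 'u) \<Rightarrow> 'u. inj_on j {x. finite {b. x b \<noteq> z}}"
proof -
  obtain pair :: "'u \<times> 'u \<Rightarrow> 'u" where "bij_betw pair (UNIV \<times> UNIV) UNIV"
    using card_of_Times_same_infinite[OF inf, THEN card_of_ordIso[THEN iffD2]] by (elim exE)
  hence "inj pair" by (simp add: bij_betw_def)
  note pair = inj_eq[OF this]
  obtain emb :: "nat \<Rightarrow> 'u" where emb: "inj emb"
    using infinite_countable_subset[OF inf] by (elim exE conjE)
  define enc where "enc xs = foldr (\<lambda>x u. pair (x, u)) xs z" for xs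
  have enc: "length xs = length ys \<Longrightarrow> enc xs = enc ys \<Longrightarrow> xs = ys" for xs ys
  proof (induction xs ys rule: list_induct2)
    case (Cons x xs y ys)
    have "pair (x, enc xs) = pair (y, enc ys)" using Cons.prems by (simp add: enc_def)
    hence "x = y" "enc xs = enc ys" unfolding pair by simp_all
    thus ?case using Cons.IH by simp
  qed simp
  define N where "N x = (LEAST n. \<forall>b\<ge>n. x b = z)" for x :: "nat \<Rightarrow> 'u"
  have N: "\<forall>b\<ge>N x. x b = z" if fin: "finite {b. x b \<noteq> z}" for x
  proof -
    obtain n where n: "{b. x b \<noteq> z} \<subseteq> {..<n}" using fin unfolding finite_nat_iff_bounded by (elim exE)
    have "x b = z" if "b \<ge> n" for b
    proof (rule ccontr)
      assume "x b \<noteq> z"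
      hence "b \<in> {..<n}" using n by blast
      thus False using that by simp
    qed
    hence "\<forall>b\<ge>n. x b = z" by blast
    thus ?thesis unfolding N_def by (rule LeastI)
  qed
  define j where "j x = pair (emb (N x), enc (map x [0..<N x]))" for x
  have "inj_on j {x. finite {b. x b \<noteq> z}}"
  proof (rule inj_onI)
    fix x y assume x: "x \<in> {x. finite {b. x b \<noteq> z}}" and y: "y \<in> {x. finite {b. x b \<noteq> z}}"
      and eq: "j x = j y"
    have "(emb (N x), enc (map x [0..<N x])) = (emb (N y), enc (map y [0..<N y]))"
      using eq unfolding j_def pair .
    hence *: "N x = N y \<and> enc (map x [0..<N x]) = enc (map y [0..<N y])"
      unfolding prod.inject inj_eq[OF emb] .
    note n = conjunct1[OF *] and en = conjunct2[OF *]
    have l: "map x [0..<N x] = map y [0..<N x]" using n enc[OF _ en] by simp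
    show "x = y"
    proof
      fix b show "x b = y b"
      proof (cases "b < N x")
        case True
        hence "map x [0..<N x] ! b = map y [0..<N x] ! b" "b < length [0..<N x]" using l by simp_all
        thus ?thesis by simp
      next
        case False
        hence "N x \<le> b" "N y \<le> b" using n by simp_all
        moreover have "\<forall>b\<ge>N x. x b = z" "\<forall>b\<ge>N y. y b = z" using N x y by blast+
        ultimately show ?thesis by simp
      qed
    qed
  qed
  thus ?thesis by blast
qed

theorem theorem1p12:
  fixes K :: "'k ring" and Sig :: "'s signature" and I :: "('k, 's) identity set"
  assumes "field K" and "char_zero K"
    and "signature Sig" and "\<forall>g\<in>I. identity K Sig g"
    and "\<forall>(V :: ('k, 'u) module) \<alpha>. module K V \<longrightarrow> linear_endo K V \<alpha> \<longrightarrow>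
           pos_graded K Sig (free_hom_variety_algebra K Sig I V \<alpha>)
             (free_hom_variety_generators K Sig I V \<alpha>)"
  shows "\<forall>f. identity K Sig f \<longrightarrow>
           (\<forall>A :: ('k, 'u, 's) op_algebra. variety_algebra K Sig I A \<longrightarrow> satisfies A f) \<longrightarrow>
           (\<forall>A :: ('k, 'u, 's) hom_algebra. hom_variety_algebra K Sig I A \<longrightarrow>
              satisfies_hom_type Sig A f)"
proof (intro allI impI)
  fix f and A :: "('k, 'u, 's) hom_algebra"
  assume f: "identity K Sig f"
    and sat: "\<forall>A :: ('k, 'u, 's) op_algebra. variety_algebra K Sig I A \<longrightarrow> satisfies A f"
    and A: "hom_variety_algebra K Sig I A"
  have A': "hom_algebra K Sig A" using A unfolding hom_variety_algebra_def by (rule conjunct1)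
  let ?R = "untwisted A"
  note tm = twist_morphism[OF assms(1,2) A']
  show "satisfies_hom_type Sig A f"
  proof (cases "carrier A \<subseteq> {\<zero>\<^bsub>A\<^esub>}")
    case True
    \<comment> \<open>The type may be too small for the transport here, but all values of the identity are zero.\<close>
    show ?thesis
      unfolding satisfies_hom_type_def
    proof
      fix \<theta> :: "nat \<Rightarrow> 'u" assume "\<theta> \<in> UNIV \<rightarrow> carrier A"
      hence "\<theta> v \<in> carrier A" for v by blast
      from subsetD[OF True eval_hom_comb_closed[OF A' f this]]
      show "eval_hom_comb A \<theta> (hom_type Sig f) = \<zero>\<^bsub>A\<^esub>" by (simp only: singleton_iff)
    qed
  next
    case False
    then obtain x where "x \<in> carrier A" "x \<noteq> \<zero>\<^bsub>A\<^esub>" by blast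
    hence inf: "infinite (UNIV :: 'u set)" by (rule infinite_module[OF assms(1,2) hom_algebraD(2)[OF A']])
    obtain j :: "(nat \<Rightarrow> 'u) \<Rightarrow> 'u" where "inj_on j {x. finite {b. x b \<noteq> \<zero>\<^bsub>A\<^esub>}}"
      using finitely_supported_sequences_inject[OF inf, of "\<zero>\<^bsub>A\<^esub>"] by (elim exE)
    moreover have "carrier ?R \<subseteq> {x. finite {b. x b \<noteq> \<zero>\<^bsub>A\<^esub>}}"
      by (auto simp: series_algebra_def finsupp_def)
    ultimately have inj: "inj_on j (carrier ?R)" by (rule inj_on_subset)
    have R: "op_algebra K Sig ?R" by (rule op_algebra_untwisted[OF assms(1-3) A'])
    obtain C :: "('k, 'u, 's) op_algebra" where C: "op_algebra K Sig C" "op_morphism K Sig ?R C j"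
      "j ` carrier ?R = carrier C"
      using transport_algebra[OF R inj] by (elim exE conjE)
    have "satisfies C g" if g: "g \<in> I" for g
    proof -
      have gi: "identity K Sig g" using assms(4) g by blast
      have "satisfies ?R g"
        by (rule untwisted_satisfies[OF assms(1-3) A' gi
              hom_variety_satisfies_component[OF assms(3,4,5) A g]])
      thus ?thesis by (rule satisfies_surjective_image[OF R C gi])
    qed
    hence "satisfies C f" using sat C(1) by (simp add: variety_algebra_def)
    hence "satisfies ?R f" by (rule satisfies_injective_preimage[OF R C(1,2) inj f])
    thus ?thesis by (rule satisfies_hom_type_if_untwisted[OF assms(1-3) A' f])
  qed
qed

end
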